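(* Let $-\infty<a<b<\infty$ and let $p,q,r,s$ be real-valued Lebesgue measurable functions on $(a,b)$ with $p>0$ and $r>0$ a.e. on $(a,b)$ and $p^{-1},q,r,s\in L^1((a,b);dx)$ (that is, the associated differential expression $\tau$ is regular on $(a,b)$). Let $(c,d)\subset(a,b)$ with $c<d$ be strictly contained in $(a,b)$, that is, either $a\leq c$ and $d<b$, or else $a<c$ and $d\leq b$. Let $T_{F,(a,b)}$ and $T_{F,(c,d)}$ denote the Friedrichs extensions of the minimal operators $T_{min,(a,b)}$ in $L^2((a,b);r\,dx)$ and $T_{min,(c,d)}$ in $L^2((c,d);r\,dx)$ associated with $\tau$ and with the restriction $\tau|_{(c,d)}$, respectively. Then the lowest eigenvalues satisfy $$\lambda_1(T_{F,(a,b)})<\lambda_1(T_{F,(c,d)}).$$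
   Context: For an open interval $(\alpha,\beta)\subseteq(a,b)$, $AC_{loc}((\alpha,\beta))$ denotes the locally absolutely continuous complex-valued functions on $(\alpha,\beta)$. Given the coefficients $p,q,r,s$, set $$\mathfrak{D}_\tau((\alpha,\beta))=\{g\in AC_{loc}((\alpha,\beta)) : g^{[1]}:=p[g'+sg]\in AC_{loc}((\alpha,\beta))\}$$ (more precisely, $p[g'+sg]$ agrees a.e. with a locally absolutely continuous function, denoted $g^{[1]}$ and called the first quasi-derivative of $g$), and $$\tau f=\frac1r\Big(-\big(f^{[1]}\big)'+s f^{[1]}+qf\Big),\quad f\in\mathfrak{D}_\tau((\alpha,\beta)).$$ The expression $\tau|_{(\alpha,\beta)}$ is obtained by restricting all coefficients to $(\alpha,\beta)$. The Hilbert space is $L^2((\alpha,\beta);r\,dx)$ with inner product $(f,g)=\int_\alpha^\beta \overline{f(x)}g(x)\,r(x)\,dx$. The maximal operator $T_{max,(\alpha,\beta)}$ acts as $f\mapsto\tau f$ on the domain of all $g\in L^2((\alpha,\beta);r\,dx)\cap\mathfrak{D}_\tau((\alpha,\beta))$ with $\tau g\in L^2((\alpha,\beta);r\,dx)$. The minimal operator $T_{min,(\alpha,\beta)}$ is the closure of the restriction of $T_{max,(\alpha,\beta)}$ to those functions in its domain that have compact support in $(\alpha,\beta)$; it is a densely defined closed symmetric operator. In the regular case considered here, $T_{min,(\alpha,\beta)}$ is bounded from below, so that it has a Friedrichs extension $T_{F,(\alpha,\beta)}$ (the self-adjoint operator associated with the closure of the quadratic form $f\mapsto(f,T_{min,(\alpha,\beta)}f)$,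 $f\in\operatorname{dom}(T_{min,(\alpha,\beta)})$), and the spectrum of $T_{F,(\alpha,\beta)}$ is purely discrete. $\lambda_1(T_{F,(\alpha,\beta)})$ denotes its smallest eigenvalue. *)

theory Defs
  imports "HOL-Analysis.Analysis"
begin

section \<open>Operators and forms in an $L^2$ space\<close>

text \<open>
  Elements of $L^2(M)$ are represented by functions, with almost everywhere equality in place
  of equality. An operator is represented by its graph, a set of pairs of functions; all graphs
  defined below, apart from generic arguments, are invariant under changing either component
  on a null set. The inner product is conjugate linear in its first argument.
\<close>

definition L2 :: "'a measure \<Rightarrow> ('a \<Rightarrow> complex) set" where
  "L2 M = {f. f \<in> borel_measurable M \<and> integrable M (\<lambda>x. (cmod (f x))\<^sup>2)}"

definition L2_inner :: "'a measure \<Rightarrow> ('a \<Rightarrow> complex) \<Rightarrow> ('a \<Rightarrow> complex) \<Rightarrow> complex" where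
  "L2_inner M f g = (\<integral>x. cnj (f x) * g x \<partial>M)"

definition L2_norm :: "'a measure \<Rightarrow> ('a \<Rightarrow> complex) \<Rightarrow> real" where
  "L2_norm M f = sqrt (\<integral>x. (cmod (f x))\<^sup>2 \<partial>M)"

definition L2_tendsto :: "'a measure \<Rightarrow> (nat \<Rightarrow> 'a \<Rightarrow> complex) \<Rightarrow> ('a \<Rightarrow> complex) \<Rightarrow> bool" where
  "L2_tendsto M F f \<longleftrightarrow> (\<lambda>n. L2_norm M (\<lambda>x. F n x - f x)) \<longlonglongrightarrow> 0"

definition op_closure :: "'a measure \<Rightarrow> ('a \<Rightarrow> complex) rel \<Rightarrow> ('a \<Rightarrow> complex) rel" where
  "op_closure M T = {(f, h). f \<in> L2 M \<and> h \<in> L2 M \<and>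
     (\<exists>F H. (\<forall>n. (F n, H n) \<in> T) \<and> L2_tendsto M F f \<and> L2_tendsto M H h)}"

text \<open>The value \<open>T f\<close>, determined up to a null set if \<open>T\<close> is (the graph of) an operator.\<close>

definition op_apply :: "('a \<Rightarrow> complex) rel \<Rightarrow> ('a \<Rightarrow> complex) \<Rightarrow> 'a \<Rightarrow> complex" where
  "op_apply T f = (SOME h. (f, h) \<in> T)"

text \<open>The sesquilinear form of \<open>T\<close>, with quadratic form \<open>f \<mapsto> (f, T f)\<close> on the diagonal.\<close>

definition op_form :: "'a measure \<Rightarrow> ('a \<Rightarrow> complex) rel \<Rightarrow>
    ('a \<Rightarrow> complex) \<Rightarrow> ('a \<Rightarrow> complex) \<Rightarrow> complex" where
  "op_form M T f g = L2_inner M f (op_apply T g)"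

text \<open>
  Form convergence $F_n \to f$: besides $L^2$ convergence, $t[F_m - F_n] \to 0$ as
  $m, n \to \infty$. For a form that is bounded from below this says that $F_n$ is Cauchy in
  the form norm.
\<close>

definition form_tendsto :: "'a measure \<Rightarrow> ('a \<Rightarrow> complex) rel \<Rightarrow>
    (nat \<Rightarrow> 'a \<Rightarrow> complex) \<Rightarrow> ('a \<Rightarrow> complex) \<Rightarrow> bool" where
  "form_tendsto M T F f \<longleftrightarrow> (\<forall>n. F n \<in> Domain T) \<and> f \<in> L2 M \<and> L2_tendsto M F f \<and>
     (\<forall>e>0. \<exists>N. \<forall>m\<ge>N. \<forall>n\<ge>N.
        cmod (op_form M T (\<lambda>x. F m x - F n x) (\<lambda>x. F m x - F n x)) < e)"

definition closed_form_dom :: "'a measure \<Rightarrow> ('a \<Rightarrow> complex) rel \<Rightarrow> ('a \<Rightarrow> complex) set" where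
  "closed_form_dom M T = {f. \<exists>F. form_tendsto M T F f}"

definition closed_form :: "'a measure \<Rightarrow> ('a \<Rightarrow> complex) rel \<Rightarrow>
    ('a \<Rightarrow> complex) \<Rightarrow> ('a \<Rightarrow> complex) \<Rightarrow> complex" where
  "closed_form M T f g = (THE z. \<forall>F G. form_tendsto M T F f \<longrightarrow> form_tendsto M T G g \<longrightarrow>
     (\<lambda>n. op_form M T (F n) (G n)) \<longlonglongrightarrow> z)"

text \<open>
  The operator associated with the closure of the form of \<open>T\<close> (first representation theorem).
  It is the Friedrichs extension when \<open>T\<close> is densely defined, symmetric and bounded from below.
\<close>

definition friedrichs :: "'a measure \<Rightarrow> ('a \<Rightarrow> complex) rel \<Rightarrow> ('a \<Rightarrow> complex) rel" where
  "friedrichs M T = {(f, h). f \<in> closed_form_dom M T \<and> h \<in> L2 M \<and>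
     (\<forall>g \<in> closed_form_dom M T. closed_form M T g f = L2_inner M g h)}"

definition is_eigenvalue :: "'a measure \<Rightarrow> ('a \<Rightarrow> complex) rel \<Rightarrow> complex \<Rightarrow> bool" where
  "is_eigenvalue M T z \<longleftrightarrow>
     (\<exists>f \<in> L2 M. \<not> (AE x in M. f x = 0) \<and> (f, \<lambda>x. z * f x) \<in> T)"

definition lowest_eigenvalue :: "'a measure \<Rightarrow> ('a \<Rightarrow> complex) rel \<Rightarrow> real" where
  "lowest_eigenvalue M T = (LEAST l. is_eigenvalue M T (complex_of_real l))"


section \<open>Sturm--Liouville operators\<close>

text \<open>
  A division is a finite family of nonoverlapping compact intervals; \<open>Inf\<close> and \<open>Sup\<close> are
  the endpoints.
\<close>

definition absolutely_continuous_on :: "real set \<Rightarrow> (real \<Rightarrow> complex) \<Rightarrow> bool" where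
  "absolutely_continuous_on S f \<longleftrightarrow>
     (\<forall>e>0. \<exists>d>0. \<forall>D. D division_of (\<Union>D) \<longrightarrow> \<Union>D \<subseteq> S \<longrightarrow>
        (\<Sum>K\<in>D. Sup K - Inf K) < d \<longrightarrow> (\<Sum>K\<in>D. norm (f (Sup K) - f (Inf K))) < e)"

definition AC_loc :: "real \<Rightarrow> real \<Rightarrow> (real \<Rightarrow> complex) set" where
  "AC_loc \<alpha> \<beta> = {f. \<forall>x y. \<alpha> < x \<longrightarrow> x < y \<longrightarrow> y < \<beta> \<longrightarrow> absolutely_continuous_on {x..y} f}"

text \<open>
  \<open>w\<close> is a locally absolutely continuous representative of $p[g' + s g]$. Where \<open>g\<close> is not
  differentiable, which is a null set for \<open>g\<close> in \<open>AC_loc\<close>, \<open>vector_derivative\<close> is arbitrary.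
\<close>

definition is_quasi_deriv :: "(real \<Rightarrow> real) \<Rightarrow> (real \<Rightarrow> real) \<Rightarrow> real \<Rightarrow> real \<Rightarrow>
    (real \<Rightarrow> complex) \<Rightarrow> (real \<Rightarrow> complex) \<Rightarrow> bool" where
  "is_quasi_deriv p s \<alpha> \<beta> g w \<longleftrightarrow> w \<in> AC_loc \<alpha> \<beta> \<and>
     (AE x in lebesgue_on {\<alpha><..<\<beta>}.
        w x = p x *\<^sub>R (vector_derivative g (at x) + s x *\<^sub>R g x))"

text \<open>Unique on the open interval by continuity, arbitrary outside.\<close>

definition quasi_deriv :: "(real \<Rightarrow> real) \<Rightarrow> (real \<Rightarrow> real) \<Rightarrow> real \<Rightarrow> real \<Rightarrow>
    (real \<Rightarrow> complex) \<Rightarrow> real \<Rightarrow> complex" where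
  "quasi_deriv p s \<alpha> \<beta> g = (SOME w. is_quasi_deriv p s \<alpha> \<beta> g w)"

definition D_tau :: "(real \<Rightarrow> real) \<Rightarrow> (real \<Rightarrow> real) \<Rightarrow> real \<Rightarrow> real \<Rightarrow> (real \<Rightarrow> complex) set" where
  "D_tau p s \<alpha> \<beta> = {g \<in> AC_loc \<alpha> \<beta>. \<exists>w. is_quasi_deriv p s \<alpha> \<beta> g w}"

definition tau :: "(real \<Rightarrow> real) \<Rightarrow> (real \<Rightarrow> real) \<Rightarrow> (real \<Rightarrow> real) \<Rightarrow> (real \<Rightarrow> real) \<Rightarrow>
    real \<Rightarrow> real \<Rightarrow> (real \<Rightarrow> complex) \<Rightarrow> real \<Rightarrow> complex" where
  "tau p q r s \<alpha> \<beta> f x = (1 / r x) *\<^sub>R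
     (- vector_derivative (quasi_deriv p s \<alpha> \<beta> f) (at x)
      + s x *\<^sub>R quasi_deriv p s \<alpha> \<beta> f x + q x *\<^sub>R f x)"

definition weighted :: "(real \<Rightarrow> real) \<Rightarrow> real \<Rightarrow> real \<Rightarrow> real measure" where
  "weighted r \<alpha> \<beta> = density (lebesgue_on {\<alpha><..<\<beta>}) (\<lambda>x. ennreal (r x))"

definition T_max :: "(real \<Rightarrow> real) \<Rightarrow> (real \<Rightarrow> real) \<Rightarrow> (real \<Rightarrow> real) \<Rightarrow> (real \<Rightarrow> real) \<Rightarrow>
    real \<Rightarrow> real \<Rightarrow> (real \<Rightarrow> complex) rel" where
  "T_max p q r s \<alpha> \<beta> = {(f, h). f \<in> L2 (weighted r \<alpha> \<beta>) \<and> h \<in> L2 (weighted r \<alpha> \<beta>) \<and>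
     (\<exists>g \<in> D_tau p s \<alpha> \<beta>. (AE x in weighted r \<alpha> \<beta>. f x = g x) \<and>
        (AE x in weighted r \<alpha> \<beta>. h x = tau p q r s \<alpha> \<beta> g x))}"

definition T_min :: "(real \<Rightarrow> real) \<Rightarrow> (real \<Rightarrow> real) \<Rightarrow> (real \<Rightarrow> real) \<Rightarrow> (real \<Rightarrow> real) \<Rightarrow>
    real \<Rightarrow> real \<Rightarrow> (real \<Rightarrow> complex) rel" where
  "T_min p q r s \<alpha> \<beta> = op_closure (weighted r \<alpha> \<beta>)
     {(f, h) \<in> T_max p q r s \<alpha> \<beta>.
        \<exists>K. compact K \<and> K \<subseteq> {\<alpha><..<\<beta>} \<and> (AE x in weighted r \<alpha> \<beta>. x \<notin> K \<longrightarrow> f x = 0)}"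

definition T_F :: "(real \<Rightarrow> real) \<Rightarrow> (real \<Rightarrow> real) \<Rightarrow> (real \<Rightarrow> real) \<Rightarrow> (real \<Rightarrow> real) \<Rightarrow>
    real \<Rightarrow> real \<Rightarrow> (real \<Rightarrow> complex) rel" where
  "T_F p q r s \<alpha> \<beta> = friedrichs (weighted r \<alpha> \<beta>) (T_min p q r s \<alpha> \<beta>)"

end

theory Submission
  imports Defs "HOL-Complex_Analysis.Great_Picard"
begin

text \<open>
  The lowest eigenvalue of the Friedrichs extension is the infimum of the Rayleigh quotient over
  the compactly supported part of the maximal operator: the form is semibounded and sets bounded
  in the form norm are relatively compact in $L^2$ (a uniform bound together with
  equicontinuity, hence Arzela--Ascoli), so minimizing sequences subconverge, and their limits
  are eigenfunctions. Extension by zero maps the compactly supported functions on $(c,d)$ to those on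
  $(a,b)$, which gives the weak inequality. If equality held, the ground state on $(c,d)$ extended
  by zero would be a weak eigenfunction on $(a,b)$; testing it against compactly supported
  solutions of the inhomogeneous equation shows that it solves the homogeneous one, and since it
  vanishes on a nonempty open interval it vanishes identically, a contradiction.

  Absolutely continuous functions are handled by passing to their variation function, whose
  Stieltjes measure has a Radon--Nikodym density.
\<close>

section \<open>Variation of absolutely continuous functions\<close>

text \<open>The coefficients are merely integrable, so smooth functions need not lie in the domain
  of the expression and no explicit test functions are available. Every compactly supported element
  that the argument needs is therefore produced by solving an initial value problem. A solution with
  zero initial data has to return to zero, which is two linear conditions on the right-hand side; so
  the admissible right-hand sides miss only a two-dimensional space, spanned by the conjugated
  homogeneous solutions.

  For the same reason the form domain is never identified with a function space. Three facts are
  drawn from the Friedrichs construction: the weak identity against the original operator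
  (\<open>friedrichs_inner\<close>), the lower bound for eigenvalues
  (\<open>friedrichs_eigenvalue_ge\<close>), and the rule that a form-convergent sequence whose
  shifted form tends to 0 has an eigenfunction as limit
  (\<open>friedrichs_bound_eigenfunction\<close>). Since the weak identity says nothing about the
  regularity of an eigenfunction, unique continuation is proved for elements of L^2 that satisfy
  it.\<close>

definition var_sum :: "(real \<Rightarrow> 'b::real_normed_vector) \<Rightarrow> real set set \<Rightarrow> real" where
  "var_sum f D = (\<Sum>K\<in>D. norm (f (Sup K) - f (Inf K)))"

text \<open>The set \<open>A\<close> is arbitrary, not just an interval: absolute continuity
  controls finite unions \<open>\<Union>D\<close>, and it is the variation over such a union that
  gets bounded. Values in \<open>ennreal\<close> postpone the question of finiteness to
  \<open>variation_finite\<close>.\<close>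

definition variation :: "(real \<Rightarrow> 'b::real_normed_vector) \<Rightarrow> real set \<Rightarrow> ennreal" where
  "variation f A = (SUP D\<in>{D. D division_of \<Union>D \<and> \<Union>D \<subseteq> A}. ennreal (var_sum f D))"

lemma var_sum_nonneg: "0 \<le> var_sum f D"
  by (simp add: var_sum_def sum_nonneg)

lemma division_real_interval:
  fixes D :: "real set set"
  assumes "D division_of S" "K \<in> D"
  obtains u v where "u \<le> v" "K = {u..v}" "Inf K = u" "Sup K = v"
  using assms by (metis atLeastatMost_empty_iff box_real(2) cInf_atLeastAtMost cSup_atLeastAtMost division_ofD(3,4))

lemma singleton_division:
  fixes u v :: real
  assumes "u \<le> v" shows "{{u..v}} division_of \<Union>{{u..v}}"
  using assms by (metis box_real(2) ccpo_Sup_singleton division_of_self atLeastatMost_empty_iff2 linorder_not_less)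

lemma sum_lengths_division:
  fixes D :: "real set set"
  assumes "D division_of \<Union>D"
  shows "(\<Sum>K\<in>D. Sup K - Inf K) = measure lebesgue (\<Union>D)"
proof -
  have "(\<Sum>K\<in>D. Sup K - Inf K) = (\<Sum>K\<in>D. measure lebesgue K)"
  proof (rule sum.cong[OF refl])
    fix K assume "K \<in> D"
    then obtain u v where "u \<le> v" "K = {u..v}" "Inf K = u" "Sup K = v"
      by (rule division_real_interval[OF assms])
    then show "Sup K - Inf K = measure lebesgue K" by simp
  qed
  then show ?thesis using content_division[OF assms] by simp
qed

lemma variation_upper:
  "D division_of \<Union>D \<Longrightarrow> \<Union>D \<subseteq> A \<Longrightarrow> ennreal (var_sum f D) \<le> variation f A"
  unfolding variation_def by (rule SUP_upper) auto

lemma variation_mono: "A \<subseteq> B \<Longrightarrow> variation f A \<le> variation f B"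
  unfolding variation_def by (rule SUP_subset_mono) auto

lemma variation_least:
  assumes "\<And>D. D division_of \<Union>D \<Longrightarrow> \<Union>D \<subseteq> A \<Longrightarrow> ennreal (var_sum f D) \<le> C"
  shows "variation f A \<le> C"
  unfolding variation_def using assms by (auto intro: SUP_least)

lemma norm_diff_le_variation:
  assumes "x \<le> y" "{x..y} \<subseteq> A"
  shows "ennreal (norm (f y - f x)) \<le> variation f A"
proof -
  show ?thesis
    using variation_upper[OF singleton_division[OF assms(1)], of A f] assms by (simp add: var_sum_def)
qed

text \<open>A division inside \<open>A\<close> and one inside \<open>B\<close> unite to a division
  inside \<open>A \<union> B\<close>, because disjointness of interiors passes to subsets.\<close>

lemma variation_Un_superadditive:
  assumes "interior A \<inter> interior B = {}"
  shows "variation f A + variation f B \<le> variation f (A \<union> B)"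
proof -
  let ?X = "\<lambda>A. {D::real set set. D division_of \<Union>D \<and> \<Union>D \<subseteq> A}"
  have ne: "?X A \<noteq> {}" for A
    by (rule ex_in_conv[THEN iffD1], rule exI[of _ "{}"]) simp
  have *: "ennreal (var_sum f D) + ennreal (var_sum f E) \<le> variation f (A \<union> B)"
    if D: "D \<in> ?X A" and E: "E \<in> ?X B" for D E
  proof -
    have int: "interior (\<Union>D) \<inter> interior (\<Union>E) = {}"
      using assms D E interior_mono[of "\<Union>D" A] interior_mono[of "\<Union>E" B] by blast
    have div: "(D \<union> E) division_of \<Union>(D \<union> E)"
      using division_disjoint_union[of D "\<Union>D" E "\<Union>E"] D E int by auto
    have fin: "finite D" "finite E" using D E by auto
    \<comment> \<open>As sets of intervals, \<open>D\<close> and \<open>E\<close> may share members,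
      which the union counts only once. A shared member has empty interior, so it is a point and
      contributes no increment.\<close>
    have zero: "(\<Sum>K\<in>D \<inter> E. norm (f (Sup K) - f (Inf K))) = 0"
    proof (rule sum.neutral, rule ballI)
      fix K assume K: "K \<in> D \<inter> E"
      then obtain u v where uv: "u \<le> v" "K = {u..v}" "Inf K = u" "Sup K = v"
        using D by (auto elim!: division_real_interval)
      have "interior K \<subseteq> interior (\<Union>D) \<inter> interior (\<Union>E)"
        using K interior_mono[of K "\<Union>D"] interior_mono[of K "\<Union>E"] by auto
      then have "interior K = {}" using int by auto
      then have "{u<..<v} = {}" using uv by simp
      then have "u = v" using uv(1) by simp
      then show "norm (f (Sup K) - f (Inf K)) = 0" using uv by simp
    qed
    have "var_sum f D + var_sum f E = var_sum f (D \<union> E)"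
      unfolding var_sum_def using sum.union_inter[OF fin, of "\<lambda>K. norm (f (Sup K) - f (Inf K))"] zero by simp
    then have "ennreal (var_sum f D) + ennreal (var_sum f E) = ennreal (var_sum f (D \<union> E))"
      by (metis ennreal_plus var_sum_nonneg)
    also have "\<dots> \<le> variation f (A \<union> B)"
      using D E by (intro variation_upper div) auto
    finally show ?thesis .
  qed
  have 1: "ennreal (var_sum f D) + variation f B \<le> variation f (A \<union> B)" if "D \<in> ?X A" for D
  proof -
    have "ennreal (var_sum f D) + variation f B = (SUP E\<in>?X B. ennreal (var_sum f D) + ennreal (var_sum f E))"
      unfolding variation_def by (rule ennreal_SUP_add_right[OF ne])
    also have "\<dots> \<le> variation f (A \<union> B)"
      using *[OF that] by (intro SUP_least)
    finally show ?thesis .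
  qed
  have "variation f A + variation f B = (SUP D\<in>?X A. ennreal (var_sum f D) + variation f B)"
    unfolding variation_def[of f A] by (rule ennreal_SUP_add_left[OF ne, symmetric])
  also have "\<dots> \<le> variation f (A \<union> B)"
    using 1 by (intro SUP_least)
  finally show ?thesis .
qed

lemma sum_variation_le:
  fixes D :: "real set set"
  assumes "D division_of \<Union>D"
  shows "(\<Sum>K\<in>D. variation f K) \<le> variation f (\<Union>D)"
proof -
  have "finite D" using assms by auto
  then show ?thesis using assms
  proof (induction D rule: finite_induct)
    case empty then show ?case by simp
  next
    case (insert K D)
    have D: "D division_of \<Union>D" using division_of_subset[OF insert.prems] by blast
    have "interior K \<inter> interior (\<Union>D) = {}"
    proof (rule Int_interior_Union_intervals)
      show "\<And>T. T \<in> D \<Longrightarrow> \<exists>a b. T = cbox a b" by (rule division_ofD(4)[OF D])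
      show "\<And>T. T \<in> D \<Longrightarrow> interior K \<inter> interior T = {}"
        using insert.prems insert.hyps by (metis division_ofD(5) insertCI)
    qed (use insert in auto)
    from variation_Un_superadditive[OF this, of f] show ?case
      using insert.IH[OF D] insert.hyps
      by (simp add: add_left_mono order_trans[rotated])
  qed
qed

text \<open>Used with \<open>C\<close> a closed half-line, to cut a division at a point. Distinct
  members have disjoint interiors, so they can have the same trace on \<open>C\<close> only if that
  trace is a point; its increment is 0, and summing over traces is the same as summing over
  members.\<close>

lemma var_sum_split:
  fixes D :: "real set set"
  assumes D: "D division_of \<Union>D" and cl: "\<And>u v. \<exists>u' v'. {u..v} \<inter> C = {u'..v'}"
  shows "((\<lambda>K. K \<inter> C) ` {K\<in>D. K \<inter> C \<noteq> {}}) division_of \<Union>((\<lambda>K. K \<inter> C) ` {K\<in>D. K \<inter> C \<noteq> {}})" (is "?E division_of _")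
    and "var_sum f ((\<lambda>K. K \<inter> C) ` {K\<in>D. K \<inter> C \<noteq> {}}) =
      (\<Sum>K\<in>{K\<in>D. K \<inter> C \<noteq> {}}. norm (f (Sup (K \<inter> C)) - f (Inf (K \<inter> C))))"
proof -
  have fin: "finite D" using D by auto
  have form: "\<exists>u v. K \<inter> C = {u..v}" if "K \<in> D" for K
    using division_real_interval[OF D that] cl by metis
  have dis: "interior (K1 \<inter> C) \<inter> interior (K2 \<inter> C) = {}" if "K1 \<in> D" "K2 \<in> D" "K1 \<noteq> K2" for K1 K2
    using division_ofD(5)[OF D that] by (auto simp: interior_Int)
  show "?E division_of \<Union>?E"
  proof (rule division_ofI)
    show "finite ?E" using fin by auto
    show "\<And>K. K \<in> ?E \<Longrightarrow> \<exists>a b. K = cbox a b" using form by auto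
    show "\<And>K1 K2. K1 \<in> ?E \<Longrightarrow> K2 \<in> ?E \<Longrightarrow> K1 \<noteq> K2 \<Longrightarrow> interior K1 \<inter> interior K2 = {}"
      using dis by blast
  qed auto
  show "var_sum f ?E = (\<Sum>K\<in>{K\<in>D. K \<inter> C \<noteq> {}}. norm (f (Sup (K \<inter> C)) - f (Inf (K \<inter> C))))"
    unfolding var_sum_def
  proof (subst sum.reindex_nontrivial)
    show "finite {K\<in>D. K \<inter> C \<noteq> {}}" using fin by auto
    fix K L assume KL: "K \<in> {K \<in> D. K \<inter> C \<noteq> {}}" "L \<in> {K \<in> D. K \<inter> C \<noteq> {}}" "K \<noteq> L" "K \<inter> C = L \<inter> C"
    then obtain u v where uv: "K \<inter> C = {u..v}" using form by blast
    have "interior (K \<inter> C) = {}" using dis[of K L] KL by auto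
    then have "{u<..<v} = {}" "{u..v} \<noteq> {}" using uv KL by auto
    then have "u = v" by simp
    then show "norm (f (Sup (K \<inter> C)) - f (Inf (K \<inter> C))) = 0" using uv by simp
  qed (simp add: o_def)
qed

text \<open>Cutting the members of a division at \<open>y\<close> can only increase the sum of
  increments, by the triangle inequality.\<close>

lemma variation_split_le:
  assumes "x \<le> y" "y \<le> z"
  shows "variation f {x..z} \<le> variation f {x..y} + variation f {y..z}"
proof (rule variation_least)
  fix D :: "real set set" assume D: "D division_of \<Union>D" and sub: "\<Union>D \<subseteq> {x..z}"
  have fin: "finite D" using D by auto
  let ?DL = "{K\<in>D. K \<inter> {..y} \<noteq> {}}" and ?DR = "{K\<in>D. K \<inter> {y..} \<noteq> {}}"
  let ?L = "(\<lambda>K. K \<inter> {..y}) ` ?DL" and ?R = "(\<lambda>K. K \<inter> {y..}) ` ?DR"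
  let ?h = "\<lambda>K. norm (f (Sup K) - f (Inf K))"
  note L = var_sum_split[OF D, of "{..y}"]
  note R = var_sum_split[OF D, of "{y..}"]
  have cL: "\<exists>u' v'. {u..v} \<inter> {..y} = {u'..v'}" for u v
    by (rule exI[of _ u], rule exI[of _ "min v y"]) auto
  have cR: "\<exists>u' v'. {u..v} \<inter> {y..} = {u'..v'}" for u v
    by (rule exI[of _ "max u y"], rule exI[of _ v]) auto
  have "var_sum f D = (\<Sum>K\<in>D. ?h K)" by (simp add: var_sum_def)
  also have "\<dots> \<le> (\<Sum>K\<in>D. (if K \<inter> {..y} \<noteq> {} then ?h (K \<inter> {..y}) else 0) + (if K \<inter> {y..} \<noteq> {} then ?h (K \<inter> {y..}) else 0))"
  proof (rule sum_mono)
    fix K assume "K \<in> D"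
    then obtain u v where uv: "u \<le> v" "K = {u..v}"
      using D by (auto elim!: division_real_interval)
    consider "v < y" | "y < u" | "u \<le> y" "y \<le> v" by linarith
    then show "?h K \<le> (if K \<inter> {..y} \<noteq> {} then ?h (K \<inter> {..y}) else 0) + (if K \<inter> {y..} \<noteq> {} then ?h (K \<inter> {y..}) else 0)"
    proof cases
      case 1 
      then have "K \<inter> {..y} = K" "K \<inter> {y..} = {}" using uv by auto
      then show ?thesis using uv by auto
    next
      case 2
      then have "K \<inter> {..y} = {}" "K \<inter> {y..} = K" using uv by auto
      then show ?thesis using uv by auto
    next
      case 3
      then have "K \<inter> {..y} = {u..y}" "K \<inter> {y..} = {y..v}" using uv by auto
      then show ?thesis using uv 3 norm_triangle_ineq[of "f y - f u" "f v - f y"] by simp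
    qed
  qed
  also have "\<dots> = (\<Sum>K\<in>?DL. ?h (K \<inter> {..y})) + (\<Sum>K\<in>?DR. ?h (K \<inter> {y..}))"
    using fin by (simp only: sum.distrib sum.inter_filter)
  also have "\<dots> = var_sum f ?L + var_sum f ?R"
    by (simp only: L(2)[OF cL] R(2)[OF cR])
  finally have "var_sum f D \<le> var_sum f ?L + var_sum f ?R" .
  from ennreal_leI[OF this] have "ennreal (var_sum f D) \<le> ennreal (var_sum f ?L) + ennreal (var_sum f ?R)"
    by (simp only: ennreal_plus var_sum_nonneg)
  also have "\<dots> \<le> variation f {x..y} + variation f {y..z}"
  proof (rule add_mono)
    show "ennreal (var_sum f ?L) \<le> variation f {x..y}"
      using sub by (intro variation_upper L(1) cL) auto
    show "ennreal (var_sum f ?R) \<le> variation f {y..z}"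
      using sub by (intro variation_upper R(1) cR) auto
  qed
  finally show "ennreal (var_sum f D) \<le> variation f {x..y} + variation f {y..z}" .
qed

lemma variation_split:
  assumes "x \<le> y" "y \<le> z"
  shows "variation f {x..z} = variation f {x..y} + variation f {y..z}"
proof (rule antisym)
  show "variation f {x..y} + variation f {y..z} \<le> variation f {x..z}"
    using variation_Un_superadditive[of "{x..y}" "{y..z}" f] assms
    by (simp add: ivl_disj_un_two_touch)
qed (use variation_split_le assms in auto)

text \<open>A division inside \<open>\<Union>D\<close> has total length at most that of
  \<open>D\<close>. Hence the \<open>d\<close> that works for single sums works for their supremum,
  at the price of a weak inequality.\<close>

lemma absolutely_continuous_on_variation:
  assumes "absolutely_continuous_on S f" "0 < e"
  obtains d where "0 < d"
    "\<And>D. D division_of \<Union>D \<Longrightarrow> \<Union>D \<subseteq> S \<Longrightarrow> (\<Sum>K\<in>D. Sup K - Inf K) < d \<Longrightarrow> variation f (\<Union>D) \<le> ennreal e"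
proof -
  obtain d where d: "0 < d" "\<And>D. D division_of \<Union>D \<Longrightarrow> \<Union>D \<subseteq> S \<Longrightarrow> (\<Sum>K\<in>D. Sup K - Inf K) < d \<Longrightarrow> var_sum f D < e"
    using assms unfolding absolutely_continuous_on_def var_sum_def by blast
  show thesis
  proof (rule that[OF d(1)], rule variation_least)
    fix D E :: "real set set" assume D: "D division_of \<Union>D" "\<Union>D \<subseteq> S" "(\<Sum>K\<in>D. Sup K - Inf K) < d"
      and E: "E division_of \<Union>E" "\<Union>E \<subseteq> \<Union>D"
    have "measure lebesgue (\<Union>E) \<le> measure lebesgue (\<Union>D)"
      using D E by (intro measure_mono_fmeasurable lmeasurable_division[OF D(1)] fmeasurableD[OF lmeasurable_division[OF E(1)]])
    then have "(\<Sum>K\<in>E. Sup K - Inf K) < d" using D(3) sum_lengths_division[OF D(1)] sum_lengths_division[OF E(1)] by simp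
    then have "var_sum f E < e" using d(2)[OF E(1)] E(2) D(2) by blast
    then show "ennreal (var_sum f E) \<le> ennreal e" by (simp add: ennreal_leI)
  qed
qed

text \<open>The variation is at most 1 on every interval shorter than some \<open>d\<close>;
  finitely many steps of length \<open>d / 2\<close>, joined by \<open>variation_split\<close>,
  reach \<open>y\<close>.\<close>

lemma variation_finite:
  assumes ac: "absolutely_continuous_on {x..y} f"
  shows "variation f {x..y} < top"
proof (cases "x \<le> y")
  case False
  then have "variation f {x..y} \<le> 0"
  proof (intro variation_least)
    fix D :: "real set set" assume D: "D division_of \<Union>D" "\<Union>D \<subseteq> {x..y}"
    have "D = {}" using division_ofD(3)[OF D(1)] D(2) False by fastforce
    then show "ennreal (var_sum f D) \<le> 0" by (simp add: var_sum_def)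
  qed
  then show ?thesis by simp
next
  case True
  obtain d where d: "0 < d" "\<And>D. D division_of \<Union>D \<Longrightarrow> \<Union>D \<subseteq> {x..y} \<Longrightarrow> (\<Sum>K\<in>D. Sup K - Inf K) < d \<Longrightarrow> variation f (\<Union>D) \<le> ennreal 1"
    using absolutely_continuous_on_variation[OF ac zero_less_one] by metis
  define h where "h = d / 2"
  have h: "0 < h" "h < d" using d by (auto simp: h_def)
  have small: "variation f {u..v} < top" if "u \<le> v" "v \<le> u + h" "x \<le> u" "v \<le> y" for u v
  proof -
    from d(2)[OF singleton_division[OF that(1)]] show ?thesis using that h by (simp add: le_less_trans)
  qed
  have "\<forall>t. x \<le> t \<and> t \<le> y \<and> t \<le> x + real n * h \<longrightarrow> variation f {x..t} < top" for n
  proof (induction n)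
    case 0 then show ?case using small[of x x] h by auto
  next
    case (Suc n)
    show ?case
    proof (intro allI impI)
      fix t assume t: "x \<le> t \<and> t \<le> y \<and> t \<le> x + real (Suc n) * h"
      define u where "u = max x (t - h)"
      have u: "x \<le> u" "u \<le> t" "u \<le> y" "t \<le> u + h" "u \<le> x + real n * h"
        using t h by (auto simp: u_def algebra_simps)
      show "variation f {x..t} < top"
        using variation_split[OF u(1,2), of f] small[of u t] Suc u t by auto
    qed
  qed
  moreover obtain n where "y - x \<le> real n * h"
    using h by (metis ex_less_of_nat_mult less_eq_real_def)
  ultimately show ?thesis using True by (metis add.commute diff_le_eq order_refl)
qed

lemma variation_finite_subset:
  assumes "absolutely_continuous_on {x..y} f" "A \<subseteq> {x..y}"
  shows "variation f A < top"
  using variation_mono[OF assms(2)] variation_finite[OF assms(1)] by (rule le_less_trans)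

definition var_fun :: "real \<Rightarrow> (real \<Rightarrow> 'b::real_normed_vector) \<Rightarrow> real \<Rightarrow> real" where
  "var_fun x f t = enn2real (variation f {x..t})"

lemma var_fun_diff:
  assumes ac: "absolutely_continuous_on {x..y} f" and "x \<le> s" "s \<le> t" "t \<le> y"
  shows "ennreal (var_fun x f t - var_fun x f s) = variation f {s..t}"
proof -
  have fin: "variation f {x..t} < top" "variation f {x..s} < top" "variation f {s..t} < top"
    using assms by (auto intro!: variation_finite_subset[OF ac])
  then have "var_fun x f t = var_fun x f s + enn2real (variation f {s..t})"
    unfolding var_fun_def using variation_split[OF assms(2,3), of f] by (simp add: enn2real_plus)
  then show ?thesis using fin by simp
qed

lemma norm_diff_le_var_fun:
  assumes ac: "absolutely_continuous_on {x..y} f" and "x \<le> s" "s \<le> t" "t \<le> y"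
  shows "norm (f t - f s) \<le> var_fun x f t - var_fun x f s"
proof -
  have "ennreal (norm (f t - f s)) \<le> ennreal (var_fun x f t - var_fun x f s)"
    using norm_diff_le_variation[of s t "{s..t}" f] var_fun_diff[OF assms] assms by simp
  moreover have "variation f {s..t} < top"
    using assms by (auto intro!: variation_finite_subset[OF ac])
  moreover have "var_fun x f s \<le> var_fun x f t"
    unfolding var_fun_def using assms
    by (intro enn2real_mono variation_mono) (auto intro!: variation_finite_subset[OF ac])
  ultimately show ?thesis by simp
qed

text \<open>The increment of \<open>var_fun\<close> over a member of \<open>D\<close> is the
  variation over that member, and superadditivity bounds the sum of these by the variation over
  \<open>\<Union>D\<close>.\<close>

lemma absolutely_continuous_var_fun:
  assumes ac: "absolutely_continuous_on {x..y} f" and "0 < e"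
  obtains d where "0 < d" "\<And>D. D division_of \<Union>D \<Longrightarrow> \<Union>D \<subseteq> {x..y} \<Longrightarrow> (\<Sum>K\<in>D. Sup K - Inf K) < d \<Longrightarrow>
    (\<Sum>K\<in>D. var_fun x f (Sup K) - var_fun x f (Inf K)) \<le> e"
proof -
  obtain d where d: "0 < d" "\<And>D. D division_of \<Union>D \<Longrightarrow> \<Union>D \<subseteq> {x..y} \<Longrightarrow> (\<Sum>K\<in>D. Sup K - Inf K) < d \<Longrightarrow> variation f (\<Union>D) \<le> ennreal e"
    using absolutely_continuous_on_variation[OF assms] by metis
  show thesis
  proof (rule that[OF d(1)])
    fix D :: "real set set" assume D: "D division_of \<Union>D" "\<Union>D \<subseteq> {x..y}" "(\<Sum>K\<in>D. Sup K - Inf K) < d"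
    have K: "0 \<le> var_fun x f (Sup K) - var_fun x f (Inf K) \<and> ennreal (var_fun x f (Sup K) - var_fun x f (Inf K)) = variation f K" if KD: "K \<in> D" for K
    proof -
      obtain u v where uv: "u \<le> v" "K = {u..v}" "Inf K = u" "Sup K = v"
        by (rule division_real_interval[OF D(1) KD])
      then have "x \<le> u" "v \<le> y" using D(2) KD by force+
      then show ?thesis using var_fun_diff[OF ac, of u v] norm_diff_le_var_fun[OF ac, of u v] uv
        by (metis norm_ge_zero order_trans)
    qed
    have "ennreal (\<Sum>K\<in>D. var_fun x f (Sup K) - var_fun x f (Inf K)) = (\<Sum>K\<in>D. variation f K)"
      using K by (subst sum_ennreal[symmetric]) auto
    also have "\<dots> \<le> ennreal e"
      using sum_variation_le[OF D(1)] d(2)[OF D] by (rule order_trans)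
    finally show "(\<Sum>K\<in>D. var_fun x f (Sup K) - var_fun x f (Inf K)) \<le> e"
      using \<open>0 < e\<close> by simp
  qed
qed

section \<open>Absolutely continuous functions as integrals\<close>

lemma integrable_imp_set_integrable:
  fixes f :: "'a \<Rightarrow> 'b::{banach, second_countable_topology}"
  shows "integrable M f \<Longrightarrow> A \<in> sets M \<Longrightarrow> set_integrable M A f"
  unfolding set_integrable_def by (rule integrable_mult_indicator)

text \<open>A finite subcover by small intervals, clipped to \<open>[x, y]\<close>. It turns a
  compact part of an open set into a finite division, the only kind of set that the definition of
  absolute continuity speaks about.\<close>

lemma compact_open_division:
  fixes K U :: "real set"
  assumes "compact K" "open U" "K \<subseteq> U" "K \<subseteq> {x..y}"
  obtains D where "D division_of \<Union>D" "K \<subseteq> \<Union>D" "\<Union>D \<subseteq> U" "\<Union>D \<subseteq> {x..y}"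
proof -
  have "\<exists>e>0. {k - e..k + e} \<subseteq> U" if kK: "k \<in> K" for k
  proof -
    obtain e where "e > 0" "cball k e \<subseteq> U"
      using open_contains_cball_eq[OF \<open>open U\<close>] assms(3) kK by (meson subsetD)
    then show ?thesis by (auto simp: cball_eq_atLeastAtMost)
  qed
  then obtain e where e: "\<And>k. k \<in> K \<Longrightarrow> e k > 0" "\<And>k. k \<in> K \<Longrightarrow> {k - e k..k + e k} \<subseteq> U"
    by metis
  obtain F where F: "F \<subseteq> K" "finite F" "K \<subseteq> (\<Union>k\<in>F. {k - e k<..<k + e k})"
  proof (rule compactE_image[OF \<open>compact K\<close>])
    show "\<And>k. k \<in> K \<Longrightarrow> open {k - e k<..<k + e k}" by simp
    show "K \<subseteq> (\<Union>k\<in>K. {k - e k<..<k + e k})" using e by force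
  qed blast
  let ?F = "(\<lambda>k. {max x (k - e k)..min y (k + e k)}) ` F"
  obtain D where D: "D division_of \<Union>?F"
  proof (rule elementary_unions_intervals[of ?F])
    show "finite ?F" using F by simp
    show "\<And>s. s \<in> ?F \<Longrightarrow> \<exists>a b. s = cbox a b" by auto
  qed blast
  have UD: "\<Union>D = \<Union>?F" by (rule division_ofD(6)[OF D])
  show thesis
  proof (rule that[of D])
    show "D division_of \<Union>D" using D UD by simp
    show "K \<subseteq> \<Union>D"
    proof
      fix z assume z: "z \<in> K"
      then obtain k where k: "k \<in> F" "z \<in> {k - e k<..<k + e k}" using F by blast
      moreover have "z \<in> {x..y}" using z assms by blast
      ultimately have "z \<in> {max x (k - e k)..min y (k + e k)}" by auto
      then show "z \<in> \<Union>D" unfolding UD using k by blast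
    qed
    show "\<Union>D \<subseteq> U"
    proof -
      have "{max x (k - e k)..min y (k + e k)} \<subseteq> U" if "k \<in> F" for k
        using e(2)[of k] F(1) that by (force intro: order_trans)
      then show ?thesis unfolding UD by blast
    qed
    show "\<Union>D \<subseteq> {x..y}" unfolding UD by auto
  qed
qed

text \<open>The density is the Radon-Nikodym derivative of the Stieltjes measure of
  \<open>G\<close>; the hypothesis \<open>ac\<close> is exactly what makes Lebesgue null sets null
  for that measure.\<close>

lemma increasing_AC_density:
  fixes G :: "real \<Rightarrow> real"
  assumes xy: "x \<le> y"
    and mono: "\<And>s t. x \<le> s \<Longrightarrow> s \<le> t \<Longrightarrow> t \<le> y \<Longrightarrow> G s \<le> G t"
    and ac: "\<And>e. 0 < e \<Longrightarrow> \<exists>d>0. \<forall>D. D division_of \<Union>D \<longrightarrow> \<Union>D \<subseteq> {x..y} \<longrightarrow>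
        (\<Sum>K\<in>D. Sup K - Inf K) < d \<longrightarrow> (\<Sum>K\<in>D. G (Sup K) - G (Inf K)) \<le> e"
  obtains \<phi> where "integrable lborel \<phi>" "\<And>t. x \<le> t \<Longrightarrow> t \<le> y \<Longrightarrow> G t - G x = (LINT u:{x..t}|lborel. \<phi> u)"
proof -
  \<comment> \<open>Clamping to \<open>[x, y]\<close> makes \<open>G\<close> constant outside, so
    that the Stieltjes measure is finite and carried by the interval.\<close>
  define c where "c t = max x (min y t)" for t
  define H where "H t = G (c t)" for t
  have c: "x \<le> c t" "c t \<le> y" for t using xy by (auto simp: c_def)
  have c_id: "c t = t" if "x \<le> t" "t \<le> y" for t using that by (auto simp: c_def)
  have c_mono: "s \<le> t \<Longrightarrow> c s \<le> c t" for s t by (auto simp: c_def)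
  have H_mono: "s \<le> t \<Longrightarrow> H s \<le> H t" for s t
    unfolding H_def using c c_mono by (intro mono) auto
  have H_cont: "continuous_on UNIV H"
  proof (subst continuous_on_iff, intro ballI allI impI)
    fix t e :: real assume "0 < e"
    then obtain d where d: "d > 0" "\<And>D. D division_of \<Union>D \<Longrightarrow> \<Union>D \<subseteq> {x..y} \<Longrightarrow> 
        (\<Sum>K\<in>D. Sup K - Inf K) < d \<Longrightarrow> (\<Sum>K\<in>D. G (Sup K) - G (Inf K)) \<le> e/2"
      using ac[of "e/2"] by auto
    have *: "H v - H u \<le> e/2" if "u \<le> v" "v - u < d" for u v
    proof -
      from d(2)[OF singleton_division[OF c_mono[OF that(1)]]] show ?thesis
        using c_mono[OF that(1)] c[of u] c[of v] that by (auto simp: H_def c_def)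
    qed
    have "dist (H u) (H t) < e" if "dist u t < d" for u
      using *[of u t] *[of t u] that \<open>0 < e\<close> H_mono[of u t] H_mono[of t u]
      by (cases "u \<le> t") (auto simp: dist_real_def)
    then show "\<exists>d>0. \<forall>u\<in>UNIV. dist u t < d \<longrightarrow> dist (H u) (H t) < e"
      using d(1) by blast
  qed
  define \<mu> where "\<mu> = interval_measure H"
  have sets [simp]: "sets \<mu> = sets borel" "space \<mu> = UNIV" by (auto simp: \<mu>_def)
  have Icc: "emeasure \<mu> {u..v} = ennreal (H v - H u)" if "u \<le> v" for u v
    unfolding \<mu>_def by (rule emeasure_interval_measure_Icc[OF that H_mono H_cont])
  have univ: "emeasure \<mu> UNIV = ennreal (G y - G x)"
  proof -
    have U: "(\<Union>n::nat. {x - real n..y + real n}) = UNIV"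
    proof -
      have "\<exists>n. t \<in> {x - real n..y + real n}" for t
      proof -
        obtain n where "\<bar>t - x\<bar> + \<bar>t - y\<bar> < real n" using reals_Archimedean2 by blast
        then show ?thesis by (intro exI[of _ n]) auto
      qed
      then show ?thesis by auto
    qed
    have "emeasure \<mu> UNIV = (SUP n. emeasure \<mu> {x - real n..y + real n})"
      unfolding U[symmetric] by (rule SUP_emeasure_incseq[symmetric]) (auto simp: incseq_def)
    also have "\<dots> = (SUP n::nat. ennreal (G y - G x))"
      using xy by (subst Icc) (auto simp: H_def c_def)
    finally show ?thesis by simp
  qed
  have xyI: "emeasure \<mu> {x..y} = ennreal (G y - G x)"
    using Icc[OF xy] xy by (simp add: H_def c_id)
  interpret \<mu>: finite_measure \<mu>
    by (rule finite_measureI) (simp add: univ)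
  have compl: "emeasure \<mu> (UNIV - {x..y}) = 0"
    using emeasure_compl[of "{x..y}" \<mu>] univ xyI by simp
  \<comment> \<open>An open \<open>U\<close> around the null set has length below \<open>d\<close>.
    Each compact part of \<open>U\<close> within \<open>[x, y]\<close> is covered by a division
    inside \<open>U\<close>, whose increments of \<open>G\<close> sum to at most \<open>e\<close>;
    inner regularity passes this bound to \<open>U \<inter> {x..y}\<close>.\<close>
  have null: "emeasure \<mu> N = 0" if N: "N \<in> null_sets lborel" for N
  proof -
    have Nb: "N \<in> sets borel" using N by auto
    have "emeasure \<mu> (N \<inter> {x..y}) \<le> ennreal e" if "e > 0" for e
    proof -
      obtain d where d: "d > 0" "\<And>D. D division_of \<Union>D \<Longrightarrow> \<Union>D \<subseteq> {x..y} \<Longrightarrow> 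
        (\<Sum>K\<in>D. Sup K - Inf K) < d \<Longrightarrow> (\<Sum>K\<in>D. G (Sup K) - G (Inf K)) \<le> e"
        using ac[OF \<open>e > 0\<close>] by auto
      obtain U where U: "open U" "N \<subseteq> U" "emeasure lborel (U - N) < d"
        using outer_regular_lborel[OF Nb d(1)] .
      have Ub: "U \<in> sets borel" using U by auto
      have Ud: "emeasure lborel U < d"
        using U(3) emeasure_Diff_null_set[OF N, of U] Ub by simp
      have "emeasure \<mu> (U \<inter> {x..y}) = (SUP K\<in>{K. K \<subseteq> U \<inter> {x..y} \<and> compact K}. emeasure \<mu> K)"
        using Ub univ by (intro inner_regular) auto
      also have "\<dots> \<le> ennreal e"
      proof (rule SUP_least)
        fix K assume "K \<in> {K. K \<subseteq> U \<inter> {x..y} \<and> compact K}"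
        then obtain D where D: "D division_of \<Union>D" "K \<subseteq> \<Union>D" "\<Union>D \<subseteq> U" "\<Union>D \<subseteq> {x..y}"
          using compact_open_division[of K U x y] U(1) by auto
        have fin: "finite D" using D by auto
        have Ic: "\<exists>u v. u \<le> v \<and> x \<le> u \<and> v \<le> y \<and> L = {u..v}" if LD: "L \<in> D" for L
        proof -
          obtain u v where "u \<le> v" "L = {u..v}" by (rule division_real_interval[OF D(1) LD])
          moreover have "x \<le> u" "v \<le> y" using calculation D(4) LD by force+
          ultimately show ?thesis by blast
        qed
        have Ls: "L \<in> sets borel" if "L \<in> D" for L using Ic[OF that] by auto
        have "emeasure \<mu> K \<le> emeasure \<mu> (\<Union>D)"
          using D(2) Ls fin by (intro emeasure_mono) (auto intro!: sets.finite_Union)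
        also have "\<dots> = emeasure \<mu> (\<Union>L\<in>D. L)" by simp
        also have "\<dots> \<le> (\<Sum>L\<in>D. emeasure \<mu> L)"
          using Ls fin by (intro emeasure_subadditive_finite) auto
        also have "\<dots> = (\<Sum>L\<in>D. ennreal (G (Sup L) - G (Inf L)))"
          using Ic by (intro sum.cong) (auto simp: Icc H_def c_id dest!: Ic)
        also have "\<dots> = ennreal (\<Sum>L\<in>D. G (Sup L) - G (Inf L))"
          using Ic mono by (intro sum_ennreal) (auto dest!: Ic)
        also have "\<dots> \<le> ennreal e"
        proof (intro ennreal_leI d(2) D)
          have DB: "\<Union>D \<in> sets borel" using Ls fin by (auto intro!: sets.finite_Union)
          have "emeasure lborel (\<Union>D) \<le> emeasure lborel U"
            using D(3) Ub by (intro emeasure_mono) auto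
          then have "emeasure lborel (\<Union>D) < d" using Ud by simp
          then have "emeasure lebesgue (\<Union>D) < d" using DB by simp
          then have "measure lebesgue (\<Union>D) < d"
            using lmeasurable_division[OF D(1)] d(1)
            by (simp add: emeasure_eq_measure2 ennreal_less_iff)
          then show "(\<Sum>K\<in>D. Sup K - Inf K) < d" using sum_lengths_division[OF D(1)] by simp
        qed
        finally show "emeasure \<mu> K \<le> ennreal e" .
      qed
      finally have "emeasure \<mu> (U \<inter> {x..y}) \<le> ennreal e" .
      moreover have "emeasure \<mu> (N \<inter> {x..y}) \<le> emeasure \<mu> (U \<inter> {x..y})"
        using U(2) Ub by (intro emeasure_mono) auto
      ultimately show ?thesis by simp
    qed
    then have 0: "emeasure \<mu> (N \<inter> {x..y}) = 0"
      using ennreal_le_epsilon[of 0 "emeasure \<mu> (N \<inter> {x..y})"] by simp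
    have "emeasure \<mu> N \<le> emeasure \<mu> ((N \<inter> {x..y}) \<union> (UNIV - {x..y}))"
      using Nb by (intro emeasure_mono) auto
    also have "\<dots> \<le> emeasure \<mu> (N \<inter> {x..y}) + emeasure \<mu> (UNIV - {x..y})"
      using Nb by (intro emeasure_subadditive) auto
    finally show ?thesis using 0 compl by simp
  qed
  have "absolutely_continuous lborel \<mu>"
    unfolding absolutely_continuous_def using null by (auto intro!: null_setsI)
  then obtain f where f: "f \<in> borel_measurable lborel" "density lborel f = \<mu>"
    using sigma_finite_measure.Radon_Nikodym[OF sigma_finite_lborel, of \<mu>] by auto
  have "(\<integral>\<^sup>+u. f u \<partial>lborel) = emeasure (density lborel f) UNIV"
    using f(1) by (simp add: emeasure_density)
  then have fin: "(\<integral>\<^sup>+u. f u \<partial>lborel) \<noteq> \<infinity>" unfolding f(2) univ by simp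
  have ae: "AE u in lborel. f u \<noteq> \<infinity>"
    using nn_integral_PInf_AE[OF f(1) fin] .
  define \<phi> where "\<phi> u = enn2real (f u)" for u
  have m: "\<phi> \<in> borel_measurable lborel" unfolding \<phi>_def using f(1) by measurable
  have ae2: "AE u in lborel. ennreal (\<phi> u) = f u"
    using ae by eventually_elim (simp add: \<phi>_def top.not_eq_extremum)
  have eq: "(\<integral>\<^sup>+u. ennreal (indicator A u *\<^sub>R \<phi> u) \<partial>lborel) = emeasure \<mu> A" if "A \<in> sets borel" for A
  proof -
    have "(\<integral>\<^sup>+u. ennreal (indicator A u *\<^sub>R \<phi> u) \<partial>lborel) = (\<integral>\<^sup>+u. f u * indicator A u \<partial>lborel)"
      by (rule nn_integral_cong_AE, use ae2 in eventually_elim) (auto simp: indicator_def)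
    also have "\<dots> = emeasure (density lborel f) A" using f(1) that by (simp add: emeasure_density)
    finally show ?thesis using f(2) by simp
  qed
  show thesis
  proof (rule that[of \<phi>])
    show "integrable lborel \<phi>"
      using eq[of UNIV] m univ by (intro integrableI_nonneg) (auto simp: \<phi>_def)
    fix t assume t: "x \<le> t" "t \<le> y"
    have "(LINT u:{x..t}|lborel. \<phi> u) = enn2real (emeasure \<mu> {x..t})"
    proof -
      have "0 \<le> indicat_real {x..t} u *\<^sub>R \<phi> u" for u by (simp add: \<phi>_def)
      moreover have "(\<lambda>u. indicat_real {x..t} u *\<^sub>R \<phi> u) \<in> borel_measurable lborel"
        using m by simp
      ultimately show ?thesis
        unfolding set_lebesgue_integral_def using eq[of "{x..t}"]
        by (subst integral_eq_nn_integral) auto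
    qed
    also have "\<dots> = G t - G x"
      using Icc[of x t] t xy mono by (simp add: H_def c_id)
    finally show "G t - G x = (LINT u:{x..t}|lborel. \<phi> u)" by simp
  qed
qed

lemma increasing_AC_density_lebesgue:
  fixes G :: "real \<Rightarrow> real"
  assumes xy: "x \<le> y"
    and mono: "\<And>s t. x \<le> s \<Longrightarrow> s \<le> t \<Longrightarrow> t \<le> y \<Longrightarrow> G s \<le> G t"
    and ac: "\<And>e. 0 < e \<Longrightarrow> \<exists>d>0. \<forall>D. D division_of \<Union>D \<longrightarrow> \<Union>D \<subseteq> {x..y} \<longrightarrow>
        (\<Sum>K\<in>D. Sup K - Inf K) < d \<longrightarrow> (\<Sum>K\<in>D. G (Sup K) - G (Inf K)) \<le> e"
  obtains \<phi> where "integrable lebesgue \<phi>" "\<And>t. x \<le> t \<Longrightarrow> t \<le> y \<Longrightarrow> G t - G x = (LINT u:{x..t}|lebesgue. \<phi> u)"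
proof -
  obtain \<phi> where \<phi>: "integrable lborel \<phi>" "\<And>t. x \<le> t \<Longrightarrow> t \<le> y \<Longrightarrow> G t - G x = (LINT u:{x..t}|lborel. \<phi> u)"
    using increasing_AC_density[OF assms] by blast
  show thesis
  proof (rule that[of \<phi>])
    show "integrable lebesgue \<phi>" using \<phi>(1) by (simp add: integrable_completion)
    show "G t - G x = (LINT u:{x..t}|lebesgue. \<phi> u)" if "x \<le> t" "t \<le> y" for t
      using \<phi>(2)[OF that] \<phi>(1) unfolding set_lebesgue_integral_def
      by (subst integral_completion) auto
  qed
qed

text \<open>Jordan decomposition: with \<open>V\<close> the variation function, \<open>V\<close>,
  \<open>V + Re f\<close> and \<open>V + Im f\<close> are increasing and absolutely continuous. Each
  has a density, and \<open>f\<close> is recovered from differences.\<close>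

lemma AC_imp_integral:
  fixes f :: "real \<Rightarrow> complex"
  assumes ac: "absolutely_continuous_on {x..y} f" and xy: "x \<le> y"
  obtains \<phi> where "integrable lebesgue \<phi>" "\<And>t. x \<le> t \<Longrightarrow> t \<le> y \<Longrightarrow> f t - f x = (LINT u:{x..t}|lebesgue. \<phi> u)"
proof -
  let ?V = "var_fun x f"
  \<comment> \<open>One argument for three functions: \<open>h\<close> will be 0, \<open>Re\<close>
    and \<open>Im\<close>, all of them contractions, so the increments of \<open>h \<circ> f\<close>
    are dominated by those of \<open>V\<close>.\<close>
  have part: "\<exists>\<phi>. integrable lebesgue \<phi> \<and> (\<forall>t. x \<le> t \<longrightarrow> t \<le> y \<longrightarrow> (?V t + h (f t)) - (?V x + h (f x)) = (LINT u:{x..t}|lebesgue. \<phi> u))"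
    if h: "\<And>z w. \<bar>h z - h w\<bar> \<le> norm (z - w)" for h :: "complex \<Rightarrow> real"
  proof -
    have le: "\<bar>h (f t) - h (f s)\<bar> \<le> ?V t - ?V s" if "x \<le> s" "s \<le> t" "t \<le> y" for s t
      using norm_diff_le_var_fun[OF ac that] h[of "f t" "f s"] by simp
    have acV: "\<exists>d>0. \<forall>D. D division_of \<Union>D \<longrightarrow> \<Union>D \<subseteq> {x..y} \<longrightarrow>
        (\<Sum>K\<in>D. Sup K - Inf K) < d \<longrightarrow> (\<Sum>K\<in>D. (?V (Sup K) + h (f (Sup K))) - (?V (Inf K) + h (f (Inf K)))) \<le> e" if e0: "e > 0" for e
    proof -
      obtain d where d: "d > 0" "\<And>D. D division_of \<Union>D \<Longrightarrow> \<Union>D \<subseteq> {x..y} \<Longrightarrow> 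
        (\<Sum>K\<in>D. Sup K - Inf K) < d \<Longrightarrow> (\<Sum>K\<in>D. ?V (Sup K) - ?V (Inf K)) \<le> e/2"
        by (rule absolutely_continuous_var_fun[OF ac half_gt_zero[OF e0]]) (rule that)
      have "(\<Sum>K\<in>D. (?V (Sup K) + h (f (Sup K))) - (?V (Inf K) + h (f (Inf K)))) \<le> e"
        if D: "D division_of \<Union>D" "\<Union>D \<subseteq> {x..y}" "(\<Sum>K\<in>D. Sup K - Inf K) < d" for D
      proof -
        have "(\<Sum>K\<in>D. (?V (Sup K) + h (f (Sup K))) - (?V (Inf K) + h (f (Inf K)))) \<le> (\<Sum>K\<in>D. 2 * (?V (Sup K) - ?V (Inf K)))"
        proof (rule sum_mono)
          fix K assume K: "K \<in> D"
          then obtain u v where uv: "u \<le> v" "K = {u..v}" "Inf K = u" "Sup K = v"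
            by (rule division_real_interval[OF D(1)])
          then have "x \<le> u" "v \<le> y" using D(2) K by force+
          then show "(?V (Sup K) + h (f (Sup K))) - (?V (Inf K) + h (f (Inf K))) \<le> 2 * (?V (Sup K) - ?V (Inf K))"
            using le[of u v] uv by simp
        qed
        also have "\<dots> \<le> e" using d(2)[OF D] by (simp add: sum_distrib_left[symmetric] right_diff_distrib[symmetric] del: right_diff_distrib_numeral)
        finally show ?thesis .
      qed
      then show ?thesis using d(1) by blast
    qed
    have monoV: "?V s + h (f s) \<le> ?V t + h (f t)" if "x \<le> s" "s \<le> t" "t \<le> y" for s t
      using le[OF that] by simp
    show ?thesis
      by (rule increasing_AC_density_lebesgue[OF xy, of "\<lambda>t. ?V t + h (f t)", OF monoV acV]) blast+
  qed
  have hRe: "\<bar>Re z - Re w\<bar> \<le> norm (z - w)" for z w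
    using abs_Re_le_cmod[of "z - w"] by simp
  have hIm: "\<bar>Im z - Im w\<bar> \<le> norm (z - w)" for z w
    using abs_Im_le_cmod[of "z - w"] by simp
  obtain \<phi>0 where 0: "integrable lebesgue \<phi>0" "\<And>t. x \<le> t \<Longrightarrow> t \<le> y \<Longrightarrow> ?V t - ?V x = (LINT u:{x..t}|lebesgue. \<phi>0 u)"
    using part[of "\<lambda>_. 0"] by auto
  obtain \<phi>1 where 1: "integrable lebesgue \<phi>1" "\<And>t. x \<le> t \<Longrightarrow> t \<le> y \<Longrightarrow> (?V t + Re (f t)) - (?V x + Re (f x)) = (LINT u:{x..t}|lebesgue. \<phi>1 u)"
    using part[of Re, OF hRe] by blast
  obtain \<phi>2 where 2: "integrable lebesgue \<phi>2" "\<And>t. x \<le> t \<Longrightarrow> t \<le> y \<Longrightarrow> (?V t + Im (f t)) - (?V x + Im (f x)) = (LINT u:{x..t}|lebesgue. \<phi>2 u)"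
    using part[of Im, OF hIm] by blast
  define \<phi> where "\<phi> u = complex_of_real (\<phi>1 u - \<phi>0 u) + \<i> * complex_of_real (\<phi>2 u - \<phi>0 u)" for u
  show thesis
  proof (rule that[of \<phi>])
    show "integrable lebesgue \<phi>" unfolding \<phi>_def using 0 1 2 by auto
    fix t assume t: "x \<le> t" "t \<le> y"
    have si: "set_integrable lebesgue {x..t} (\<lambda>u. complex_of_real (\<phi>0 u))" "set_integrable lebesgue {x..t} (\<lambda>u. complex_of_real (\<phi>1 u))"
      "set_integrable lebesgue {x..t} (\<lambda>u. complex_of_real (\<phi>2 u))"
      using 0(1) 1(1) 2(1) by (auto intro!: integrable_imp_set_integrable)
    have "(LINT u:{x..t}|lebesgue. \<phi> u) = complex_of_real ((LINT u:{x..t}|lebesgue. \<phi>1 u) - (LINT u:{x..t}|lebesgue. \<phi>0 u))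
       + \<i> * complex_of_real ((LINT u:{x..t}|lebesgue. \<phi>2 u) - (LINT u:{x..t}|lebesgue. \<phi>0 u))"
      unfolding \<phi>_def of_real_diff set_integral_complex_of_real[symmetric]
      using si by (simp only: set_integral_add(2) set_integral_diff set_integral_mult_right set_integrable_mult_right)
    also have "\<dots> = f t - f x"
      using 0(2)[OF t] 1(2)[OF t] 2(2)[OF t] by (simp add: complex_eq_iff)
    finally show "f t - f x = (LINT u:{x..t}|lebesgue. \<phi> u)" by simp
  qed
qed

section \<open>Indefinite Lebesgue integrals\<close>

text \<open>Integration starts at minus infinity, so no base point has to be tracked: for integrands
  that vanish left of \<open>a\<close>, this is the integral from \<open>a\<close>, and it is 0 up
  to \<open>a\<close>.\<close>

definition prim :: "(real \<Rightarrow> 'b::euclidean_space) \<Rightarrow> real \<Rightarrow> 'b" where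
  "prim \<phi> t = (LINT u:{..t}|lebesgue. \<phi> u)"

lemma prim_add:
  "integrable lebesgue \<phi> \<Longrightarrow> integrable lebesgue \<psi> \<Longrightarrow> prim (\<lambda>u. \<phi> u + \<psi> u) t = prim \<phi> t + prim \<psi> t"
  unfolding prim_def by (intro set_integral_add(2) integrable_imp_set_integrable) auto

lemma prim_diff:
  "integrable lebesgue \<phi> \<Longrightarrow> integrable lebesgue \<psi> \<Longrightarrow> prim (\<lambda>u. \<phi> u - \<psi> u) t = prim \<phi> t - prim \<psi> t"
  unfolding prim_def by (intro set_integral_diff(2) integrable_imp_set_integrable) auto

lemma prim_mult_left: "prim (\<lambda>u. c * \<phi> u) t = c * prim \<phi> t" for c :: complex
  unfolding prim_def by simp

lemma prim_cong_AE:
  assumes "AE u in lebesgue. \<phi> u = \<psi> u" "integrable lebesgue \<phi>" "integrable lebesgue \<psi>"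
  shows "prim \<phi> t = prim \<psi> t"
  unfolding prim_def set_lebesgue_integral_def
  using assms by (intro integral_cong_AE) (auto intro!: borel_measurable_integrable integrable_mult_indicator)

lemma AE_lebesgue_not_in_finite: "finite F \<Longrightarrow> AE t in lebesgue. t \<notin> F"
  for F :: "real set"
  by (intro AE_not_in null_sets_completionI finite_imp_null_set_lborel)

section \<open>Increments, bounds and monotonicity of indefinite integrals\<close>

lemma prim_increment:
  assumes "integrable lebesgue \<phi>" "u \<le> v"
  shows "prim \<phi> v - prim \<phi> u = (LINT x:{u..v}|lebesgue. \<phi> x)"
proof -
  have "prim \<phi> v = (LINT x:{..u} \<union> {u<..v}|lebesgue. \<phi> x)"
    unfolding prim_def using assms(2) by (simp add: ivl_disj_un_one(3))
  also have "\<dots> = prim \<phi> u + (LINT x:{u<..v}|lebesgue. \<phi> x)"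
    unfolding prim_def using assms(1) by (intro set_integral_Un integrable_imp_set_integrable) auto
  also have "(LINT x:{u<..v}|lebesgue. \<phi> x) = (LINT x:{u..v}|lebesgue. \<phi> x)"
    unfolding set_lebesgue_integral_def
  proof (rule integral_cong_AE)
    have "AE x in lebesgue. x \<notin> {u}" by (rule AE_lebesgue_not_in_finite) simp
    then show "AE x in lebesgue. indicat_real {u<..v} x *\<^sub>R \<phi> x = indicat_real {u..v} x *\<^sub>R \<phi> x"
      by eventually_elim (auto simp: indicator_def)
  qed (use assms in \<open>auto intro!: borel_measurable_integrable integrable_mult_indicator\<close>)
  finally show ?thesis by simp
qed

lemma prim_increment_HK:
  assumes "integrable lebesgue \<phi>" "u \<le> v"
  shows "prim \<phi> v - prim \<phi> u = integral {u..v} \<phi>"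
  using prim_increment[OF assms] set_lebesgue_integral_eq_integral(2)[OF integrable_imp_set_integrable[OF assms(1)], of "{u..v}"]
  by simp

lemma integrable_lebesgue_imp_integrable_on:
  fixes \<phi> :: "real \<Rightarrow> 'b::euclidean_space"
  assumes "integrable lebesgue \<phi>"
  shows "\<phi> integrable_on {u..v}"
  by (rule set_lebesgue_integral_eq_integral(1)[OF integrable_imp_set_integrable[OF assms]]) simp

lemma norm_prim_le:
  assumes "integrable lebesgue \<phi>"
  shows "norm (prim \<phi> t) \<le> (LINT x|lebesgue. norm (\<phi> x))"
proof -
  have "norm (prim \<phi> t) \<le> (LINT x|lebesgue. norm (indicat_real {..t} x *\<^sub>R \<phi> x))"
    unfolding prim_def set_lebesgue_integral_def by (rule integral_norm_bound)
  also have "\<dots> \<le> (LINT x|lebesgue. norm (\<phi> x))"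
    using assms by (intro integral_mono integrable_norm integrable_mult_indicator) (auto simp: indicator_def)
  finally show ?thesis .
qed

lemma prim_nonneg: "(\<And>x. 0 \<le> \<phi> x) \<Longrightarrow> 0 \<le> prim \<phi> t" for \<phi> :: "real \<Rightarrow> real"
  unfolding prim_def set_lebesgue_integral_def by (auto intro!: Bochner_Integration.integral_nonneg)

lemma prim_mono:
  fixes \<phi> \<psi> :: "real \<Rightarrow> real"
  assumes "integrable lebesgue \<phi>" "integrable lebesgue \<psi>" "\<And>x. \<phi> x \<le> \<psi> x"
  shows "prim \<phi> t \<le> prim \<psi> t"
  unfolding prim_def using assms by (intro set_integral_mono integrable_imp_set_integrable) auto

lemma prim_increasing:
  fixes \<phi> :: "real \<Rightarrow> real"
  assumes "integrable lebesgue \<phi>" "\<And>x. 0 \<le> \<phi> x" "u \<le> v"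
  shows "prim \<phi> u \<le> prim \<phi> v"
proof -
  have "0 \<le> integral {u..v} \<phi>"
    using assms by (intro integral_nonneg integrable_lebesgue_imp_integrable_on) auto
  then show ?thesis using prim_increment_HK[OF assms(1,3)] by simp
qed

lemma prim_tail_small:
  fixes \<phi> :: "real \<Rightarrow> 'b::euclidean_space"
  assumes "integrable lebesgue \<phi>" "0 < e"
  obtains n :: nat where "(LINT u|lebesgue. norm (\<phi> u) * indicator {u. real n < norm (\<phi> u)} u) < e"
proof -
  have m: "\<phi> \<in> borel_measurable lebesgue" using assms(1) by auto
  have "(\<lambda>n::nat. LINT u|lebesgue. norm (\<phi> u) * indicator {u. real n < norm (\<phi> u)} u) \<longlonglongrightarrow> (LINT u|(lebesgue :: real measure). 0)"
  proof (rule integral_dominated_convergence[where w = "\<lambda>u. norm (\<phi> u)" and f = "\<lambda>_. 0"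
        and s = "\<lambda>(n::nat) u. norm (\<phi> u) * indicat_real {u. real n < norm (\<phi> u)} u"])
    show "integrable lebesgue (\<lambda>u. norm (\<phi> u))" using assms(1) by simp
    show "\<And>i. (\<lambda>x. norm (\<phi> x) * indicat_real {u. real i < norm (\<phi> u)} x) \<in> borel_measurable lebesgue"
    proof -
      fix i
      have "{u. real i < norm (\<phi> u)} = {u \<in> space lebesgue. real i < norm (\<phi> u)}" by simp
      also have "\<dots> \<in> sets lebesgue" using m by measurable
      finally have "{u. real i < norm (\<phi> u)} \<in> sets lebesgue" .
      then show "(\<lambda>x. norm (\<phi> x) * indicat_real {u. real i < norm (\<phi> u)} x) \<in> borel_measurable lebesgue"
        using m by (intro borel_measurable_times borel_measurable_indicator) auto
    qed
    show "AE x in lebesgue. (\<lambda>i. norm (\<phi> x) * indicat_real {u. real i < norm (\<phi> u)} x) \<longlonglongrightarrow> 0"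
    proof (rule AE_I2)
      fix x
      obtain N :: nat where "norm (\<phi> x) \<le> real N" using real_arch_simple by blast
      then have "eventually (\<lambda>i. norm (\<phi> x) * indicat_real {u. real i < norm (\<phi> u)} x = 0) sequentially"
        unfolding eventually_sequentially by (intro exI[of _ N]) auto
      then show "(\<lambda>i. norm (\<phi> x) * indicat_real {u. real i < norm (\<phi> u)} x) \<longlonglongrightarrow> 0"
        by (rule tendsto_eventually)
    qed
    show "\<And>i. AE x in lebesgue. norm (norm (\<phi> x) * indicat_real {u. real i < norm (\<phi> u)} x) \<le> norm (\<phi> x)"
      by (auto simp: indicator_def)
  qed simp
  then have "eventually (\<lambda>n::nat. (LINT u|lebesgue. norm (\<phi> u) * indicator {u. real n < norm (\<phi> u)} u) < e) sequentially"
    using assms(2) by (intro order_tendstoD) auto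
  then show thesis using that by (auto simp: eventually_sequentially)
qed

text \<open>The part of the integrand above height \<open>n\<close> has integral below
  \<open>e / 2\<close> by \<open>prim_tail_small\<close>; the rest contributes at most
  \<open>n\<close> times the total length.\<close>

lemma prim_absolutely_continuous:
  fixes \<phi> :: "real \<Rightarrow> 'b::euclidean_space"
  assumes int: "integrable lebesgue \<phi>" and "0 < e"
  obtains d where "0 < d" "\<And>D. D division_of \<Union>D \<Longrightarrow> (\<Sum>K\<in>D. Sup K - Inf K) < d \<Longrightarrow>
     (\<Sum>K\<in>D. norm (prim \<phi> (Sup K) - prim \<phi> (Inf K))) < e"
proof -
  obtain n :: nat where n: "(LINT u|lebesgue. norm (\<phi> u) * indicator {u. real n < norm (\<phi> u)} u) < e/2"
    using prim_tail_small[OF int half_gt_zero[OF \<open>0 < e\<close>]] .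
  define \<psi> where "\<psi> u = norm (\<phi> u) * indicator {u. real n < norm (\<phi> u)} u" for u
  have m: "\<phi> \<in> borel_measurable lebesgue" using int by auto
  have s: "{u. real n < norm (\<phi> u)} \<in> sets lebesgue"
  proof -
    have "{u. real n < norm (\<phi> u)} = {u \<in> space lebesgue. real n < norm (\<phi> u)}" by simp
    also have "\<dots> \<in> sets lebesgue" using m by measurable
    finally show ?thesis .
  qed
  have \<psi>int: "integrable lebesgue \<psi>"
    unfolding \<psi>_def using integrable_mult_indicator[OF s integrable_norm[OF int]] by (simp add: mult.commute)
  have \<psi>0: "0 \<le> \<psi> u" for u by (simp add: \<psi>_def)
  have le: "norm (\<phi> u) \<le> \<psi> u + real n" for u by (auto simp: \<psi>_def indicator_def)
  \<comment> \<open>Makes \<open>real n * d \<le> e / 2\<close>; the added 1 keeps the denominator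
    positive when \<open>n = 0\<close>.\<close>
  define d where "d = e / (2 * (real n + 1))"
  show thesis
  proof (rule that[of d])
    show "0 < d" using \<open>0 < e\<close> by (simp add: d_def)
    fix D :: "real set set" assume D: "D division_of \<Union>D" "(\<Sum>K\<in>D. Sup K - Inf K) < d"
    have "(\<Sum>K\<in>D. norm (prim \<phi> (Sup K) - prim \<phi> (Inf K))) \<le> (\<Sum>K\<in>D. integral K \<psi> + real n * (Sup K - Inf K))"
    proof (rule sum_mono)
      fix K assume "K \<in> D"
      then obtain u v where uv: "u \<le> v" "K = {u..v}" "Inf K = u" "Sup K = v"
        by (rule division_real_interval[OF D(1)])
      have "norm (prim \<phi> v - prim \<phi> u) \<le> integral {u..v} (\<lambda>x. \<psi> x + real n)"
        unfolding prim_increment_HK[OF int uv(1)] using le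
        by (intro integral_norm_bound_integral integrable_lebesgue_imp_integrable_on[OF int]
            integrable_add integrable_lebesgue_imp_integrable_on[OF \<psi>int]) auto
      also have "\<dots> = integral {u..v} \<psi> + real n * (v - u)"
        using uv(1) by (subst Henstock_Kurzweil_Integration.integral_add)
          (auto intro: integrable_lebesgue_imp_integrable_on[OF \<psi>int])
      finally show "norm (prim \<phi> (Sup K) - prim \<phi> (Inf K)) \<le> integral K \<psi> + real n * (Sup K - Inf K)"
        using uv by simp
    qed
    also have "\<dots> = (\<Sum>K\<in>D. integral K \<psi>) + real n * (\<Sum>K\<in>D. Sup K - Inf K)"
      by (simp add: sum.distrib sum_distrib_left)
    also have "(\<Sum>K\<in>D. integral K \<psi>) = integral (\<Union>D) \<psi>"
    proof (rule integral_combine_division_bottomup[symmetric, OF D(1)])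
      fix K assume "K \<in> D"
      then obtain u v where "K = {u..v}" by (rule division_real_interval[OF D(1)])
      then show "\<psi> integrable_on K" using integrable_lebesgue_imp_integrable_on[OF \<psi>int] by simp
    qed
    also have "integral (\<Union>D) \<psi> \<le> (LINT u|lebesgue. \<psi> u)"
    proof -
      have sD: "\<Union>D \<in> sets lebesgue" using lmeasurable_division[OF D(1)] by auto
      have "integral (\<Union>D) \<psi> = (LINT u:\<Union>D|lebesgue. \<psi> u)"
        by (rule set_lebesgue_integral_eq_integral(2)[symmetric, OF integrable_imp_set_integrable[OF \<psi>int sD]])
      also have "\<dots> \<le> (LINT u|lebesgue. \<psi> u)"
        unfolding set_lebesgue_integral_def using \<psi>int \<psi>0 sD
        by (intro integral_mono integrable_mult_indicator) (auto simp: indicator_def)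
      finally show ?thesis .
    qed
    also have "(LINT u|lebesgue. \<psi> u) < e/2" using n by (simp add: \<psi>_def)
    also have "real n * (\<Sum>K\<in>D. Sup K - Inf K) \<le> e/2"
    proof -
      have "real n * (\<Sum>K\<in>D. Sup K - Inf K) \<le> real n * d"
        using D(2) by (intro mult_left_mono) auto
      also have "\<dots> \<le> e/2"
        using \<open>0 < e\<close> by (simp add: d_def field_simps)
      finally show ?thesis .
    qed
    finally show "(\<Sum>K\<in>D. norm (prim \<phi> (Sup K) - prim \<phi> (Inf K))) < e" by simp
  qed
qed

lemma absolutely_continuous_on_prim:
  "integrable lebesgue \<phi> \<Longrightarrow> absolutely_continuous_on S (prim \<phi>)"
  unfolding absolutely_continuous_on_def
proof (intro allI impI)
  fix e :: real assume int: "integrable lebesgue \<phi>" and e: "0 < e"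
  show "\<exists>d>0. \<forall>D. D division_of (\<Union>D) \<longrightarrow> \<Union>D \<subseteq> S \<longrightarrow>
        (\<Sum>K\<in>D. Sup K - Inf K) < d \<longrightarrow> (\<Sum>K\<in>D. norm (prim \<phi> (Sup K) - prim \<phi> (Inf K))) < e"
    by (rule prim_absolutely_continuous[OF int e]) blast
qed

lemma absolutely_continuous_onE:
  assumes "absolutely_continuous_on S f" "0 < e"
  obtains d where "0 < d" "\<And>D. D division_of (\<Union>D) \<Longrightarrow> \<Union>D \<subseteq> S \<Longrightarrow>
        (\<Sum>K\<in>D. Sup K - Inf K) < d \<Longrightarrow> (\<Sum>K\<in>D. norm (f (Sup K) - f (Inf K))) < e"
proof -
  have "\<exists>d>0. \<forall>D. D division_of (\<Union>D) \<longrightarrow> \<Union>D \<subseteq> S \<longrightarrow>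
        (\<Sum>K\<in>D. Sup K - Inf K) < d \<longrightarrow> (\<Sum>K\<in>D. norm (f (Sup K) - f (Inf K))) < e"
    using assms unfolding absolutely_continuous_on_def by (elim allE[of _ e]) simp
  then show thesis using that by (elim exE conjE) (erule meta_allE, erule meta_impE, assumption, erule meta_impE, blast, assumption)
qed

text \<open>Covers products of bounded functions as well as compositions with a Lipschitz function:
  \<open>prim_product\<close> and \<open>prim_exp\<close> both reduce to such an increment
  bound.\<close>

lemma absolutely_continuous_on_combine:
  assumes f: "absolutely_continuous_on S f" and g: "absolutely_continuous_on S g"
    and le: "\<And>s t. s \<in> S \<Longrightarrow> t \<in> S \<Longrightarrow> norm (h t - h s) \<le> C * (norm (f t - f s) + norm (g t - g s))"
  shows "absolutely_continuous_on S h"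
  unfolding absolutely_continuous_on_def
proof (intro allI impI)
  fix e :: real assume "0 < e"
  define B where "B = \<bar>C\<bar> + 1"
  have B: "0 < B" "C \<le> B" by (auto simp: B_def)
  have eB: "0 < e / (2 * B)" using \<open>0 < e\<close> B by simp
  obtain d1 where d1: "0 < d1" "\<And>D. D division_of (\<Union>D) \<Longrightarrow> \<Union>D \<subseteq> S \<Longrightarrow>
        (\<Sum>K\<in>D. Sup K - Inf K) < d1 \<Longrightarrow> (\<Sum>K\<in>D. norm (f (Sup K) - f (Inf K))) < e / (2 * B)"
    by (rule absolutely_continuous_onE[OF f eB]) (rule that)
  obtain d2 where d2: "0 < d2" "\<And>D. D division_of (\<Union>D) \<Longrightarrow> \<Union>D \<subseteq> S \<Longrightarrow>
        (\<Sum>K\<in>D. Sup K - Inf K) < d2 \<Longrightarrow> (\<Sum>K\<in>D. norm (g (Sup K) - g (Inf K))) < e / (2 * B)"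
    by (rule absolutely_continuous_onE[OF g eB]) (rule that)
  have "(\<Sum>K\<in>D. norm (h (Sup K) - h (Inf K))) < e"
    if D: "D division_of \<Union>D" "\<Union>D \<subseteq> S" "(\<Sum>K\<in>D. Sup K - Inf K) < min d1 d2" for D
  proof -
    have "(\<Sum>K\<in>D. norm (h (Sup K) - h (Inf K))) \<le> (\<Sum>K\<in>D. B * (norm (f (Sup K) - f (Inf K)) + norm (g (Sup K) - g (Inf K))))"
    proof (rule sum_mono)
      fix K assume K: "K \<in> D"
      then obtain u v where uv: "u \<le> v" "K = {u..v}" "Inf K = u" "Sup K = v"
        by (rule division_real_interval[OF D(1)])
      have "K \<subseteq> S" using K D(2) by blast
      then have "u \<in> S" "v \<in> S" using uv by auto
      then have "norm (h v - h u) \<le> C * (norm (f v - f u) + norm (g v - g u))" using le by simp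
      also have "\<dots> \<le> B * (norm (f v - f u) + norm (g v - g u))"
        using B by (intro mult_right_mono) auto
      finally show "norm (h (Sup K) - h (Inf K)) \<le> B * (norm (f (Sup K) - f (Inf K)) + norm (g (Sup K) - g (Inf K)))"
        using uv by simp
    qed
    also have "\<dots> = B * ((\<Sum>K\<in>D. norm (f (Sup K) - f (Inf K))) + (\<Sum>K\<in>D. norm (g (Sup K) - g (Inf K))))"
      by (simp only: sum_distrib_left[symmetric] sum.distrib)
    also have "\<dots> < B * (e / (2 * B) + e / (2 * B))"
      using d1(2)[OF D(1,2)] d2(2)[OF D(1,2)] D(3) B by (intro mult_strict_left_mono add_strict_mono) auto
    also have "\<dots> = e" using B by (simp add: field_simps)
    finally show ?thesis .
  qed
  then show "\<exists>d>0. \<forall>D. D division_of \<Union>D \<longrightarrow> \<Union>D \<subseteq> S \<longrightarrow> (\<Sum>K\<in>D. Sup K - Inf K) < d \<longrightarrow>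
        (\<Sum>K\<in>D. norm (h (Sup K) - h (Inf K))) < e"
    using d1(1) d2(1) by (intro exI[of _ "min d1 d2"]) auto
qed

lemma absolutely_continuous_on_imp_continuous:
  assumes ac: "absolutely_continuous_on {x..y} f"
  shows "continuous_on {x..y} f"
proof (subst continuous_on_iff, intro ballI allI impI)
  fix t e :: real assume t: "t \<in> {x..y}" "0 < e"
  obtain d where d: "d > 0" "\<And>D. D division_of \<Union>D \<Longrightarrow> \<Union>D \<subseteq> {x..y} \<Longrightarrow> 
      (\<Sum>K\<in>D. Sup K - Inf K) < d \<Longrightarrow> (\<Sum>K\<in>D. norm (f (Sup K) - f (Inf K))) < e"
    by (rule absolutely_continuous_onE[OF ac t(2)]) (rule that)
  have *: "norm (f v - f u) < e" if "u \<le> v" "v - u < d" "x \<le> u" "v \<le> y" for u v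
  proof -
    from d(2)[OF singleton_division[OF that(1)]] show ?thesis using that by simp
  qed
  have "dist (f u) (f t) < e" if "u \<in> {x..y}" "dist u t < d" for u
    using *[of u t] *[of t u] that t
    by (cases "u \<le> t") (auto simp: dist_real_def dist_norm norm_minus_commute)
  then show "\<exists>d>0. \<forall>u\<in>{x..y}. dist u t < d \<longrightarrow> dist (f u) (f t) < e"
    using d(1) by blast
qed

lemma continuous_on_prim:
  assumes "integrable lebesgue \<phi>" shows "continuous_on S (prim \<phi>)"
proof (subst continuous_on_iff, intro ballI allI impI)
  fix t e :: real assume "0 < e"
  obtain d where d: "d > 0" "\<And>D. D division_of \<Union>D \<Longrightarrow> (\<Sum>K\<in>D. Sup K - Inf K) < d \<Longrightarrow>
      (\<Sum>K\<in>D. norm (prim \<phi> (Sup K) - prim \<phi> (Inf K))) < e"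
    by (rule prim_absolutely_continuous[OF assms \<open>0 < e\<close>]) (rule that)
  have *: "norm (prim \<phi> v - prim \<phi> u) < e" if "u \<le> v" "v - u < d" for u v
  proof -
    from d(2)[OF singleton_division[OF that(1)]] show ?thesis using that by simp
  qed
  have "dist (prim \<phi> u) (prim \<phi> t) < e" if "dist u t < d" for u
    using *[of u t] *[of t u] that
    by (cases "u \<le> t") (auto simp: dist_real_def dist_norm norm_minus_commute)
  then show "\<exists>d>0. \<forall>u\<in>S. dist u t < d \<longrightarrow> dist (prim \<phi> u) (prim \<phi> t) < e"
    using d(1) by blast
qed

text \<open>Lebesgue differentiation. \<open>integrable_ccontinuous_explicit\<close> controls
  averages over \<open>[t, t + h]\<close> only; applied to the reflected function it also yields
  those over \<open>[t - h, t]\<close>.\<close>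

lemma prim_has_vector_derivative:
  fixes \<phi> :: "real \<Rightarrow> 'b::euclidean_space"
  assumes int: "integrable lebesgue \<phi>"
  shows "AE t in lebesgue. (prim \<phi> has_vector_derivative \<phi> t) (at t)"
proof -
  have io: "\<phi> integrable_on cbox u v" for u v
    using integrable_lebesgue_imp_integrable_on[OF int] by simp
  have io': "(\<lambda>t. \<phi> (- t)) integrable_on cbox u v" for u v
    using Henstock_Kurzweil_Integration.integrable_reflect_real[of \<phi> "-u" "-v"] io[of "-v" "-u"] by simp
  obtain N where N: "negligible N" "\<And>x e. \<lbrakk>x \<notin> N; 0 < e\<rbrakk> \<Longrightarrow>
      \<exists>d>0. \<forall>h. 0 < h \<and> h < d \<longrightarrow> norm (integral (cbox x (x + h *\<^sub>R One)) \<phi> /\<^sub>R h ^ DIM(real) - \<phi> x) < e"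
    using integrable_ccontinuous_explicit[of \<phi>, OF io] by blast
  obtain L where L: "negligible L" "\<And>x e. \<lbrakk>x \<notin> L; 0 < e\<rbrakk> \<Longrightarrow>
      \<exists>d>0. \<forall>h. 0 < h \<and> h < d \<longrightarrow> norm (integral (cbox x (x + h *\<^sub>R One)) (\<lambda>t. \<phi> (- t)) /\<^sub>R h ^ DIM(real) - \<phi> (- x)) < e"
    using integrable_ccontinuous_explicit[of "\<lambda>t. \<phi> (- t)", OF io'] by blast
  have negL: "negligible (uminus ` L)"
    by (rule negligible_differentiable_image_negligible[OF order_refl L(1)])
      (auto intro!: linear_imp_differentiable_on linear_uminus)
  have "negligible (N \<union> uminus ` L)" using N(1) negL by (rule negligible_Un)
  then have "AE t in lebesgue. t \<notin> N \<union> uminus ` L"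
    by (intro AE_not_in) (simp add: negligible_iff_null_sets)
  then show ?thesis
  proof eventually_elim
    case (elim t)
    then have tN: "t \<notin> N" and tL: "- t \<notin> L" by force+
    show "(prim \<phi> has_vector_derivative \<phi> t) (at t)"
      unfolding has_vector_derivative_def has_derivative_at_alt
    proof (intro conjI allI impI)
      show "bounded_linear (\<lambda>x. x *\<^sub>R \<phi> t)" by (rule bounded_linear_scaleR_left)
      fix e :: real assume "0 < e"
      obtain d1 where d1: "d1 > 0" "\<And>h. 0 < h \<Longrightarrow> h < d1 \<Longrightarrow> norm (integral {t..t + h} \<phi> /\<^sub>R h - \<phi> t) < e"
        using N(2)[OF tN \<open>0 < e\<close>] by auto
      obtain d2 where d2: "d2 > 0" "\<And>h. 0 < h \<Longrightarrow> h < d2 \<Longrightarrow> norm (integral {- t..- t + h} (\<lambda>t. \<phi> (- t)) /\<^sub>R h - \<phi> t) < e"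
        using L(2)[OF tL \<open>0 < e\<close>] by auto
      have scale: "norm (I - h *\<^sub>R z) \<le> e * h" if "0 < h" "norm (I /\<^sub>R h - z) < e" for I z :: 'b and h
      proof -
        have "I - h *\<^sub>R z = h *\<^sub>R (I /\<^sub>R h - z)" using that by (simp add: algebra_simps)
        then show ?thesis using that by (simp add: mult.commute)
      qed
      have "norm (prim \<phi> y - prim \<phi> t - (y - t) *\<^sub>R \<phi> t) \<le> e * norm (y - t)"
        if y: "norm (y - t) < min d1 d2" for y
      proof -
        consider "y = t" | "t < y" | "y < t" by linarith
        then show ?thesis
        proof cases
          case 2
          have "norm (integral {t..t + (y - t)} \<phi> - (y - t) *\<^sub>R \<phi> t) \<le> e * (y - t)"
            using 2 y by (intro scale d1(2)) auto
          then show ?thesis using 2 prim_increment_HK[OF int, of t y] by simp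
        next
          case 3
          have "integral {- t..- y} (\<lambda>t. \<phi> (- t)) = integral {y..t} \<phi>"
            by (rule Henstock_Kurzweil_Integration.integral_reflect_real)
          then have "norm (integral {y..t} \<phi> - (t - y) *\<^sub>R \<phi> t) \<le> e * (t - y)"
            using 3 y d2(2)[of "t - y"] by (intro scale) auto
          then have "norm ((prim \<phi> t - prim \<phi> y) - (t - y) *\<^sub>R \<phi> t) \<le> e * (t - y)"
            using 3 prim_increment_HK[OF int, of y t] by simp
          moreover have "prim \<phi> y - prim \<phi> t - (y - t) *\<^sub>R \<phi> t = - ((prim \<phi> t - prim \<phi> y) - (t - y) *\<^sub>R \<phi> t)"
            by (simp add: algebra_simps)
          ultimately show ?thesis using 3 by (simp only: norm_minus_cancel) simp
        qed simp
      qed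
      then show "\<exists>d>0. \<forall>y. norm (y - t) < d \<longrightarrow> norm (prim \<phi> y - prim \<phi> t - (y - t) *\<^sub>R \<phi> t) \<le> e * norm (y - t)"
        using d1(1) d2(1) by (intro exI[of _ "min d1 d2"]) auto
    qed
  qed
qed

lemma AC_imp_prim:
  fixes f :: "real \<Rightarrow> complex"
  assumes ac: "absolutely_continuous_on {x..y} f" and xy: "x \<le> y"
  obtains \<phi> where "integrable lebesgue \<phi>" "\<And>t. t \<le> x \<Longrightarrow> \<phi> t = 0" "\<And>t. y \<le> t \<Longrightarrow> \<phi> t = 0"
    "\<And>t. x \<le> t \<Longrightarrow> t \<le> y \<Longrightarrow> f t = f x + prim \<phi> t"
    "AE t in lebesgue. x < t \<and> t < y \<longrightarrow> (f has_vector_derivative \<phi> t) (at t)"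
proof -
  obtain \<psi> where \<psi>: "integrable lebesgue \<psi>" "\<And>t. x \<le> t \<Longrightarrow> t \<le> y \<Longrightarrow> f t - f x = (LINT u:{x..t}|lebesgue. \<psi> u)"
    using AC_imp_integral[OF assms] by metis
  \<comment> \<open>Dropping the mass outside \<open>(x, y)\<close> makes \<open>prim\<close>, which
    integrates from minus infinity, start at \<open>x\<close>.\<close>
  define \<phi> where "\<phi> u = indicat_real {x<..<y} u *\<^sub>R \<psi> u" for u
  have int: "integrable lebesgue \<phi>" unfolding \<phi>_def using \<psi>(1) by (intro integrable_mult_indicator) auto
  have f: "f t = f x + prim \<phi> t" if "x \<le> t" "t \<le> y" for t
  proof -
    have "prim \<phi> t = (LINT u:{x..t}|lebesgue. \<psi> u)"
      unfolding prim_def set_lebesgue_integral_def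
    proof (rule integral_cong_AE)
      have "AE u in lebesgue. u \<notin> {x,y}" by (rule AE_lebesgue_not_in_finite) simp
      then show "AE u in lebesgue. indicat_real {..t} u *\<^sub>R \<phi> u = indicat_real {x..t} u *\<^sub>R \<psi> u"
        by eventually_elim (use that in \<open>auto simp: indicator_def \<phi>_def\<close>)
    qed (use int \<psi>(1) in \<open>auto intro!: borel_measurable_integrable integrable_mult_indicator\<close>)
    then show ?thesis using \<psi>(2)[OF that] by (simp add: algebra_simps)
  qed
  show thesis
  proof (rule that[OF int _ _ f])
    show "AE t in lebesgue. x < t \<and> t < y \<longrightarrow> (f has_vector_derivative \<phi> t) (at t)"
      using prim_has_vector_derivative[OF int]
    proof eventually_elim
      case (elim t)
      show ?case
      proof
        assume t: "x < t \<and> t < y"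
        have "((\<lambda>t. f x + prim \<phi> t) has_vector_derivative \<phi> t) (at t)"
          using elim by (auto intro!: derivative_eq_intros)
        then show "(f has_vector_derivative \<phi> t) (at t)"
        proof (rule has_vector_derivative_transform_within_open)
          show "open {x<..<y}" "t \<in> {x<..<y}" using t by auto
          show "f x + prim \<phi> z = f z" if "z \<in> {x<..<y}" for z
            by (rule f[symmetric]) (use that in auto)
        qed
      qed
    qed
  qed (auto simp: \<phi>_def)
qed

text \<open>The density from \<open>AC_imp_prim\<close> is almost everywhere the derivative, hence
  agrees with \<open>\<phi>\<close>. Absolute continuity is what excludes a singular part of
  \<open>f\<close>.\<close>

lemma AC_increment_eq_prim:
  fixes f :: "real \<Rightarrow> complex"
  assumes ac: "absolutely_continuous_on {x..y} f" and xy: "x \<le> y"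
    and int: "integrable lebesgue \<phi>"
    and deriv: "AE t in lebesgue. x < t \<and> t < y \<longrightarrow> (f has_vector_derivative \<phi> t) (at t)"
  shows "f y - f x = prim \<phi> y - prim \<phi> x"
proof -
  obtain \<psi> where \<psi>: "integrable lebesgue \<psi>" "\<And>t. t \<le> x \<Longrightarrow> \<psi> t = 0" "\<And>t. y \<le> t \<Longrightarrow> \<psi> t = 0"
    "\<And>t. x \<le> t \<Longrightarrow> t \<le> y \<Longrightarrow> f t = f x + prim \<psi> t"
    "AE t in lebesgue. x < t \<and> t < y \<longrightarrow> (f has_vector_derivative \<psi> t) (at t)"
    by (rule AC_imp_prim[OF ac xy]) (rule that)
  have "f y - f x = prim \<psi> y - prim \<psi> x" using \<psi>(4)[of y] \<psi>(4)[of x] xy by simp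
  also have "\<dots> = (LINT t:{x..y}|lebesgue. \<psi> t)" by (rule prim_increment[OF \<psi>(1) xy])
  also have "\<dots> = (LINT t:{x..y}|lebesgue. \<phi> t)"
    unfolding set_lebesgue_integral_def
  proof (rule integral_cong_AE)
    have "AE u in lebesgue. u \<notin> {x,y}" by (rule AE_lebesgue_not_in_finite) simp
    then show "AE u in lebesgue. indicat_real {x..y} u *\<^sub>R \<psi> u = indicat_real {x..y} u *\<^sub>R \<phi> u"
      using \<psi>(5) deriv
      by eventually_elim (auto simp: indicator_def dest: vector_derivative_unique_at)
  qed (use int \<psi>(1) in \<open>auto intro!: borel_measurable_integrable integrable_mult_indicator\<close>)
  also have "\<dots> = prim \<phi> y - prim \<phi> x" by (rule prim_increment[OF int xy, symmetric])
  finally show ?thesis .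
qed

section \<open>The space $L^2$\<close>

lemma L2_measurable: "f \<in> L2 M \<Longrightarrow> f \<in> borel_measurable M"
  by (simp add: L2_def)

lemma L2_integrable: "f \<in> L2 M \<Longrightarrow> integrable M (\<lambda>x. (cmod (f x))\<^sup>2)"
  by (simp add: L2_def)

lemma L2_inner_integrable:
  assumes "f \<in> L2 M" "g \<in> L2 M"
  shows "integrable M (\<lambda>x. cnj (f x) * g x)"
proof (rule Bochner_Integration.integrable_bound)
  show "integrable M (\<lambda>x. (cmod (f x))\<^sup>2 + (cmod (g x))\<^sup>2)"
    using assms by (auto dest: L2_integrable)
  show "(\<lambda>x. cnj (f x) * g x) \<in> borel_measurable M"
    using assms[THEN L2_measurable]
    by (intro borel_measurable_times measurable_compose[OF _ borel_measurable_continuous_onI[OF continuous_on_cnj[OF continuous_on_id]]])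
  have "a * b \<le> a\<^sup>2 + b\<^sup>2" if "0 \<le> a" "0 \<le> b" for a b :: real
    using sum_squares_bound[of a b] mult_nonneg_nonneg[OF that] by (simp add: power2_eq_square)
  then show "AE x in M. norm (cnj (f x) * g x) \<le> norm ((cmod (f x))\<^sup>2 + (cmod (g x))\<^sup>2)"
    by (auto simp: norm_mult)
qed

lemma L2_add_mult:
  assumes "f \<in> L2 M" "g \<in> L2 M"
  shows "(\<lambda>x. f x + c * g x) \<in> L2 M"
proof -
  have m: "(\<lambda>x. f x + c * g x) \<in> borel_measurable M"
    using assms[THEN L2_measurable] by simp
  have "integrable M (\<lambda>x. (cmod (f x + c * g x))\<^sup>2)"
  proof (rule Bochner_Integration.integrable_bound)
    show "integrable M (\<lambda>x. 2 * (cmod (f x))\<^sup>2 + 2 * (cmod c)\<^sup>2 * (cmod (g x))\<^sup>2)"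
      by (intro Bochner_Integration.integrable_add integrable_mult_right L2_integrable assms)
    show "(\<lambda>x. (cmod (f x + c * g x))\<^sup>2) \<in> borel_measurable M" using m by simp
    have "(cmod (z + c * w))\<^sup>2 \<le> 2 * (cmod z)\<^sup>2 + 2 * (cmod c)\<^sup>2 * (cmod w)\<^sup>2" for z w
    proof -
      have "(cmod (z + c * w))\<^sup>2 \<le> (cmod z + cmod c * cmod w)\<^sup>2"
        using norm_triangle_ineq[of z "c * w"] by (intro power_mono) (auto simp: norm_mult)
      also have "\<dots> \<le> 2 * (cmod z)\<^sup>2 + 2 * (cmod c * cmod w)\<^sup>2"
        using sum_squares_bound[of "cmod z" "cmod c * cmod w"] by (simp add: power2_sum)
      finally show ?thesis by (simp add: power_mult_distrib)
    qed
    then show "AE x in M. norm ((cmod (f x + c * g x))\<^sup>2) \<le> norm (2 * (cmod (f x))\<^sup>2 + 2 * (cmod c)\<^sup>2 * (cmod (g x))\<^sup>2)"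
      by auto
  qed
  then show ?thesis using m by (simp add: L2_def)
qed

lemma L2_zero: "(\<lambda>x. 0) \<in> L2 M"
  by (simp add: L2_def)

lemma L2_mult: "f \<in> L2 M \<Longrightarrow> (\<lambda>x. c * f x) \<in> L2 M"
  using L2_add_mult[OF L2_zero, of f M c] by simp

lemma L2_diff: "f \<in> L2 M \<Longrightarrow> g \<in> L2 M \<Longrightarrow> (\<lambda>x. f x - g x) \<in> L2 M"
  using L2_add_mult[of f M g "-1"] by simp

lemma L2_inner_add_mult:
  assumes "f \<in> L2 M" "g \<in> L2 M" "h \<in> L2 M"
  shows "L2_inner M f (\<lambda>x. g x + c * h x) = L2_inner M f g + c * L2_inner M f h"
proof -
  have "L2_inner M f (\<lambda>x. g x + c * h x) = (\<integral>x. cnj (f x) * g x + c * (cnj (f x) * h x) \<partial>M)"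
    unfolding L2_inner_def by (intro Bochner_Integration.integral_cong) (auto simp: algebra_simps)
  also have "\<dots> = L2_inner M f g + c * L2_inner M f h"
    unfolding L2_inner_def using L2_inner_integrable[OF assms(1,2)] L2_inner_integrable[OF assms(1,3)] by simp
  finally show ?thesis .
qed

lemma L2_inner_commute: "L2_inner M g f = cnj (L2_inner M f g)"
proof -
  have "(\<lambda>x. cnj (g x) * f x) = (\<lambda>x. cnj (cnj (f x) * g x))"
    by (simp add: fun_eq_iff mult.commute)
  then show ?thesis unfolding L2_inner_def by (simp only: Bochner_Integration.integral_cnj)
qed

lemma L2_inner_add_mult_left:
  assumes "f \<in> L2 M" "g \<in> L2 M" "h \<in> L2 M"
  shows "L2_inner M (\<lambda>x. g x + c * h x) f = L2_inner M g f + cnj c * L2_inner M h f"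
  by (subst (1 2 3) L2_inner_commute) (simp add: L2_inner_add_mult[OF assms])

lemma L2_inner_diff:
  assumes "f \<in> L2 M" "g \<in> L2 M" "h \<in> L2 M"
  shows "L2_inner M f (\<lambda>x. g x - h x) = L2_inner M f g - L2_inner M f h"
    "L2_inner M (\<lambda>x. g x - h x) f = L2_inner M g f - L2_inner M h f"
  using L2_inner_add_mult[OF assms, of "-1"] L2_inner_add_mult_left[OF assms, of "-1"] by simp_all

lemma L2_inner_mult: "L2_inner M f (\<lambda>x. c * g x) = c * L2_inner M f g"
  unfolding L2_inner_def by (simp add: mult.left_commute)

lemma L2_inner_self: "L2_inner M f f = complex_of_real ((L2_norm M f)\<^sup>2)"
proof -
  have "L2_inner M f f = (\<integral>x. complex_of_real ((cmod (f x))\<^sup>2) \<partial>M)"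
    unfolding L2_inner_def by (intro Bochner_Integration.integral_cong refl) (metis complex_norm_square mult.commute)
  also have "\<dots> = complex_of_real (\<integral>x. (cmod (f x))\<^sup>2 \<partial>M)"
    by (rule integral_complex_of_real)
  finally show ?thesis by (simp add: L2_norm_def)
qed

lemma L2_norm_nonneg: "0 \<le> L2_norm M f"
  by (simp add: L2_norm_def)

text \<open>The discriminant argument behind Cauchy-Schwarz, isolated because it serves the L^2
  inner product, the shifted form of an operator and a weighted integral. These are only
  semidefinite, so \<open>C = 0\<close> is a genuine case.\<close>

lemma quadratic_nonneg_imp_bound:
  fixes b :: complex and A C :: real
  assumes C: "0 \<le> C" and pos: "\<And>c. 0 \<le> A + 2 * Re (c * b) + (cmod c)\<^sup>2 * C"
  shows "(cmod b)\<^sup>2 \<le> A * C"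
proof (cases "C = 0")
  case True
  have le: "0 \<le> A - 2 * t * (cmod b)\<^sup>2" for t
    using pos[of "- of_real t * cnj b"] True unfolding cmod_power2
    by (simp add: power2_eq_square algebra_simps)
  have "b = 0"
  proof (rule ccontr)
    assume "b \<noteq> 0"
    \<comment> \<open>This choice of \<open>t\<close> makes the right side \<open>- A - 2\<close>,
      while \<open>t = 0\<close> gives \<open>0 \<le> A\<close>.\<close>
    then have "0 \<le> A - 2 * (A + 1)" using le[of "(A + 1) / (cmod b)\<^sup>2"] by simp
    then show False using le[of 0] by simp
  qed
  then show ?thesis using True by simp
next
  case False
  then have "C > 0" using C by simp
  have "0 \<le> A - (cmod b)\<^sup>2 / C"
  proof -
    \<comment> \<open>The value \<open>c = - cnj b / C\<close> minimizes the quadratic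
      expression.\<close>
    have "Re (- cnj b / of_real C * b) = - (cmod b)\<^sup>2 / C"
      unfolding cmod_power2 using \<open>C > 0\<close> by (simp add: power2_eq_square divide_simps) (simp add: algebra_simps)?
    moreover have "(cmod (- cnj b / of_real C))\<^sup>2 * C = (cmod b)\<^sup>2 / C"
      using \<open>C > 0\<close> by (simp add: norm_divide power_divide power2_eq_square)
    ultimately show ?thesis using pos[of "- cnj b / of_real C"] by linarith
  qed
  then show ?thesis using \<open>C > 0\<close> by (simp add: field_simps)
qed

lemma L2_norm_add_mult:
  assumes "f \<in> L2 M" "g \<in> L2 M"
  shows "(L2_norm M (\<lambda>x. f x + c * g x))\<^sup>2 = (L2_norm M f)\<^sup>2 + 2 * Re (c * L2_inner M f g) + (cmod c)\<^sup>2 * (L2_norm M g)\<^sup>2"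
proof -
  have "complex_of_real ((L2_norm M (\<lambda>x. f x + c * g x))\<^sup>2) = L2_inner M f f + cnj c * L2_inner M g f + c * (L2_inner M f g + cnj c * L2_inner M g g)"
    unfolding L2_inner_self[symmetric] 
    using assms L2_add_mult[OF assms, of c] by (simp add: L2_inner_add_mult L2_inner_add_mult_left)
  also have "\<dots> = of_real ((L2_norm M f)\<^sup>2) + (c * L2_inner M f g + cnj (c * L2_inner M f g)) + (c * cnj c) * of_real ((L2_norm M g)\<^sup>2)"
    by (simp add: L2_inner_self L2_inner_commute[of M g f] algebra_simps)
  also have "\<dots> = complex_of_real ((L2_norm M f)\<^sup>2 + 2 * Re (c * L2_inner M f g) + (cmod c)\<^sup>2 * (L2_norm M g)\<^sup>2)"
    by (simp only: complex_add_cnj complex_norm_square[symmetric] of_real_add of_real_mult)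
  finally show ?thesis by (simp only: of_real_eq_iff)
qed

lemma L2_Cauchy_Schwarz:
  assumes "f \<in> L2 M" "g \<in> L2 M"
  shows "cmod (L2_inner M f g) \<le> L2_norm M f * L2_norm M g"
proof -
  have "(cmod (L2_inner M f g))\<^sup>2 \<le> (L2_norm M f)\<^sup>2 * (L2_norm M g)\<^sup>2"
    by (rule quadratic_nonneg_imp_bound, simp, subst L2_norm_add_mult[OF assms, symmetric], simp)
  then show ?thesis
    by (metis L2_norm_nonneg mult_nonneg_nonneg power2_le_imp_le power_mult_distrib)
qed

lemma L2_norm_triangle:
  assumes "f \<in> L2 M" "g \<in> L2 M"
  shows "L2_norm M (\<lambda>x. f x + g x) \<le> L2_norm M f + L2_norm M g"
proof -
  have "(L2_norm M (\<lambda>x. f x + g x))\<^sup>2 = (L2_norm M f)\<^sup>2 + 2 * Re (L2_inner M f g) + (L2_norm M g)\<^sup>2"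
    using L2_norm_add_mult[OF assms, of 1] by simp
  also have "\<dots> \<le> (L2_norm M f + L2_norm M g)\<^sup>2"
    using L2_Cauchy_Schwarz[OF assms] complex_Re_le_cmod[of "L2_inner M f g"] by (simp add: power2_sum)
  finally show ?thesis
    by (rule power2_le_imp_le) (simp add: L2_norm_nonneg)
qed

lemma L2_norm_minus_commute: "L2_norm M (\<lambda>x. f x - g x) = L2_norm M (\<lambda>x. g x - f x)"
  unfolding L2_norm_def by (simp add: norm_minus_commute)

lemma L2_norm_diff_triangle:
  assumes "f \<in> L2 M" "g \<in> L2 M" "h \<in> L2 M"
  shows "L2_norm M (\<lambda>x. f x - h x) \<le> L2_norm M (\<lambda>x. f x - g x) + L2_norm M (\<lambda>x. g x - h x)"
  using L2_norm_triangle[of "\<lambda>x. f x - g x" M "\<lambda>x. g x - h x"] assms by (simp add: L2_diff)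

lemma L2_norm_triangle_reverse:
  assumes "f \<in> L2 M" "g \<in> L2 M"
  shows "\<bar>L2_norm M f - L2_norm M g\<bar> \<le> L2_norm M (\<lambda>x. f x - g x)"
  using L2_norm_diff_triangle[of f M g "\<lambda>x. 0"] L2_norm_diff_triangle[of g M f "\<lambda>x. 0"] assms
    L2_norm_minus_commute[of M f g] by (simp add: L2_zero)

lemma L2_norm_mult: "L2_norm M (\<lambda>x. c * f x) = cmod c * L2_norm M f"
proof -
  have "(\<integral>x. (cmod (c * f x))\<^sup>2 \<partial>M) = (cmod c)\<^sup>2 * (\<integral>x. (cmod (f x))\<^sup>2 \<partial>M)"
    by (simp add: norm_mult power_mult_distrib)
  then show ?thesis by (simp add: L2_norm_def real_sqrt_mult)
qed

lemma L2_norm_eq_0_iff: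
  assumes "f \<in> L2 M"
  shows "L2_norm M f = 0 \<longleftrightarrow> (AE x in M. f x = 0)"
  using integral_nonneg_eq_0_iff_AE[OF L2_integrable[OF assms]] by (simp add: L2_norm_def)

section \<open>Continuity of norm and inner product under L^2 convergence\<close>

lemma L2_tendsto_norm:
  assumes "L2_tendsto M F f" "\<And>n. F n \<in> L2 M" "f \<in> L2 M"
  shows "(\<lambda>n. L2_norm M (F n)) \<longlonglongrightarrow> L2_norm M f"
proof -
  have "(\<lambda>n. L2_norm M (F n) - L2_norm M f) \<longlonglongrightarrow> 0"
    using L2_norm_triangle_reverse[OF assms(2,3)]
    by (intro Lim_null_comparison[OF _ assms(1)[unfolded L2_tendsto_def]]) auto
  then show ?thesis by (simp add: LIM_zero_iff)
qed

lemma L2_tendsto_inner: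
  assumes F: "L2_tendsto M F f" "\<And>n. F n \<in> L2 M" "f \<in> L2 M"
    and G: "L2_tendsto M G g" "\<And>n. G n \<in> L2 M" "g \<in> L2 M"
  shows "(\<lambda>n. L2_inner M (F n) (G n)) \<longlonglongrightarrow> L2_inner M f g"
proof -
  let ?e = "\<lambda>n. L2_norm M (\<lambda>x. F n x - f x) * L2_norm M (G n) + L2_norm M f * L2_norm M (\<lambda>x. G n x - g x)"
  have "?e \<longlonglongrightarrow> 0 * L2_norm M g + L2_norm M f * 0"
    using F(1) G(1) L2_tendsto_norm[OF G] unfolding L2_tendsto_def by (intro tendsto_intros)
  then have e: "?e \<longlonglongrightarrow> 0" by simp
  have "cmod (L2_inner M (F n) (G n) - L2_inner M f g) \<le> ?e n" for n
  proof -
    have "L2_inner M (F n) (G n) - L2_inner M f g = L2_inner M (\<lambda>x. F n x - f x) (G n) + L2_inner M f (\<lambda>x. G n x - g x)"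
      using F(2,3) G(2,3) by (simp add: L2_inner_diff)
    then have "cmod (L2_inner M (F n) (G n) - L2_inner M f g)
        \<le> cmod (L2_inner M (\<lambda>x. F n x - f x) (G n)) + cmod (L2_inner M f (\<lambda>x. G n x - g x))"
      by (simp add: norm_triangle_ineq)
    also have "\<dots> \<le> ?e n"
      using F G by (intro add_mono L2_Cauchy_Schwarz L2_diff)
    finally show ?thesis .
  qed
  then have "(\<lambda>n. L2_inner M (F n) (G n) - L2_inner M f g) \<longlonglongrightarrow> 0"
    by (intro Lim_null_comparison[OF _ e]) auto
  then show ?thesis by (simp add: LIM_zero_iff)
qed

lemma L2_tendsto_const: "L2_tendsto M (\<lambda>_. f) f"
  by (simp add: L2_tendsto_def L2_norm_def)

lemma L2_tendsto_add_mult: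
  assumes F: "L2_tendsto M F f" "\<And>n. F n \<in> L2 M" "f \<in> L2 M"
    and G: "L2_tendsto M G g" "\<And>n. G n \<in> L2 M" "g \<in> L2 M"
  shows "L2_tendsto M (\<lambda>n x. F n x + c * G n x) (\<lambda>x. f x + c * g x)"
  unfolding L2_tendsto_def
proof (rule Lim_null_comparison)
  let ?e = "\<lambda>n. L2_norm M (\<lambda>x. F n x - f x) + cmod c * L2_norm M (\<lambda>x. G n x - g x)"
  have "?e \<longlonglongrightarrow> 0 + cmod c * 0"
    using F(1) G(1) unfolding L2_tendsto_def by (intro tendsto_intros)
  then show "?e \<longlonglongrightarrow> 0" by simp
  have "L2_norm M (\<lambda>x. F n x + c * G n x - (f x + c * g x)) \<le> ?e n" for n
    unfolding L2_norm_mult[symmetric]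
    using L2_norm_triangle[of "\<lambda>x. F n x - f x" M "\<lambda>x. c * (G n x - g x)"] F G
    by (simp add: L2_diff L2_mult algebra_simps)
  then show "eventually (\<lambda>n. norm (L2_norm M (\<lambda>x. F n x + c * G n x - (f x + c * g x))) \<le> ?e n) sequentially"
    by (simp add: L2_norm_nonneg)
qed

lemma L2_tendsto_diff:
  assumes F: "L2_tendsto M F f" "\<And>n. F n \<in> L2 M" "f \<in> L2 M"
    and G: "L2_tendsto M G g" "\<And>n. G n \<in> L2 M" "g \<in> L2 M"
  shows "L2_tendsto M (\<lambda>n x. F n x - G n x) (\<lambda>x. f x - g x)"
  using L2_tendsto_add_mult[OF assms, of "-1"] by simp

lemma L2_tendsto_Cauchy:
  assumes F: "L2_tendsto M F f" "\<And>n. F n \<in> L2 M" "f \<in> L2 M" and "0 < e"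
  shows "\<exists>N. \<forall>m\<ge>N. \<forall>n\<ge>N. L2_norm M (\<lambda>x. F m x - F n x) < e"
proof -
  obtain N where N: "\<And>n. n \<ge> N \<Longrightarrow> L2_norm M (\<lambda>x. F n x - f x) < e / 2"
    using LIMSEQ_D[OF F(1)[unfolded L2_tendsto_def], of "e/2"] \<open>0 < e\<close> by (auto simp: L2_norm_nonneg)
  have "L2_norm M (\<lambda>x. F m x - F n x) < e" if "m \<ge> N" "n \<ge> N" for m n
    using L2_norm_diff_triangle[of "F m" M f "F n"] F N[OF that(1)] N[OF that(2)]
    by (simp add: L2_norm_minus_commute[of M f])
  then show ?thesis by blast
qed

section \<open>Friedrichs extensions of semibounded operators\<close>

lemma op_closureI:
  assumes "f \<in> L2 M" "h \<in> L2 M" "\<And>n. (F n, H n) \<in> T" "L2_tendsto M F f" "L2_tendsto M H h"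
  shows "(f, h) \<in> op_closure M T"
  unfolding op_closure_def using assms by blast

text \<open>The lower bound \<open>m\<close> is a parameter so that the results can be used with the
  optimal bound \<open>rayleigh_inf M T\<close>, where \<open>m\<close> turns into an
  eigenvalue.\<close>

locale semibounded_op =
  fixes M :: "'a measure" and T :: "('a \<Rightarrow> complex) rel" and m :: real
  assumes L2: "(f, h) \<in> T \<Longrightarrow> f \<in> L2 M \<and> h \<in> L2 M"
    and add_mult: "(f, h) \<in> T \<Longrightarrow> (g, k) \<in> T \<Longrightarrow> (\<lambda>x. f x + c * g x, \<lambda>x. h x + c * k x) \<in> T"
    and symmetric: "(f, h) \<in> T \<Longrightarrow> (g, k) \<in> T \<Longrightarrow> L2_inner M f k = L2_inner M h g"
    and bounded_below: "(f, h) \<in> T \<Longrightarrow> m * (L2_norm M f)\<^sup>2 \<le> Re (L2_inner M f h)"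
begin

lemma Domain_L2: "f \<in> Domain T \<Longrightarrow> f \<in> L2 M"
  using L2 by auto

lemma Domain_add_mult: "f \<in> Domain T \<Longrightarrow> g \<in> Domain T \<Longrightarrow> (\<lambda>x. f x + c * g x) \<in> Domain T"
  using add_mult by blast

lemma Domain_diff: "f \<in> Domain T \<Longrightarrow> g \<in> Domain T \<Longrightarrow> (\<lambda>x. f x - g x) \<in> Domain T"
  using Domain_add_mult[of f g "-1"] by simp

text \<open>Symmetry makes the form independent of the value chosen by \<^const>\<open>op_apply\<close>.\<close>

lemma op_form_eq:
  assumes "f \<in> Domain T" "(g, k) \<in> T"
  shows "op_form M T f g = L2_inner M f k"
proof -
  have "(g, op_apply T g) \<in> T" unfolding op_apply_def by (rule someI[where P = "\<lambda>h. (g, h) \<in> T", OF assms(2)])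
  then show ?thesis using assms symmetric unfolding op_form_def by (metis DomainE)
qed

lemma op_form_eq_left:
  assumes "(f, h) \<in> T" "g \<in> Domain T"
  shows "op_form M T f g = L2_inner M h g"
proof -
  obtain k where k: "(g, k) \<in> T" using assms(2) by auto
  show ?thesis using op_form_eq[of f g k] assms(1) k symmetric[OF assms(1) k] by auto
qed

lemma op_form_add_mult:
  assumes "f \<in> Domain T" "g \<in> Domain T" "h \<in> Domain T"
  shows "op_form M T f (\<lambda>x. g x + c * h x) = op_form M T f g + c * op_form M T f h"
proof -
  obtain k where k: "(f, k) \<in> T" using assms(1) by auto
  show ?thesis
    using op_form_eq_left[OF k] assms Domain_add_mult[of g h c] L2[OF k] Domain_L2
    by (simp add: L2_inner_add_mult)
qed

lemma op_form_commute:
  assumes "f \<in> Domain T" "g \<in> Domain T"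
  shows "op_form M T g f = cnj (op_form M T f g)"
proof -
  obtain k where k: "(f, k) \<in> T" using assms(1) by auto
  show ?thesis using op_form_eq[OF assms(2) k] op_form_eq_left[OF k assms(2)] by (simp add: L2_inner_commute[of M g k])
qed

text \<open>The form shifted by its lower bound: a semi-inner product on \<open>Domain T\<close>, so
  Cauchy-Schwarz applies although \<open>op_form\<close> itself may be indefinite.\<close>

definition a :: "('a \<Rightarrow> complex) \<Rightarrow> ('a \<Rightarrow> complex) \<Rightarrow> complex" where
  "a f g = op_form M T f g - of_real m * L2_inner M f g"

definition a2 :: "('a \<Rightarrow> complex) \<Rightarrow> real" where
  "a2 f = Re (a f f)"

lemma a_add_mult:
  assumes "f \<in> Domain T" "g \<in> Domain T" "h \<in> Domain T"
  shows "a f (\<lambda>x. g x + c * h x) = a f g + c * a f h"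
  using op_form_add_mult[OF assms] assms[THEN Domain_L2] by (simp add: a_def L2_inner_add_mult algebra_simps)

lemma a_commute:
  assumes "f \<in> Domain T" "g \<in> Domain T"
  shows "a g f = cnj (a f g)"
  using op_form_commute[OF assms] by (simp add: a_def L2_inner_commute[of M g f])

lemma a_add_mult_left:
  assumes "f \<in> Domain T" "g \<in> Domain T" "h \<in> Domain T"
  shows "a (\<lambda>x. g x + c * h x) f = a g f + cnj c * a h f"
  using a_commute[of f] a_add_mult[OF assms] assms Domain_add_mult[OF assms(2,3)] by simp

lemma a_diff:
  assumes "f \<in> Domain T" "g \<in> Domain T" "h \<in> Domain T"
  shows "a f (\<lambda>x. g x - h x) = a f g - a f h" "a (\<lambda>x. g x - h x) f = a g f - a h f"
  using a_add_mult[OF assms, of "-1"] a_add_mult_left[OF assms, of "-1"] by simp_all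

lemma a2_nonneg:
  assumes "f \<in> Domain T" shows "0 \<le> a2 f"
proof -
  obtain k where k: "(f, k) \<in> T" using assms by auto
  show ?thesis using op_form_eq[OF assms k] bounded_below[OF k] by (simp add: a2_def a_def L2_inner_self)
qed

lemma a2_add_mult:
  assumes "f \<in> Domain T" "g \<in> Domain T"
  shows "a2 (\<lambda>x. f x + c * g x) = a2 f + 2 * Re (c * a f g) + (cmod c)\<^sup>2 * a2 g"
proof -
  have im: "Im (a g g) = 0" using a_commute[OF assms(2,2)] by (metis Reals_cnj_iff complex_is_Real_iff)
  have "a (\<lambda>x. f x + c * g x) (\<lambda>x. f x + c * g x) = a f f + c * a f g + cnj c * (a g f + c * a g g)"
    using assms Domain_add_mult[OF assms, of c] by (simp add: a_add_mult a_add_mult_left algebra_simps)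
  then show ?thesis
    using im unfolding a2_def a_commute[OF assms] cmod_power2 by (simp add: power2_eq_square algebra_simps)
qed

lemma a_Cauchy_Schwarz:
  assumes "f \<in> Domain T" "g \<in> Domain T"
  shows "cmod (a f g) \<le> sqrt (a2 f) * sqrt (a2 g)"
proof -
  have "(cmod (a f g))\<^sup>2 \<le> a2 f * a2 g"
    by (rule quadratic_nonneg_imp_bound, rule a2_nonneg[OF assms(2)], subst a2_add_mult[OF assms, symmetric],
        rule a2_nonneg[OF Domain_add_mult[OF assms]])
  then show ?thesis by (metis real_le_rsqrt real_sqrt_mult)
qed

lemma a2_diff_le:
  assumes "f \<in> Domain T" "g \<in> Domain T"
  shows "a2 (\<lambda>x. f x - g x) \<le> 2 * a2 f + 2 * a2 g" "a2 f \<le> 2 * a2 (\<lambda>x. f x - g x) + 2 * a2 g"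
proof -
  have 1: "a2 (\<lambda>x. f x - g x) = a2 f - 2 * Re (a f g) + a2 g"
    using a2_add_mult[OF assms, of "-1"] by simp
  have "0 \<le> a2 f + 2 * Re (a f g) + a2 g"
    using a2_nonneg[OF Domain_add_mult[OF assms, of 1]] a2_add_mult[OF assms, of 1] by simp
  then show "a2 (\<lambda>x. f x - g x) \<le> 2 * a2 f + 2 * a2 g" using 1 by simp
  \<comment> \<open>Nonnegativity of \<open>a2\<close> at f - 2 g; its value is the difference of
    the two sides of the claim.\<close>
  have "0 \<le> a2 f + 2 * Re (- 2 * a f g) + 4 * a2 g"
    using a2_nonneg[OF Domain_add_mult[OF assms, of "-2"]] a2_add_mult[OF assms, of "-2"] by simp
  then show "a2 f \<le> 2 * a2 (\<lambda>x. f x - g x) + 2 * a2 g" using 1 by simp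
qed

section \<open>Form Cauchy sequences and closability\<close>

definition a_Cauchy :: "(nat \<Rightarrow> 'a \<Rightarrow> complex) \<Rightarrow> bool" where
  "a_Cauchy F \<longleftrightarrow> (\<forall>n. F n \<in> Domain T) \<and> (\<forall>e>0. \<exists>N. \<forall>i\<ge>N. \<forall>j\<ge>N. a2 (\<lambda>x. F i x - F j x) < e)"

lemma a_CauchyD: "a_Cauchy F \<Longrightarrow> 0 < e \<Longrightarrow> \<exists>N. \<forall>i\<ge>N. \<forall>j\<ge>N. a2 (\<lambda>x. F i x - F j x) < e"
  by (simp add: a_Cauchy_def)

lemma a_Cauchy_Domain: "a_Cauchy F \<Longrightarrow> F n \<in> Domain T"
  by (simp add: a_Cauchy_def)

lemma a_Cauchy_bounded:
  assumes "a_Cauchy F"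
  obtains C where "0 < C" "eventually (\<lambda>n. a2 (F n) \<le> C) sequentially"
proof -
  note D = a_Cauchy_Domain[OF assms]
  obtain N where N: "\<And>i j. i \<ge> N \<Longrightarrow> j \<ge> N \<Longrightarrow> a2 (\<lambda>x. F i x - F j x) < 1"
    using a_CauchyD[OF assms, of 1] by auto
  have "a2 (F n) \<le> 2 + 2 * a2 (F N)" if "n \<ge> N" for n
    using a2_diff_le(2)[OF D[of n] D[of N]] N[OF that order_refl] by simp
  moreover have "0 < 2 + 2 * a2 (F N)" using a2_nonneg[OF D] by (simp add: add_pos_nonneg)
  ultimately show thesis using that[of "2 + 2 * a2 (F N)"] by (auto simp: eventually_sequentially)
qed

lemma a_Cauchy_diff:
  assumes "a_Cauchy F" "a_Cauchy G"
  shows "a_Cauchy (\<lambda>n x. F n x - G n x)"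
  unfolding a_Cauchy_def
proof (intro conjI allI impI)
  note D = a_Cauchy_Domain[OF assms(1)] a_Cauchy_Domain[OF assms(2)]
  show "(\<lambda>x. F n x - G n x) \<in> Domain T" for n using D by (rule Domain_diff)
  fix e :: real assume "0 < e"
  then obtain N1 N2 where N: "\<forall>i\<ge>N1. \<forall>j\<ge>N1. a2 (\<lambda>x. F i x - F j x) < e/4"
    "\<forall>i\<ge>N2. \<forall>j\<ge>N2. a2 (\<lambda>x. G i x - G j x) < e/4"
    using a_CauchyD[OF assms(1), of "e/4"] a_CauchyD[OF assms(2), of "e/4"] by auto
  have "a2 (\<lambda>x. (F i x - G i x) - (F j x - G j x)) < e" if "i \<ge> max N1 N2" "j \<ge> max N1 N2" for i j
  proof -
    have "(\<lambda>x. (F i x - G i x) - (F j x - G j x)) = (\<lambda>x. (F i x - F j x) - (G i x - G j x))"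
      by (simp add: fun_eq_iff)
    then show ?thesis
      using a2_diff_le(1)[OF Domain_diff[OF D(1) D(1)] Domain_diff[OF D(2) D(2)], of i j i j] N that
      by fastforce
  qed
  then show "\<exists>N. \<forall>i\<ge>N. \<forall>j\<ge>N. a2 (\<lambda>x. (F i x - G i x) - (F j x - G j x)) < e" by blast
qed

lemma a_Cauchy_const: "f \<in> Domain T \<Longrightarrow> a_Cauchy (\<lambda>_. f)"
proof -
  assume f: "f \<in> Domain T"
  have "a2 (\<lambda>x. f x - f x) = 0"
    using a2_add_mult[OF f f, of "-1"] by (simp add: a2_def)
  then show "a_Cauchy (\<lambda>_. f)" using f by (auto simp: a_Cauchy_def)
qed

text \<open>Along an L^2 convergent sequence the shift \<open>m * (L2_norm M _)^2\<close> of the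
  differences tends to 0, so being Cauchy for the form and for the shifted form are the same. By
  symmetry the form is real on the diagonal.\<close>

lemma form_tendsto_iff: "form_tendsto M T F f \<longleftrightarrow> a_Cauchy F \<and> f \<in> L2 M \<and> L2_tendsto M F f"
proof -
  have "(\<forall>e>0. \<exists>N. \<forall>i\<ge>N. \<forall>j\<ge>N. cmod (op_form M T (\<lambda>x. F i x - F j x) (\<lambda>x. F i x - F j x)) < e) \<longleftrightarrow>
      (\<forall>e>0. \<exists>N. \<forall>i\<ge>N. \<forall>j\<ge>N. a2 (\<lambda>x. F i x - F j x) < e)" (is "?L \<longleftrightarrow> ?R")
    if F: "\<forall>n. F n \<in> Domain T" "f \<in> L2 M" "L2_tendsto M F f"
  proof -
    let ?d = "\<lambda>i j x. F i x - F j x"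
    have D: "?d i j \<in> Domain T" for i j using F(1) by (blast intro: Domain_diff)
    have form: "op_form M T (?d i j) (?d i j) = of_real (a2 (?d i j) + m * (L2_norm M (?d i j))\<^sup>2)" for i j
    proof -
      have "Im (op_form M T (?d i j) (?d i j)) = 0"
        using op_form_commute[OF D D, of i j i j] by (metis Reals_cnj_iff complex_is_Real_iff)
      then show ?thesis by (simp add: a2_def a_def L2_inner_self complex_eq_iff)
    qed
    have small: "\<exists>N. \<forall>i\<ge>N. \<forall>j\<ge>N. \<bar>m * (L2_norm M (?d i j))\<^sup>2\<bar> < e" if "0 < e" for e
    proof -
      define e' where "e' = sqrt (e / (\<bar>m\<bar> + 1))"
      have e': "0 < e'" using that by (simp add: e'_def)
      obtain N where N: "\<forall>i\<ge>N. \<forall>j\<ge>N. L2_norm M (?d i j) < e'"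
        using L2_tendsto_Cauchy[OF F(3) _ F(2) e'] F(1) Domain_L2 by blast
      have "\<bar>m * (L2_norm M (?d i j))\<^sup>2\<bar> < e" if "i \<ge> N" "j \<ge> N" for i j
      proof -
        have "\<bar>m * (L2_norm M (?d i j))\<^sup>2\<bar> \<le> (\<bar>m\<bar> + 1) * (L2_norm M (?d i j))\<^sup>2"
          by (simp add: abs_mult mult_right_mono)
        also have "\<dots> < (\<bar>m\<bar> + 1) * e'\<^sup>2"
          using N that by (intro mult_strict_left_mono power_strict_mono) (auto simp: L2_norm_nonneg)
        also have "\<dots> = e" using \<open>0 < e\<close> by (simp add: e'_def)
        finally show ?thesis .
      qed
      then show ?thesis by blast
    qed
    show ?thesis
    proof
      assume L: ?L
      show ?R
      proof (intro allI impI)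
        fix e :: real assume "0 < e"
        then obtain N1 N2 where N: "\<forall>i\<ge>N1. \<forall>j\<ge>N1. cmod (op_form M T (?d i j) (?d i j)) < e/2"
          "\<forall>i\<ge>N2. \<forall>j\<ge>N2. \<bar>m * (L2_norm M (?d i j))\<^sup>2\<bar> < e/2"
          using L small[of "e/2"] by (meson half_gt_zero)
        have "a2 (?d i j) < e" if "i \<ge> max N1 N2" "j \<ge> max N1 N2" for i j
        proof -
          have "\<bar>a2 (?d i j) + m * (L2_norm M (?d i j))\<^sup>2\<bar> < e/2" 
            using N(1) that form[of i j] by (metis max.bounded_iff norm_of_real)
          moreover have "\<bar>m * (L2_norm M (?d i j))\<^sup>2\<bar> < e/2" using N(2) that by simp
          ultimately show ?thesis by linarith
        qed
        then show "\<exists>N. \<forall>i\<ge>N. \<forall>j\<ge>N. a2 (?d i j) < e" by blast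
      qed
    next
      assume R: ?R
      show ?L
      proof (intro allI impI)
        fix e :: real assume "0 < e"
        then obtain N1 N2 where N: "\<forall>i\<ge>N1. \<forall>j\<ge>N1. a2 (?d i j) < e/2"
          "\<forall>i\<ge>N2. \<forall>j\<ge>N2. \<bar>m * (L2_norm M (?d i j))\<^sup>2\<bar> < e/2"
          using R small[of "e/2"] by (meson half_gt_zero)
        have "cmod (op_form M T (?d i j) (?d i j)) < e" if "i \<ge> max N1 N2" "j \<ge> max N1 N2" for i j
        proof -
          have "a2 (?d i j) < e/2" "\<bar>m * (L2_norm M (?d i j))\<^sup>2\<bar> < e/2" using N that by simp_all
          then show ?thesis using a2_nonneg[OF D[of i j]] unfolding form norm_of_real by linarith
        qed
        then show "\<exists>N. \<forall>i\<ge>N. \<forall>j\<ge>N. cmod (op_form M T (?d i j) (?d i j)) < e" by blast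
      qed
    qed
  qed
  then show ?thesis unfolding form_tendsto_def a_Cauchy_def by blast
qed

text \<open>Closability of the form of a symmetric operator: split \<open>a (F n) (F n)\<close> at a
  fixed late member \<open>F N1\<close>. Against the difference it is small by Cauchy-Schwarz;
  against \<open>F N1\<close> it is an L^2 inner product with fixed vectors, hence tends to 0 with
  \<open>F n\<close>.\<close>

lemma form_closable:
  assumes F: "a_Cauchy F" and 0: "L2_tendsto M F (\<lambda>_. 0)"
  shows "(\<lambda>n. a2 (F n)) \<longlonglongrightarrow> 0"
proof (rule LIMSEQ_I)
  fix e :: real assume "0 < e"
  note D = a_Cauchy_Domain[OF F]
  obtain C N0 where C: "0 < C" "\<And>n. n \<ge> N0 \<Longrightarrow> a2 (F n) \<le> C"
    using a_Cauchy_bounded[OF F] by (metis eventually_sequentially)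
  \<comment> \<open>Chosen so that \<open>sqrt C * sqrt d = e / 2\<close> in the Cauchy-Schwarz
    estimate below.\<close>
  define d where "d = (e / (2 * sqrt C))\<^sup>2"
  have "0 < d" using C \<open>0 < e\<close> by (simp add: d_def)
  obtain N1 where N1: "\<forall>i\<ge>N1. \<forall>j\<ge>N1. a2 (\<lambda>x. F i x - F j x) < d"
    using a_CauchyD[OF F \<open>0 < d\<close>] by blast
  obtain h where h: "(F N1, h) \<in> T" using D by blast
  have lim: "(\<lambda>n. a (F n) (F N1)) \<longlonglongrightarrow> 0"
  proof -
    have "(\<lambda>n. L2_inner M (F n) h - of_real m * L2_inner M (F n) (F N1)) \<longlonglongrightarrow>
        L2_inner M (\<lambda>_. 0) h - of_real m * L2_inner M (\<lambda>_. 0) (F N1)"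
      using 0 L2[OF h] D Domain_L2 by (intro tendsto_intros L2_tendsto_inner L2_tendsto_const) (auto simp: L2_zero)
    then show ?thesis using op_form_eq[OF D h] by (simp add: a_def L2_inner_def[of _ "\<lambda>_. 0"])
  qed
  obtain N2 where N2: "\<And>n. n \<ge> N2 \<Longrightarrow> cmod (a (F n) (F N1)) < e / 2"
    using LIMSEQ_D[OF lim, of "e/2"] \<open>0 < e\<close> by auto
  have "norm (a2 (F n) - 0) < e" if n: "n \<ge> max N0 (max N1 N2)" for n
  proof -
    have "a (F n) (F n) = a (F n) (\<lambda>x. F n x - F N1 x) + a (F n) (F N1)"
      using a_diff(1)[OF D D D, of n n N1] by simp
    then have "a2 (F n) \<le> cmod (a (F n) (\<lambda>x. F n x - F N1 x)) + cmod (a (F n) (F N1))"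
      unfolding a2_def by (metis complex_Re_le_cmod norm_triangle_ineq order_trans)
    also have "cmod (a (F n) (\<lambda>x. F n x - F N1 x)) \<le> sqrt (a2 (F n)) * sqrt (a2 (\<lambda>x. F n x - F N1 x))"
      using D by (intro a_Cauchy_Schwarz Domain_diff) auto
    also have "\<dots> \<le> sqrt C * sqrt d"
      using C N1 n a2_nonneg[OF D] a2_nonneg[OF Domain_diff[OF D D]]
      by (intro mult_mono real_sqrt_le_mono) (auto intro: less_imp_le)
    also have "\<dots> = e / 2" using C \<open>0 < e\<close> by (simp add: d_def)
    also have "cmod (a (F n) (F N1)) < e / 2" using N2 n by simp
    finally show ?thesis using a2_nonneg[OF D[of n]] by simp
  qed
  then show "\<exists>N. \<forall>n\<ge>N. norm (a2 (F n) - 0) < e" by blast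
qed

lemma a_tendsto_0:
  assumes F: "a_Cauchy F" "(\<lambda>n. a2 (F n)) \<longlonglongrightarrow> 0" and G: "a_Cauchy G"
  shows "(\<lambda>n. a (F n) (G n)) \<longlonglongrightarrow> 0" "(\<lambda>n. a (G n) (F n)) \<longlonglongrightarrow> 0"
proof -
  note D = a_Cauchy_Domain[OF F(1)] a_Cauchy_Domain[OF G]
  obtain C where C: "0 < C" "eventually (\<lambda>n. a2 (G n) \<le> C) sequentially"
    using a_Cauchy_bounded[OF G] by metis
  have lim: "(\<lambda>n. sqrt (a2 (F n)) * sqrt C) \<longlonglongrightarrow> 0"
    using tendsto_mult[OF tendsto_real_sqrt[OF F(2)] tendsto_const[of "sqrt C"]] by simp
  show 1: "(\<lambda>n. a (F n) (G n)) \<longlonglongrightarrow> 0"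
  proof (rule Lim_null_comparison[OF _ lim])
    show "eventually (\<lambda>n. cmod (a (F n) (G n)) \<le> sqrt (a2 (F n)) * sqrt C) sequentially"
      using C(2)
    proof eventually_elim
      case (elim n)
      have "cmod (a (F n) (G n)) \<le> sqrt (a2 (F n)) * sqrt (a2 (G n))" by (rule a_Cauchy_Schwarz[OF D])
      also have "\<dots> \<le> sqrt (a2 (F n)) * sqrt C"
        using elim a2_nonneg[OF D(1)] by (intro mult_left_mono) auto
      finally show ?case .
    qed
  qed
  have "(\<lambda>n. cnj (a (F n) (G n))) \<longlonglongrightarrow> cnj 0" using 1 by (intro tendsto_cnj)
  then show "(\<lambda>n. a (G n) (F n)) \<longlonglongrightarrow> 0" using a_commute[OF D] by simp
qed

text \<open>The difference of two sequences with the same limit is form Cauchy and L^2 null, so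
  closability applies. This makes values of the closed form independent of the approximating
  sequence.\<close>

lemma a2_diff_tendsto_0:
  assumes "form_tendsto M T F f" "form_tendsto M T G f"
  shows "a_Cauchy (\<lambda>n x. F n x - G n x)" "(\<lambda>n. a2 (\<lambda>x. F n x - G n x)) \<longlonglongrightarrow> 0"
proof -
  have F: "a_Cauchy F" "f \<in> L2 M" "L2_tendsto M F f" and G: "a_Cauchy G" "L2_tendsto M G f"
    using assms by (auto simp: form_tendsto_iff)
  show 1: "a_Cauchy (\<lambda>n x. F n x - G n x)" by (rule a_Cauchy_diff[OF F(1) G(1)])
  have "L2_tendsto M (\<lambda>n x. F n x - G n x) (\<lambda>x. f x - f x)"
    using F G a_Cauchy_Domain Domain_L2 by (intro L2_tendsto_diff) auto
  then show "(\<lambda>n. a2 (\<lambda>x. F n x - G n x)) \<longlonglongrightarrow> 0" by (intro form_closable[OF 1]) simp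
qed

text \<open>Membership in the form domain supplies at least one pair of approximating sequences;
  without one, every number would satisfy the condition under \<open>THE\<close>.\<close>

lemma closed_form_eqI:
  assumes "f \<in> closed_form_dom M T" "g \<in> closed_form_dom M T"
    and "\<And>F G. form_tendsto M T F f \<Longrightarrow> form_tendsto M T G g \<Longrightarrow> (\<lambda>n. op_form M T (F n) (G n)) \<longlonglongrightarrow> z"
  shows "closed_form M T f g = z"
  unfolding closed_form_def
proof (rule the_equality)
  show "\<forall>F G. form_tendsto M T F f \<longrightarrow> form_tendsto M T G g \<longrightarrow> (\<lambda>n. op_form M T (F n) (G n)) \<longlonglongrightarrow> z"
    using assms(3) by blast
  obtain F G where FG: "form_tendsto M T F f" "form_tendsto M T G g"
    using assms(1,2) by (auto simp: closed_form_dom_def)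
  show "w = z" if "\<forall>F G. form_tendsto M T F f \<longrightarrow> form_tendsto M T G g \<longrightarrow> (\<lambda>n. op_form M T (F n) (G n)) \<longlonglongrightarrow> w" for w
    using that assms(3) FG LIMSEQ_unique by blast
qed

lemma op_form_conv_a: "op_form M T f g = a f g + of_real m * L2_inner M f g"
  by (simp add: a_def)

text \<open>If the shifted form dies out along one approximating sequence of \<open>f\<close>, it
  does so along all of them; Cauchy-Schwarz then removes it against every \<open>G\<close>, and only
  \<open>m\<close> times the inner product remains of the closed form.\<close>

lemma friedrichs_bound_eigenfunction:
  assumes F: "form_tendsto M T F f" and a0: "(\<lambda>n. a2 (F n)) \<longlonglongrightarrow> 0"
  shows "(f, \<lambda>x. of_real m * f x) \<in> friedrichs M T"
proof -
  have f: "f \<in> L2 M" "f \<in> closed_form_dom M T" using F by (auto simp: form_tendsto_iff closed_form_dom_def)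
  have "closed_form M T g f = L2_inner M g (\<lambda>x. of_real m * f x)" if g: "g \<in> closed_form_dom M T" for g
  proof (rule closed_form_eqI[OF g f(2)])
    fix G F' assume G: "form_tendsto M T G g" and F': "form_tendsto M T F' f"
    have cF: "a_Cauchy F" "a_Cauchy F'" "L2_tendsto M F' f" and cG: "a_Cauchy G" "g \<in> L2 M" "L2_tendsto M G g"
      using F F' G by (auto simp: form_tendsto_iff)
    note D = a_Cauchy_Domain[OF cF(1)] a_Cauchy_Domain[OF cF(2)] a_Cauchy_Domain[OF cG(1)]
    have "(\<lambda>n. 2 * a2 (\<lambda>x. F' n x - F n x) + 2 * a2 (F n)) \<longlonglongrightarrow> 2 * 0 + 2 * 0"
      by (intro tendsto_intros a0 a2_diff_tendsto_0(2)[OF F' F])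
    then have "(\<lambda>n. 2 * a2 (\<lambda>x. F' n x - F n x) + 2 * a2 (F n)) \<longlonglongrightarrow> 0" by simp
    then have "(\<lambda>n. a2 (F' n)) \<longlonglongrightarrow> 0"
      by (rule Lim_null_comparison[rotated]) (use a2_diff_le(2)[OF D(2) D(1)] a2_nonneg[OF D(2)] in auto)
    then have "(\<lambda>n. a (G n) (F' n)) \<longlonglongrightarrow> 0" by (rule a_tendsto_0(2)[OF cF(2) _ cG(1)])
    then have "(\<lambda>n. a (G n) (F' n) + of_real m * L2_inner M (G n) (F' n)) \<longlonglongrightarrow> 0 + of_real m * L2_inner M g f"
      using cF cG f D Domain_L2 by (intro tendsto_intros L2_tendsto_inner) auto
    then show "(\<lambda>n. op_form M T (G n) (F' n)) \<longlonglongrightarrow> L2_inner M g (\<lambda>x. of_real m * f x)"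
      by (simp add: op_form_conv_a L2_inner_mult)
  qed
  then show ?thesis using f by (simp add: friedrichs_def L2_mult)
qed

lemma form_tendsto_const: "f \<in> Domain T \<Longrightarrow> form_tendsto M T (\<lambda>_. f) f"
  by (simp add: form_tendsto_iff a_Cauchy_const Domain_L2 L2_tendsto_const)

text \<open>The weak form of the equation for \<open>f\<close>, tested with elements of
  \<open>T\<close>. Since the constant sequence approximates \<open>g\<close>, any other sequence
  \<open>G\<close> for \<open>g\<close> may be replaced by it up to a vanishing error, and then the
  operator can be moved onto \<open>g\<close>.\<close>

lemma friedrichs_inner:
  assumes fh: "(f, h) \<in> friedrichs M T" and gk: "(g, k) \<in> T"
  shows "L2_inner M k f = L2_inner M g h"
proof -
  have f: "f \<in> closed_form_dom M T" using fh by (simp add: friedrichs_def)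
  have gD: "g \<in> Domain T" using gk by auto
  have g: "g \<in> closed_form_dom M T" using form_tendsto_const[OF gD] by (auto simp: closed_form_dom_def)
  have "closed_form M T g f = L2_inner M k f"
  proof (rule closed_form_eqI[OF g f])
    fix G F assume G: "form_tendsto M T G g" and F: "form_tendsto M T F f"
    have cF: "a_Cauchy F" "f \<in> L2 M" "L2_tendsto M F f" and cG: "a_Cauchy G" "g \<in> L2 M" "L2_tendsto M G g"
      using F G by (auto simp: form_tendsto_iff)
    note D = a_Cauchy_Domain[OF cF(1)] a_Cauchy_Domain[OF cG(1)]
    note L = D[THEN Domain_L2] cF(2) cG(2) L2[OF gk, THEN conjunct2]
    have "(\<lambda>n. a (\<lambda>x. G n x - g x) (F n)) \<longlonglongrightarrow> 0"
      using a2_diff_tendsto_0[OF G form_tendsto_const[OF gD]] cF(1) by (intro a_tendsto_0(1)) auto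
    moreover have "(\<lambda>n. L2_inner M (\<lambda>x. G n x - g x) (F n)) \<longlonglongrightarrow> L2_inner M (\<lambda>x. g x - g x) f"
      using cF(3) cG(3) L by (intro L2_tendsto_inner L2_tendsto_diff L2_tendsto_const L2_diff) auto
    moreover have "(\<lambda>n. L2_inner M k (F n)) \<longlonglongrightarrow> L2_inner M k f"
      using cF(3) L by (intro L2_tendsto_inner L2_tendsto_const) auto
    ultimately have "(\<lambda>n. (a (\<lambda>x. G n x - g x) (F n) + of_real m * L2_inner M (\<lambda>x. G n x - g x) (F n)) + L2_inner M k (F n)) \<longlonglongrightarrow>
        (0 + of_real m * L2_inner M (\<lambda>x. g x - g x) f) + L2_inner M k f"
      by (intro tendsto_intros)
    moreover have "(a (\<lambda>x. G n x - g x) (F n) + of_real m * L2_inner M (\<lambda>x. G n x - g x) (F n)) + L2_inner M k (F n) = op_form M T (G n) (F n)" for n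
      using a_diff(2)[OF D(1) D(2) gD, of n n] op_form_eq_left[OF gk D(1)] L
      by (simp add: a_def L2_inner_diff algebra_simps)
    ultimately show "(\<lambda>n. op_form M T (G n) (F n)) \<longlonglongrightarrow> L2_inner M k f"
      by (simp add: L2_inner_def[of _ "\<lambda>_. 0"])
  qed
  then show ?thesis using fh g by (simp add: friedrichs_def)
qed

text \<open>The product of \<open>l - m\<close> with the squared norm of \<open>f\<close> is a limit
  of values \<open>a (F n) (F j)\<close>, which differ from \<open>a2 (F n) \<ge> 0\<close> by at
  most \<open>e\<close> for late indices. As \<open>friedrichs_inner\<close> tests only with
  elements of \<open>T\<close>, the limits are taken one at a time: first in \<open>j\<close>, then
  in \<open>n\<close>.\<close>

lemma friedrichs_eigenvalue_ge:
  assumes fh: "(f, \<lambda>x. of_real l * f x) \<in> friedrichs M T" and nz: "\<not> (AE x in M. f x = 0)"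
  shows "m \<le> l"
proof -
  obtain F where F: "form_tendsto M T F f" using fh by (auto simp: friedrichs_def closed_form_dom_def)
  then have cF: "a_Cauchy F" "f \<in> L2 M" "L2_tendsto M F f" by (auto simp: form_tendsto_iff)
  note D = a_Cauchy_Domain[OF cF(1)]
  note L = D[THEN Domain_L2] cF(2)
  have "\<forall>n. \<exists>h. (F n, h) \<in> T" using D by blast
  then obtain H where H: "\<And>n. (F n, H n) \<in> T" by metis
  note HL = L2[OF H, THEN conjunct2]
  have norm_pos: "0 < L2_norm M f" using L2_norm_eq_0_iff[OF cF(2)] nz L2_norm_nonneg[of M f] by linarith
  let ?b = "\<lambda>n. L2_inner M (H n) f - of_real m * L2_inner M (F n) f"
  have b: "?b n = of_real (l - m) * L2_inner M (F n) f" for n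
    using friedrichs_inner[OF fh H, of n] by (simp add: L2_inner_mult algebra_simps)
  have lim: "?b \<longlonglongrightarrow> of_real (l - m) * L2_inner M f f"
    unfolding b using cF L by (intro tendsto_intros L2_tendsto_inner L2_tendsto_const) auto
  have b_lim: "(\<lambda>j. a (F n) (F j)) \<longlonglongrightarrow> ?b n" for n
  proof -
    have "(\<lambda>j. L2_inner M (H n) (F j) - of_real m * L2_inner M (F n) (F j)) \<longlonglongrightarrow> ?b n"
      using cF L HL by (intro tendsto_intros L2_tendsto_inner L2_tendsto_const) auto
    then show ?thesis using op_form_eq_left[OF H D] by (simp add: a_def)
  qed
  obtain C N0 where C: "0 < C" "\<And>n. n \<ge> N0 \<Longrightarrow> a2 (F n) \<le> C"
    using a_Cauchy_bounded[OF cF(1)] by (metis eventually_sequentially)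
  have ge: "- e \<le> (l - m) * (L2_norm M f)\<^sup>2" if "0 < e" for e
  proof -
    define d where "d = (e / sqrt C)\<^sup>2"
    have "0 < d" using C that by (simp add: d_def)
    obtain N1 where N1: "\<forall>i\<ge>N1. \<forall>j\<ge>N1. a2 (\<lambda>x. F i x - F j x) < d"
      using a_CauchyD[OF cF(1) \<open>0 < d\<close>] by blast
    have ge1: "- e \<le> Re (a (F n) (F j))" if nj: "n \<ge> max N0 N1" "j \<ge> max N0 N1" for n j
    proof -
      have "a (F n) (F j) = a (F n) (F n) + a (F n) (\<lambda>x. F j x - F n x)"
        using a_diff(1)[OF D D D, of n j n] by simp
      then have "Re (a (F n) (F j)) \<ge> a2 (F n) - cmod (a (F n) (\<lambda>x. F j x - F n x))"
        using abs_Re_le_cmod[of "a (F n) (\<lambda>x. F j x - F n x)"] by (simp add: a2_def)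
      moreover have "cmod (a (F n) (\<lambda>x. F j x - F n x)) \<le> e"
      proof -
        have "cmod (a (F n) (\<lambda>x. F j x - F n x)) \<le> sqrt (a2 (F n)) * sqrt (a2 (\<lambda>x. F j x - F n x))"
          using D by (intro a_Cauchy_Schwarz Domain_diff) auto
        also have "\<dots> \<le> sqrt C * sqrt d"
          using C N1 nj a2_nonneg[OF D] a2_nonneg[OF Domain_diff[OF D D]]
          by (intro mult_mono real_sqrt_le_mono) (auto intro: less_imp_le)
        also have "\<dots> = e" using C \<open>0 < e\<close> by (simp add: d_def)
        finally show ?thesis .
      qed
      ultimately show ?thesis using a2_nonneg[OF D, of n] by linarith
    qed
    have "- e \<le> Re (?b n)" if "n \<ge> max N0 N1" for n
      by (rule tendsto_lowerbound[OF tendsto_Re[OF b_lim]])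
        (use ge1[OF that] in \<open>auto simp: eventually_sequentially intro!: exI[of _ "max N0 N1"]\<close>)
    then have "- e \<le> Re (of_real (l - m) * L2_inner M f f)"
      by (intro tendsto_lowerbound[OF tendsto_Re[OF lim]])
        (auto simp: eventually_sequentially intro!: exI[of _ "max N0 N1"])
    then show ?thesis by (simp add: L2_inner_self)
  qed
  have "0 \<le> (l - m) * (L2_norm M f)\<^sup>2"
    by (rule field_le_epsilon) (use ge in fastforce)
  then show ?thesis using norm_pos by (simp add: zero_le_mult_iff)
qed

lemma op_closure_superset: "T \<subseteq> op_closure M T"
proof (rule subrelI)
  fix f h assume "(f, h) \<in> T"
  then show "(f, h) \<in> op_closure M T"
    using L2 by (intro op_closureI[of _ _ _ "\<lambda>_. f" "\<lambda>_. h"] L2_tendsto_const) auto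
qed

lemma op_closureE:
  assumes "(f, h) \<in> op_closure M T"
  obtains F H where "f \<in> L2 M" "h \<in> L2 M" "\<And>n. (F n, H n) \<in> T" "L2_tendsto M F f" "L2_tendsto M H h"
    "\<And>n. F n \<in> L2 M" "\<And>n. H n \<in> L2 M"
proof -
  obtain F H where "f \<in> L2 M" "h \<in> L2 M" "\<And>n. (F n, H n) \<in> T" "L2_tendsto M F f" "L2_tendsto M H h"
    using assms unfolding op_closure_def by auto
  then show thesis using that[of F H] L2 by blast
qed

lemma semibounded_op_closure: "semibounded_op M (op_closure M T) m"
proof
  fix f h assume fh: "(f, h) \<in> op_closure M T"
  then obtain F H where FH: "f \<in> L2 M" "h \<in> L2 M" "\<And>n. (F n, H n) \<in> T" "L2_tendsto M F f" "L2_tendsto M H h"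
    "\<And>n. F n \<in> L2 M" "\<And>n. H n \<in> L2 M"
    by (rule op_closureE) (rule that)
  show "f \<in> L2 M \<and> h \<in> L2 M" using FH by simp
  have 1: "(\<lambda>n. Re (L2_inner M (F n) (H n))) \<longlonglongrightarrow> Re (L2_inner M f h)"
    using FH by (intro tendsto_Re L2_tendsto_inner)
  have 2: "(\<lambda>n. m * (L2_norm M (F n))\<^sup>2) \<longlonglongrightarrow> m * (L2_norm M f)\<^sup>2"
    using FH by (intro tendsto_intros L2_tendsto_norm)
  show "m * (L2_norm M f)\<^sup>2 \<le> Re (L2_inner M f h)"
    by (rule LIMSEQ_le[OF 2 1]) (use bounded_below[OF FH(3)] in auto)
  fix g k assume gk: "(g, k) \<in> op_closure M T"
  then obtain G K where GK: "g \<in> L2 M" "k \<in> L2 M" "\<And>n. (G n, K n) \<in> T" "L2_tendsto M G g" "L2_tendsto M K k"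
    "\<And>n. G n \<in> L2 M" "\<And>n. K n \<in> L2 M"
    by (rule op_closureE) (rule that)
  have 3: "(\<lambda>n. L2_inner M (F n) (K n)) \<longlonglongrightarrow> L2_inner M f k" "(\<lambda>n. L2_inner M (H n) (G n)) \<longlonglongrightarrow> L2_inner M h g"
    using FH GK by (auto intro: L2_tendsto_inner)
  show "L2_inner M f k = L2_inner M h g"
    using LIMSEQ_unique[OF 3(1)] 3(2) symmetric[OF FH(3) GK(3)] by simp
  fix c
  show "(\<lambda>x. f x + c * g x, \<lambda>x. h x + c * k x) \<in> op_closure M T"
  proof (rule op_closureI)
    show "(\<lambda>x. F n x + c * G n x, \<lambda>x. H n x + c * K n x) \<in> T" for n
      by (rule add_mult[OF FH(3) GK(3)])
  qed (use FH GK in \<open>auto intro!: L2_add_mult L2_tendsto_add_mult\<close>)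
qed

text \<open>For normalized elements whose form values tend to the lower bound,
  \<open>a2 (F n)\<close> tends to 0. The sequence is then automatically form Cauchy, so L^2
  convergence alone puts its limit into the form domain.\<close>

lemma minimizing_sequence:
  assumes FH: "\<And>n. (F n, H n) \<in> T" "\<And>n. L2_norm M (F n) = 1"
    and lim: "(\<lambda>n. Re (L2_inner M (F n) (H n))) \<longlonglongrightarrow> m"
    and f: "f \<in> L2 M" "L2_tendsto M F f"
  shows "(f, \<lambda>x. of_real m * f x) \<in> friedrichs M T" "L2_norm M f = 1"
proof -
  have D: "F n \<in> Domain T" for n using FH(1) by blast
  show "L2_norm M f = 1"
    using LIMSEQ_unique[OF L2_tendsto_norm[OF f(2) Domain_L2[OF D] f(1)]] FH(2) by simp
  have a2F: "a2 (F n) = Re (L2_inner M (F n) (H n)) - m" for n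
    using op_form_eq[OF D FH(1), of n n] FH(2)[of n] by (simp add: a2_def a_def L2_inner_self)
  have a0: "(\<lambda>n. a2 (F n)) \<longlonglongrightarrow> 0"
    unfolding a2F using lim by (simp add: LIM_zero)
  have "a_Cauchy F"
    unfolding a_Cauchy_def
  proof (intro conjI allI impI D)
    fix e :: real assume "0 < e"
    then obtain N where N: "\<And>n. n \<ge> N \<Longrightarrow> a2 (F n) < e / 4"
      using LIMSEQ_D[OF a0, of "e/4"] by fastforce
    have "a2 (\<lambda>x. F i x - F j x) < e" if "i \<ge> N" "j \<ge> N" for i j
      using a2_diff_le(1)[OF D D, of i j] N[OF that(1)] N[OF that(2)] by simp
    then show "\<exists>N. \<forall>i\<ge>N. \<forall>j\<ge>N. a2 (\<lambda>x. F i x - F j x) < e" by blast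
  qed
  then have "form_tendsto M T F f" using f by (simp add: form_tendsto_iff)
  from friedrichs_bound_eigenfunction[OF this a0]
  show "(f, \<lambda>x. of_real m * f x) \<in> friedrichs M T" .
qed

lemma L2_inner_eq_0:
  assumes "(f, h) \<in> T" "L2_norm M f = 0"
  shows "L2_inner M f h = 0"
  using L2_Cauchy_Schwarz[of f M h] L2[OF assms(1)] assms(2) by simp

lemma normalize:
  assumes fh: "(f, h) \<in> T" and nz: "L2_norm M f \<noteq> 0"
  obtains f' h' where "(f', h') \<in> T" "L2_norm M f' = 1"
    "Re (L2_inner M f' h') = Re (L2_inner M f h) / (L2_norm M f)\<^sup>2"
proof -
  define n where "n = L2_norm M f"
  have n: "0 < n" using nz L2_norm_nonneg[of M f] by (simp add: n_def)
  define c where "c = complex_of_real (1 / n)"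
  \<comment> \<open>Scaling by \<open>c\<close> is written as adding \<open>c - 1\<close> times the
    element to itself, to fit \<open>add_mult\<close>.\<close>
  have "(\<lambda>x. f x + (c - 1) * f x, \<lambda>x. h x + (c - 1) * h x) \<in> T" by (rule add_mult[OF fh fh])
  then have T: "(\<lambda>x. c * f x, \<lambda>x. c * h x) \<in> T" by (simp add: algebra_simps)
  have "L2_inner M (\<lambda>x. c * f x) (\<lambda>x. c * h x) = cnj c * c * L2_inner M f h"
    using L2_inner_mult[of M "\<lambda>x. c * f x" c h] L2_inner_mult[of M h c f] L2_inner_commute[of M "\<lambda>x. c * f x" h]
      L2_inner_commute[of M f h] by simp
  then have "Re (L2_inner M (\<lambda>x. c * f x) (\<lambda>x. c * h x)) = Re (L2_inner M f h) / n\<^sup>2"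
    by (simp add: c_def power2_eq_square)
  moreover have "L2_norm M (\<lambda>x. c * f x) = 1" using n unfolding L2_norm_mult by (simp add: c_def norm_divide n_def)
  ultimately show thesis using that[OF T] by (simp add: n_def)
qed

end

definition rayleigh_inf :: "'a measure \<Rightarrow> ('a \<Rightarrow> complex) rel \<Rightarrow> real" where
  "rayleigh_inf M T = Inf {Re (L2_inner M f h) |f h. (f, h) \<in> T \<and> L2_norm M f = 1}"

lemma (in semibounded_op) rayleigh_bdd_below:
  "bdd_below {Re (L2_inner M f h) |f h. (f, h) \<in> T \<and> L2_norm M f = 1}"
  using bounded_below by (intro bdd_belowI[of _ m]) fastforce

lemma (in semibounded_op) rayleigh_inf_le:
  "(f, h) \<in> T \<Longrightarrow> L2_norm M f = 1 \<Longrightarrow> rayleigh_inf M T \<le> Re (L2_inner M f h)"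
  unfolding rayleigh_inf_def by (rule cInf_lower[OF _ rayleigh_bdd_below]) blast

text \<open>By homogeneity, the infimum over normalized elements bounds the form everywhere;
  elements of norm 0 have vanishing form by Cauchy-Schwarz.\<close>

lemma (in semibounded_op) semibounded_rayleigh_inf: "semibounded_op M T (rayleigh_inf M T)"
proof unfold_locales
  fix f h assume fh: "(f, h) \<in> T"
  show "rayleigh_inf M T * (L2_norm M f)\<^sup>2 \<le> Re (L2_inner M f h)"
  proof (cases "L2_norm M f = 0")
    case True
    then show ?thesis using L2_inner_eq_0[OF fh] by simp
  next
    case False
    obtain f' h' where f': "(f', h') \<in> T" "L2_norm M f' = 1"
      "Re (L2_inner M f' h') = Re (L2_inner M f h) / (L2_norm M f)\<^sup>2"
      by (rule normalize[OF fh False]) (rule that)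
    show ?thesis using rayleigh_inf_le[OF f'(1,2)] False unfolding f'(3) by (simp add: pos_le_divide_eq)
  qed
qed (use L2 add_mult symmetric in auto)

text \<open>The condition \<open>compact\<close> is the sequential form of a compact embedding of
  the form domain into L^2, and \<open>nontrivial\<close> makes the set whose infimum is
  \<open>rayleigh_inf\<close> nonempty.\<close>

locale compact_op = semibounded_op +
  assumes nontrivial: "\<exists>f h. (f, h) \<in> T \<and> L2_norm M f \<noteq> 0"
    and compact: "\<And>(F :: nat \<Rightarrow> 'a \<Rightarrow> complex) H K. (\<And>n. (F n, H n) \<in> T) \<Longrightarrow> (\<And>n. L2_norm M (F n) \<le> 1) \<Longrightarrow>
      (\<And>n. Re (L2_inner M (F n) (H n)) \<le> K) \<Longrightarrow> \<exists>f\<in>L2 M. \<exists>k. strict_mono k \<and> L2_tendsto M (F \<circ> k) f"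
begin

text \<open>The minimizing sequence is part of the conclusion, not only its limit: it is what gets
  extended by zero to the larger interval.\<close>

lemma ground_state:
  obtains F H f where "\<And>n. (F n, H n) \<in> T" "\<And>n. L2_norm M (F n) = 1"
    "(\<lambda>n. Re (L2_inner M (F n) (H n))) \<longlonglongrightarrow> rayleigh_inf M T" "f \<in> L2 M" "L2_tendsto M F f"
proof -
  let ?S = "{Re (L2_inner M f h) |f h. (f, h) \<in> T \<and> L2_norm M f = 1}"
  obtain f h where "(f, h) \<in> T" "L2_norm M f \<noteq> 0" using nontrivial by blast
  then have ne: "?S \<noteq> {}" by (rule normalize) blast
  have "\<exists>z\<in>?S. z < rayleigh_inf M T + 1 / real (Suc n)" for n
    unfolding rayleigh_inf_def using cInf_lessD[OF ne, of "Inf ?S + 1 / real (Suc n)"] by simp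
  then have "\<forall>n. \<exists>fh. fh \<in> T \<and> L2_norm M (fst fh) = 1 \<and> Re (L2_inner M (fst fh) (snd fh)) < rayleigh_inf M T + 1 / real (Suc n)"
    by fastforce
  then obtain P where P: "\<And>n. P n \<in> T \<and> L2_norm M (fst (P n)) = 1 \<and> Re (L2_inner M (fst (P n)) (snd (P n))) < rayleigh_inf M T + 1 / real (Suc n)"
    by metis
  define F H where "F n = fst (P n)" and "H n = snd (P n)" for n
  have FH: "(F n, H n) \<in> T" "L2_norm M (F n) = 1" "Re (L2_inner M (F n) (H n)) < rayleigh_inf M T + 1 / real (Suc n)" for n
    using P[of n] by (simp_all add: F_def H_def)
  have le: "Re (L2_inner M (F n) (H n)) \<le> rayleigh_inf M T + 1" for n
  proof -
    have "1 / real (Suc n) \<le> 1" by simp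
    then show ?thesis using FH(3)[of n] by linarith
  qed
  obtain f k where fk: "f \<in> L2 M" "strict_mono k" "L2_tendsto M (F \<circ> k) f"
    using compact[of F H, OF FH(1) eq_refl[OF FH(2)] le] by blast
  have lim: "(\<lambda>n. Re (L2_inner M (F n) (H n))) \<longlonglongrightarrow> rayleigh_inf M T"
  proof (rule tendsto_sandwich[where f = "\<lambda>_. rayleigh_inf M T" and h = "\<lambda>n. rayleigh_inf M T + 1 / real (Suc n)"])
    show "(\<lambda>n. rayleigh_inf M T + 1 / real (Suc n)) \<longlonglongrightarrow> rayleigh_inf M T"
      using tendsto_add[OF tendsto_const LIMSEQ_inverse_real_of_nat, of "rayleigh_inf M T"]
      by (simp add: inverse_eq_divide)
  qed (use rayleigh_inf_le[OF FH(1,2)] FH(3) in \<open>auto intro!: always_eventually less_imp_le\<close>)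
  show thesis
    by (rule that[of "F \<circ> k" "H \<circ> k" f])
      (use FH fk LIMSEQ_subseq_LIMSEQ[OF lim fk(2)] in \<open>auto simp: o_def\<close>)
qed

lemma friedrichs_minimizing_sequence:
  assumes FH: "\<And>n. (F n, H n) \<in> T" "\<And>n. L2_norm M (F n) = 1"
    and lim: "(\<lambda>n. Re (L2_inner M (F n) (H n))) \<longlonglongrightarrow> rayleigh_inf M T"
    and f: "f \<in> L2 M" "L2_tendsto M F f"
  shows "(f, \<lambda>x. of_real (rayleigh_inf M T) * f x) \<in> friedrichs M (op_closure M T)" "L2_norm M f = 1"
proof -
  interpret T: semibounded_op M T "rayleigh_inf M T" by (rule semibounded_rayleigh_inf)
  interpret C: semibounded_op M "op_closure M T" "rayleigh_inf M T" by (rule T.semibounded_op_closure)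
  have "(F n, H n) \<in> op_closure M T" for n using T.op_closure_superset FH(1) by blast
  from C.minimizing_sequence[OF this FH(2) lim f]
  show "(f, \<lambda>x. of_real (rayleigh_inf M T) * f x) \<in> friedrichs M (op_closure M T)" "L2_norm M f = 1"
    by auto
qed

text \<open>Closing the operator keeps the bound \<open>rayleigh_inf M T\<close>, and compactness
  makes this bound an eigenvalue, so the minimum required by \<open>LEAST\<close> is
  attained.\<close>

lemma lowest_eigenvalue_friedrichs:
  "lowest_eigenvalue M (friedrichs M (op_closure M T)) = rayleigh_inf M T"
  unfolding lowest_eigenvalue_def
proof (rule Least_equality)
  interpret T: semibounded_op M T "rayleigh_inf M T" by (rule semibounded_rayleigh_inf)
  interpret C: semibounded_op M "op_closure M T" "rayleigh_inf M T" by (rule T.semibounded_op_closure)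
  obtain F H f where *: "\<And>n. (F n, H n) \<in> T" "\<And>n. L2_norm M (F n) = 1"
    "(\<lambda>n. Re (L2_inner M (F n) (H n))) \<longlonglongrightarrow> rayleigh_inf M T" "f \<in> L2 M" "L2_tendsto M F f"
    by (rule ground_state) (rule that)
  show "is_eigenvalue M (friedrichs M (op_closure M T)) (complex_of_real (rayleigh_inf M T))"
    unfolding is_eigenvalue_def
    using friedrichs_minimizing_sequence[OF *] L2_norm_eq_0_iff[OF *(4)] *(4) by (intro bexI[of _ f]) auto
  show "rayleigh_inf M T \<le> l" if "is_eigenvalue M (friedrichs M (op_closure M T)) (complex_of_real l)" for l
    using that C.friedrichs_eigenvalue_ge unfolding is_eigenvalue_def by blast
qed

lemma friedrichs_closure_inner:
  assumes "(f, h) \<in> friedrichs M (op_closure M T)" "(g, k) \<in> T"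
  shows "L2_inner M k f = L2_inner M g h"
proof -
  interpret C: semibounded_op M "op_closure M T" m by (rule semibounded_op_closure)
  show ?thesis using C.friedrichs_inner[OF assms(1)] op_closure_superset assms(2) by blast
qed

end

section \<open>Linear integral equations\<close>

lemma prim_eq_0:
  assumes "\<And>u. u \<le> t \<Longrightarrow> \<phi> u = 0" shows "prim \<phi> t = 0"
proof -
  have "(\<lambda>u. indicat_real {..t} u *\<^sub>R \<phi> u) = (\<lambda>u. 0)"
    using assms by (auto simp: fun_eq_iff indicator_def)
  then show ?thesis unfolding prim_def set_lebesgue_integral_def by simp
qed

lemma prim_eq_const:
  assumes "integrable lebesgue \<phi>" "\<And>u. x \<le> u \<Longrightarrow> u \<le> t \<Longrightarrow> \<phi> u = 0" "x \<le> t"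
  shows "prim \<phi> t = prim \<phi> x"
proof -
  have "(\<lambda>u. indicat_real {x..t} u *\<^sub>R \<phi> u) = (\<lambda>u. 0)"
    using assms(2) by (auto simp: fun_eq_iff indicator_def)
  then have "(LINT u:{x..t}|lebesgue. \<phi> u) = 0"
    unfolding set_lebesgue_integral_def by simp
  then show ?thesis using prim_increment[OF assms(1,3)] by simp
qed

lemma prim_eq_integral:
  assumes "\<And>u. t < u \<Longrightarrow> \<phi> u = 0"
  shows "prim \<phi> t = (LINT u|lebesgue. \<phi> u)"
proof -
  have "(\<lambda>u. indicat_real {..t} u *\<^sub>R \<phi> u) = \<phi>"
  proof
    show "indicat_real {..t} u *\<^sub>R \<phi> u = \<phi> u" for u
      using assms[of u] by (cases "u \<le> t") auto
  qed
  then show ?thesis unfolding prim_def set_lebesgue_integral_def by simp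
qed

lemma AC_on_real_prim:
  "integrable lebesgue (\<phi> :: real \<Rightarrow> real) \<Longrightarrow> absolutely_continuous_on S (\<lambda>t. complex_of_real (prim \<phi> t))"
  unfolding absolutely_continuous_on_def
proof (intro allI impI)
  fix e :: real assume int: "integrable lebesgue \<phi>" and e: "0 < e"
  show "\<exists>d>0. \<forall>D. D division_of (\<Union>D) \<longrightarrow> \<Union>D \<subseteq> S \<longrightarrow>
        (\<Sum>K\<in>D. Sup K - Inf K) < d \<longrightarrow> (\<Sum>K\<in>D. norm (complex_of_real (prim \<phi> (Sup K)) - complex_of_real (prim \<phi> (Inf K)))) < e"
    by (rule prim_absolutely_continuous[OF int e]) (auto simp: of_real_diff[symmetric] simp del: of_real_diff)
qed

lemma continuous_imp_lebesgue_measurable: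
  fixes f :: "real \<Rightarrow> 'b::euclidean_space"
  shows "continuous_on UNIV f \<Longrightarrow> f \<in> borel_measurable lebesgue"
  by (intro measurable_completion) (simp add: borel_measurable_continuous_onI)

lemma integrable_bounded_mult:
  fixes f :: "real \<Rightarrow> 'b::euclidean_space"
  assumes "integrable lebesgue c" "continuous_on UNIV f" "\<And>t. norm (f t) \<le> B"
  shows "integrable lebesgue (\<lambda>t. c t *\<^sub>R f t)"
proof (rule Bochner_Integration.integrable_bound)
  show "integrable lebesgue (\<lambda>t. B * c t)" using assms(1) by simp
  have "f \<in> borel_measurable lebesgue"
    using assms(2) by (rule continuous_imp_lebesgue_measurable)
  then show "(\<lambda>t. c t *\<^sub>R f t) \<in> borel_measurable lebesgue"
    using borel_measurable_integrable[OF assms(1)] by (intro borel_measurable_scaleR)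
  show "AE t in lebesgue. norm (c t *\<^sub>R f t) \<le> norm (B * c t)"
  proof (rule AE_I2)
    fix t
    have "0 \<le> B" using assms(3)[of t] norm_ge_zero order_trans by blast
    then show "norm (c t *\<^sub>R f t) \<le> norm (B * c t)"
      using mult_right_mono[OF assms(3)[of t], of "\<bar>c t\<bar>"] by (simp add: abs_mult mult.commute)
  qed
qed

text \<open>Product rule for indefinite integrals of merely integrable functions, through absolute
  continuity of the product. Since both densities vanish up to \<open>a\<close>, the functions take
  the values \<open>u0\<close> and \<open>v0\<close> there, which fixes the constant.\<close>

lemma prim_product:
  fixes \<phi> \<psi> :: "real \<Rightarrow> complex"
  assumes int: "integrable lebesgue \<phi>" "integrable lebesgue \<psi>"
    and 0: "\<And>t. t \<le> a \<Longrightarrow> \<phi> t = 0" "\<And>t. t \<le> a \<Longrightarrow> \<psi> t = 0"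
    and u: "\<And>t. u t = u0 + prim \<phi> t" and v: "\<And>t. v t = v0 + prim \<psi> t"
  shows "integrable lebesgue (\<lambda>t. \<phi> t * v t + u t * \<psi> t)"
    and "u t * v t = u0 * v0 + prim (\<lambda>t. \<phi> t * v t + u t * \<psi> t) t"
proof -
  define U V where "U = norm u0 + (LINT x|lebesgue. norm (\<phi> x))" and "V = norm v0 + (LINT x|lebesgue. norm (\<psi> x))"
  have Ub: "norm (u t) \<le> U" and Vb: "norm (v t) \<le> V" for t
    unfolding U_def V_def u v by (intro norm_triangle_le add_left_mono norm_prim_le int)+
  have cu: "continuous_on UNIV u" and cv: "continuous_on UNIV v"
    unfolding u[abs_def] v[abs_def] by (intro continuous_intros continuous_on_prim int)+
  have bm: "f \<in> borel_measurable lebesgue" if "continuous_on UNIV f" for f :: "real \<Rightarrow> complex"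
    using that by (rule continuous_imp_lebesgue_measurable)
  have i: "integrable lebesgue (\<lambda>t. c t * f t)" if "integrable lebesgue c" "continuous_on UNIV f" "\<And>t. norm (f t) \<le> B"
    for c f :: "real \<Rightarrow> complex" and B
  proof (rule Bochner_Integration.integrable_bound)
    show "integrable lebesgue (\<lambda>t. B * norm (c t))" using that(1) by simp
    show "(\<lambda>t. c t * f t) \<in> borel_measurable lebesgue"
      using borel_measurable_integrable[OF that(1)] bm[OF that(2)] by (intro borel_measurable_times)
    show "AE t in lebesgue. norm (c t * f t) \<le> norm (B * norm (c t))"
    proof (rule AE_I2)
      fix t
      have "0 \<le> B" using that(3)[of t] norm_ge_zero order_trans by blast
      then show "norm (c t * f t) \<le> norm (B * norm (c t))"
        using mult_right_mono[OF that(3)[of t], of "norm (c t)"] by (simp add: norm_mult abs_mult mult.commute)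
    qed
  qed
  show int': "integrable lebesgue (\<lambda>t. \<phi> t * v t + u t * \<psi> t)"
    using i[OF int(1) cv Vb] i[OF int(2) cu Ub] by (simp add: mult.commute)
  show "u t * v t = u0 * v0 + prim (\<lambda>t. \<phi> t * v t + u t * \<psi> t) t"
  proof (cases "t \<le> a")
    case True
    then have "prim (\<lambda>t. \<phi> t * v t + u t * \<psi> t) t = 0" "prim \<phi> t = 0" "prim \<psi> t = 0"
      using 0 by (auto intro!: prim_eq_0)
    then show ?thesis by (simp add: u v)
  next
    case False
    have acu: "absolutely_continuous_on {a..t} (prim \<phi>)" and acv: "absolutely_continuous_on {a..t} (prim \<psi>)"
      by (intro absolutely_continuous_on_prim int)+
    have "absolutely_continuous_on {a..t} (\<lambda>t. u t * v t)"
    proof (rule absolutely_continuous_on_combine[OF acu acv])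
      fix x y
      have "u y * v y - u x * v x = (u y - u x) * v y + u x * (v y - v x)" by (simp add: algebra_simps)
      also have "norm \<dots> \<le> norm (u y - u x) * V + U * norm (v y - v x)"
        using Ub[of x] Vb[of y] by (intro norm_triangle_le add_mono) (auto simp: norm_mult mult_left_mono mult_right_mono)
      also have "\<dots> \<le> (U + V) * (norm (u y - u x) + norm (v y - v x))"
        using order_trans[OF norm_ge_zero Ub] order_trans[OF norm_ge_zero Vb] by (simp add: algebra_simps)
      finally have le: "norm (u y * v y - u x * v x) \<le> (U + V) * (norm (u y - u x) + norm (v y - v x))" .
      have "u y - u x = prim \<phi> y - prim \<phi> x" "v y - v x = prim \<psi> y - prim \<psi> x" by (simp_all add: u v)
      with le show "norm (u y * v y - u x * v x) \<le> (U + V) * (norm (prim \<phi> y - prim \<phi> x) + norm (prim \<psi> y - prim \<psi> x))"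
        by (simp only:)
    qed
    moreover have "AE z in lebesgue. a < z \<and> z < t \<longrightarrow> ((\<lambda>t. u t * v t) has_vector_derivative (\<phi> z * v z + u z * \<psi> z)) (at z)"
      using prim_has_vector_derivative[OF int(1)] prim_has_vector_derivative[OF int(2)]
    proof eventually_elim
      case (elim z)
      have "(u has_vector_derivative \<phi> z) (at z)" "(v has_vector_derivative \<psi> z) (at z)"
        unfolding u[abs_def] v[abs_def] using elim by (auto intro!: derivative_eq_intros)
      from has_vector_derivative_mult[OF this] show ?case by (simp add: add.commute)
    qed
    ultimately have "u t * v t - u a * v a = prim (\<lambda>t. \<phi> t * v t + u t * \<psi> t) t - prim (\<lambda>t. \<phi> t * v t + u t * \<psi> t) a"
      using False by (intro AC_increment_eq_prim int') auto
    moreover have "prim (\<lambda>t. \<phi> t * v t + u t * \<psi> t) a = 0" "prim \<phi> a = 0" "prim \<psi> a = 0"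
      using 0 by (auto intro!: prim_eq_0)
    ultimately show ?thesis by (simp add: u v algebra_simps)
  qed
qed

text \<open>The chain rule for \<open>exp (2 * prim L t)\<close>, whose almost everywhere derivative
  is twice the integrand. It evaluates the weighted integral that decides the contraction constant
  of the Picard iteration.\<close>

lemma prim_exp:
  fixes L :: "real \<Rightarrow> real"
  assumes int: "integrable lebesgue L" and pos: "\<And>t. 0 \<le> L t" and 0: "\<And>t. t \<le> a \<Longrightarrow> L t = 0"
  shows "integrable lebesgue (\<lambda>t. L t * exp (2 * prim L t))"
    and "prim (\<lambda>t. L t * exp (2 * prim L t)) t = (exp (2 * prim L t) - 1) / 2"
proof -
  define B where "B = exp (2 * (LINT x|lebesgue. norm (L x)))"
  have cont: "continuous_on UNIV (\<lambda>t. exp (2 * prim L t))"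
    by (intro continuous_intros continuous_on_prim int)
  have Lb: "prim L t \<le> (LINT x|lebesgue. norm (L x))" "0 \<le> prim L t" for t
    using norm_prim_le[OF int, of t] prim_nonneg[of L t, OF pos] by auto
  have bound: "norm (exp (2 * prim L t)) \<le> B" for t
    using Lb[of t] by (simp add: B_def)
  show int': "integrable lebesgue (\<lambda>t. L t * exp (2 * prim L t))"
    using integrable_bounded_mult[OF int cont bound] by simp
  show "prim (\<lambda>t. L t * exp (2 * prim L t)) t = (exp (2 * prim L t) - 1) / 2"
  proof (cases "t \<le> a")
    case True
    then have "prim (\<lambda>t. L t * exp (2 * prim L t)) t = 0" "prim L t = 0"
      using 0 by (auto intro!: prim_eq_0)
    then show ?thesis by simp
  next
    case False
    let ?G = "\<lambda>t. complex_of_real (exp (2 * prim L t))" and ?g = "\<lambda>t. complex_of_real (2 * (L t * exp (2 * prim L t)))"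
    have ac: "absolutely_continuous_on {a..t} (\<lambda>t. complex_of_real (prim L t))"
      by (rule AC_on_real_prim[OF int])
    have "absolutely_continuous_on {a..t} ?G"
    proof (rule absolutely_continuous_on_combine[OF ac ac])
      have *: "exp (2 * prim L y) - exp (2 * prim L x) \<le> 2 * B * (prim L y - prim L x)" if "x \<le> y" for x y
      proof -
        have le: "prim L x \<le> prim L y" by (rule prim_increasing[OF int pos that])
        have "exp (2 * prim L y) - exp (2 * prim L x) = exp (2 * prim L y) * (1 - exp (- (2 * (prim L y - prim L x))))"
          by (simp add: right_diff_distrib exp_diff[symmetric] exp_minus[symmetric] mult_exp_exp)
        also have "\<dots> \<le> exp (2 * prim L y) * (2 * (prim L y - prim L x))"
        proof (intro mult_left_mono)
          show "1 - exp (- (2 * (prim L y - prim L x))) \<le> 2 * (prim L y - prim L x)"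
            using exp_ge_add_one_self[of "- (2 * (prim L y - prim L x))"] by linarith
        qed simp
        also have "\<dots> \<le> B * (2 * (prim L y - prim L x))"
          using bound[of y] le by (intro mult_right_mono) auto
        finally show ?thesis by (simp only: mult.assoc mult.left_commute)
      qed
      fix x y
      have "\<bar>exp (2 * prim L y) - exp (2 * prim L x)\<bar> \<le> 2 * B * \<bar>prim L y - prim L x\<bar>"
      proof (cases "x \<le> y")
        case True
        then show ?thesis using *[OF True] prim_increasing[OF int pos True] by simp
      next
        case False
        then show ?thesis using *[of y x] prim_increasing[OF int pos, of y x] by simp
      qed
      then show "norm (?G y - ?G x) \<le> B * (norm (complex_of_real (prim L y) - complex_of_real (prim L x)) + norm (complex_of_real (prim L y) - complex_of_real (prim L x)))"
        by (simp only: of_real_diff[symmetric] norm_of_real) simp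
    qed
    moreover have "AE z in lebesgue. a < z \<and> z < t \<longrightarrow> (?G has_vector_derivative ?g z) (at z)"
      using prim_has_vector_derivative[OF int]
    proof eventually_elim
      case (elim z)
      then have "(prim L has_real_derivative L z) (at z)"
        by (simp add: has_real_derivative_iff_has_vector_derivative)
      then have "((\<lambda>t. exp (2 * prim L t)) has_real_derivative 2 * (L z * exp (2 * prim L z))) (at z)"
        by (auto intro!: derivative_eq_intros)
      then show ?case
        by (auto intro!: has_vector_derivative_of_real simp: has_real_derivative_iff_has_vector_derivative simp del: of_real_mult)
    qed
    moreover have int2: "integrable lebesgue (\<lambda>t. 2 * (L t * exp (2 * prim L t)))" using int' by simp
    ultimately have "?G t - ?G a = prim ?g t - prim ?g a"
      using False by (intro AC_increment_eq_prim integrable_of_real) auto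
    moreover have "prim ?g t = of_real (2 * prim (\<lambda>t. L t * exp (2 * prim L t)) t)" for t
      unfolding prim_def by (simp only: set_integral_complex_of_real set_integral_mult_right)
    moreover have "prim ?g a = 0" "prim L a = 0"
      using 0 by (auto intro!: prim_eq_0)
    ultimately have "complex_of_real (exp (2 * prim L t) - 1) = of_real (2 * prim (\<lambda>t. L t * exp (2 * prim L t)) t)"
      by simp
    then show ?thesis unfolding of_real_eq_iff by simp
  qed
qed

text \<open>Picard iteration contracts in the supremum norm weighted by \<open>exp (- 2 * prim L t)\<close>.\<close>

lemma integral_equation_solution:
  fixes F :: "real \<Rightarrow> 'e::euclidean_space \<Rightarrow> 'e" and L :: "real \<Rightarrow> real"
  assumes int: "integrable lebesgue L" and pos: "\<And>t. 0 \<le> L t" and 0: "\<And>t. t \<le> a \<Longrightarrow> L t = 0"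
    and lip: "\<And>t y z. norm (F t y - F t z) \<le> L t * norm (y - z)"
    and intF: "\<And>y B. continuous_on UNIV y \<Longrightarrow> (\<And>t. norm (y t) \<le> B) \<Longrightarrow> integrable lebesgue (\<lambda>t. F t (y t))"
  obtains y B where "continuous_on UNIV y" "\<And>t. norm (y t) \<le> B" "\<And>t. y t = y0 + prim (\<lambda>u. F u (y u)) t"
proof -
  define E where "E t = exp (2 * prim L t)" for t
  define C where "C = exp (2 * (LINT x|lebesgue. norm (L x)))"
  have Lb: "prim L t \<le> (LINT x|lebesgue. norm (L x))" "0 \<le> prim L t" for t
    using norm_prim_le[OF int, of t] prim_nonneg[of L t, OF pos] by auto
  have E: "1 \<le> E t" "E t \<le> C" "0 < E t" for t using Lb[of t] by (auto simp: E_def C_def)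
  have contE: "continuous_on UNIV E" unfolding E_def by (intro continuous_intros continuous_on_prim int)
  have Ez: "continuous_on UNIV (\<lambda>t. E t *\<^sub>R apply_bcontfun z t)" "norm (E t *\<^sub>R apply_bcontfun z t) \<le> C * norm z"
    for z :: "real \<Rightarrow>\<^sub>C 'e" and t
  proof -
    show "continuous_on UNIV (\<lambda>t. E t *\<^sub>R apply_bcontfun z t)"
      by (intro continuous_intros contE) (auto intro: continuous_on_apply_bcontfun)
    show "norm (E t *\<^sub>R apply_bcontfun z t) \<le> C * norm z"
      using E[of t] norm_bounded[of z t] by (auto intro!: mult_mono)
  qed
  note intz = intF[OF Ez]
  \<comment> \<open>The unknown is \<open>z = y / E\<close>: dividing by the weight replaces the
    weighted supremum norm of \<open>y\<close> by the ordinary one on bounded continuous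
    functions.\<close>
  define \<Theta> where "\<Theta> z t = (1 / E t) *\<^sub>R (y0 + prim (\<lambda>u. F u (E u *\<^sub>R apply_bcontfun z u)) t)" for z :: "real \<Rightarrow>\<^sub>C 'e" and t
  have \<Theta>_bcont: "\<Theta> z \<in> bcontfun" for z
  proof (rule bcontfun_normI)
    show "continuous_on UNIV (\<Theta> z)"
      unfolding \<Theta>_def[abs_def] using E(3) by (intro continuous_intros contE continuous_on_prim intz) (auto simp: less_imp_neq[THEN not_sym])
    let ?I = "LINT x|lebesgue. norm (F x (E x *\<^sub>R apply_bcontfun z x))"
    show "norm (\<Theta> z t) \<le> norm y0 + ?I" for t
    proof -
      have "norm (\<Theta> z t) \<le> norm (y0 + prim (\<lambda>u. F u (E u *\<^sub>R apply_bcontfun z u)) t)"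
      proof -
        have "\<bar>1 / E t\<bar> \<le> 1" using E[of t] by simp
        then show ?thesis unfolding \<Theta>_def norm_scaleR by (intro mult_left_le_one_le) auto
      qed
      also have "\<dots> \<le> norm y0 + ?I"
        by (intro norm_triangle_le add_left_mono norm_prim_le intz)
      finally show ?thesis .
    qed
  qed
  define \<Phi> where "\<Phi> z = Bcontfun (\<Theta> z)" for z
  have app: "apply_bcontfun (\<Phi> z) = \<Theta> z" for z
    unfolding \<Phi>_def by (rule Bcontfun_inverse[OF \<Theta>_bcont])
  have contr: "dist (\<Phi> z) (\<Phi> w) \<le> (1/2) * dist z w" for z w
  proof (rule dist_bound)
    fix t
    let ?f = "\<lambda>z u. F u (E u *\<^sub>R apply_bcontfun z u)"
    have "norm (prim (?f z) t - prim (?f w) t) = norm (prim (\<lambda>u. ?f z u - ?f w u) t)"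
      by (subst prim_diff[OF intz intz]) simp
    also have "\<dots> \<le> prim (\<lambda>u. norm (?f z u - ?f w u)) t"
    proof -
      have "norm (prim (\<lambda>u. ?f z u - ?f w u) t) \<le> (LINT u|lebesgue. norm (indicat_real {..t} u *\<^sub>R (?f z u - ?f w u)))"
        unfolding prim_def set_lebesgue_integral_def by (rule integral_norm_bound)
      then show ?thesis unfolding prim_def set_lebesgue_integral_def by simp
    qed
    also have "\<dots> \<le> prim (\<lambda>u. dist z w * (L u * E u)) t"
    proof (rule prim_mono)
      show "integrable lebesgue (\<lambda>u. norm (?f z u - ?f w u))"
        by (intro integrable_norm Bochner_Integration.integrable_diff intz)
      show "integrable lebesgue (\<lambda>u. dist z w * (L u * E u))"
        unfolding E_def by (intro integrable_mult_right prim_exp(1)[OF int pos 0])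
      fix u
      have "norm (?f z u - ?f w u) \<le> L u * norm (E u *\<^sub>R apply_bcontfun z u - E u *\<^sub>R apply_bcontfun w u)" by (rule lip)
      also have "\<dots> = L u * (E u * dist (apply_bcontfun z u) (apply_bcontfun w u))"
        using E[of u] by (simp add: scaleR_diff_right[symmetric] dist_norm del: scaleR_diff_right)
      also have "\<dots> \<le> L u * (E u * dist z w)"
        using E[of u] pos[of u] dist_bounded[of z u w] by (intro mult_left_mono) auto
      finally show "norm (?f z u - ?f w u) \<le> dist z w * (L u * E u)" by (simp add: mult_ac)
    qed
    also have "\<dots> = dist z w * prim (\<lambda>u. L u * E u) t" unfolding prim_def by simp
    also have "prim (\<lambda>u. L u * E u) t = (E t - 1) / 2"
      unfolding E_def by (rule prim_exp(2)[OF int pos 0])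
    \<comment> \<open>The factor 2 in the exponent of \<open>E\<close> is what produces the
      contraction constant \<open>1/2\<close>.\<close>
    also have "dist z w * ((E t - 1) / 2) \<le> E t * (1/2 * dist z w)"
      by (simp add: algebra_simps)
    finally have *: "norm (prim (?f z) t - prim (?f w) t) \<le> E t * (1/2 * dist z w)" .
    have "dist (\<Theta> z t) (\<Theta> w t) = (1 / E t) * norm (prim (?f z) t - prim (?f w) t)"
      using E[of t] by (simp add: \<Theta>_def dist_norm scaleR_diff_right[symmetric] del: scaleR_diff_right)
    also have "\<dots> \<le> (1 / E t) * (E t * (1/2 * dist z w))"
      using E[of t] by (intro mult_left_mono *) auto
    also have "\<dots> = 1/2 * dist z w" using E[of t] by simp
    finally show "dist (apply_bcontfun (\<Phi> z) t) (apply_bcontfun (\<Phi> w) t) \<le> 1/2 * dist z w"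
      unfolding app .
  qed
  have "\<exists>!z. \<Phi> z = z"
    by (rule banach_fix_type[where c = "1/2"]) (use contr in auto)
  then obtain z where z: "\<Phi> z = z" by blast
  show thesis
  proof (rule that[of "\<lambda>t. E t *\<^sub>R apply_bcontfun z t"])
    show "continuous_on UNIV (\<lambda>t. E t *\<^sub>R apply_bcontfun z t)" by (rule Ez)
    show "norm (E t *\<^sub>R apply_bcontfun z t) \<le> C * norm z" for t by (rule Ez)
    show "E t *\<^sub>R apply_bcontfun z t = y0 + prim (\<lambda>u. F u (E u *\<^sub>R apply_bcontfun z u)) t" for t
    proof -
      have "apply_bcontfun z t = \<Theta> z t" using app[of z] z by simp
      then show ?thesis using E[of t] by (simp add: \<Theta>_def)
    qed
  qed
qed

section \<open>Regular Sturm--Liouville expressions\<close>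

text \<open>The set where two continuous functions differ within \<open>U\<close> is open, and a
  nonempty open set is not negligible.\<close>

lemma continuous_AE_eq:
  fixes u v :: "real \<Rightarrow> 'b::metric_space"
  assumes U: "open U" and cont: "continuous_on U u" "continuous_on U v"
    and ae: "AE t in lebesgue. t \<in> U \<longrightarrow> u t = v t" and t: "t \<in> U"
  shows "u t = v t"
proof -
  let ?N = "{t \<in> U. u t \<noteq> v t}"
  have "?N = U \<inter> (\<lambda>t. dist (u t) (v t)) -` {0<..}" by auto
  also have "open \<dots>"
    using cont U by (intro continuous_open_preimage) (auto intro!: continuous_intros)
  finally have op: "open ?N" .
  have "negligible ?N"
    using ae op by (auto simp: negligible_iff_null_sets eventually_ae_filter intro: null_sets_completion_subset)
  then have "?N = {}" using op open_not_negligible by blast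
  then show ?thesis using t by blast
qed

locale SL_regular =
  fixes p q r s :: "real \<Rightarrow> real" and a b :: real
  assumes ab: "a < b"
    and p_meas: "p \<in> borel_measurable (lebesgue_on {a<..<b})"
    and r_meas: "r \<in> borel_measurable (lebesgue_on {a<..<b})"
    and p_pos: "AE x in lebesgue_on {a<..<b}. p x > 0"
    and r_pos: "AE x in lebesgue_on {a<..<b}. r x > 0"
    and p_int: "integrable (lebesgue_on {a<..<b}) (\<lambda>x. 1 / p x)"
    and q_int: "integrable (lebesgue_on {a<..<b}) q"
    and r_int: "integrable (lebesgue_on {a<..<b}) r"
    and s_int: "integrable (lebesgue_on {a<..<b}) s"
begin

abbreviation "I \<equiv> {a<..<b}"

abbreviation "M \<equiv> weighted r a b"

text \<open>The coefficients extended by zero; \<open>max 0\<close> turns the signs of \<open>1 / p\<close> and \<open>r\<close> into pointwise facts.\<close>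

definition "P t = max 0 (indicat_real I t * (1 / p t))"
definition "Q t = indicat_real I t * q t"
definition "R t = max 0 (indicat_real I t * r t)"
definition "S t = indicat_real I t * s t"

lemma P_int: "integrable lebesgue P" and Q_int: "integrable lebesgue Q"
  and R_int: "integrable lebesgue R" and S_int: "integrable lebesgue S"
  unfolding P_def[abs_def] Q_def[abs_def] R_def[abs_def] S_def[abs_def]
  using p_int q_int r_int s_int by (auto simp: integrable_restrict_space)

lemma PQRS_outside: "t \<notin> I \<Longrightarrow> P t = 0" "t \<notin> I \<Longrightarrow> Q t = 0" "t \<notin> I \<Longrightarrow> R t = 0" "t \<notin> I \<Longrightarrow> S t = 0"
  by (auto simp: P_def Q_def R_def S_def)

lemma P_nonneg: "0 \<le> P t" and R_nonneg: "0 \<le> R t"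
  by (auto simp: P_def R_def)

lemma AE_coefficients:
  "AE t in lebesgue. t \<in> I \<longrightarrow> p t > 0 \<and> P t = 1 / p t \<and> r t > 0 \<and> R t = r t \<and> Q t = q t \<and> S t = s t"
proof -
  have "AE t in lebesgue. t \<in> I \<longrightarrow> p t > 0" "AE t in lebesgue. t \<in> I \<longrightarrow> r t > 0"
    using p_pos r_pos by (auto simp: AE_restrict_space_iff)
  then show ?thesis by eventually_elim (auto simp: P_def R_def Q_def S_def)
qed

lemma AE_lebesgue_on_I: "(AE t in lebesgue_on I. X t) \<longleftrightarrow> (AE t in lebesgue. t \<in> I \<longrightarrow> X t)"
  by (simp add: AE_restrict_space_iff)

section \<open>Weighted null sets, integrals and inner products in terms of Lebesgue measure on the
  line\<close>

lemma AE_M: "(AE t in M. X t) \<longleftrightarrow> (AE t in lebesgue. t \<in> I \<longrightarrow> X t)"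
proof -
  have "(AE t in M. X t) \<longleftrightarrow> (AE t in lebesgue_on I. 0 < ennreal (r t) \<longrightarrow> X t)"
    unfolding weighted_def using r_meas by (intro AE_density) auto
  also have "\<dots> \<longleftrightarrow> (AE t in lebesgue_on I. X t)"
  proof
    assume "AE t in lebesgue_on I. 0 < ennreal (r t) \<longrightarrow> X t"
    with r_pos show "AE t in lebesgue_on I. X t" by eventually_elim (simp add: ennreal_less_zero_iff)
  next
    assume "AE t in lebesgue_on I. X t"
    then show "AE t in lebesgue_on I. 0 < ennreal (r t) \<longrightarrow> X t" by eventually_elim simp
  qed
  also have "\<dots> \<longleftrightarrow> (AE t in lebesgue. t \<in> I \<longrightarrow> X t)" by (rule AE_lebesgue_on_I)
  finally show ?thesis .
qed

lemma measurable_M: "borel_measurable M = borel_measurable (lebesgue_on I)"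
  by (rule measurable_cong_sets) (auto simp: weighted_def)

lemma measurable_M_iff:
  "f \<in> borel_measurable M \<longleftrightarrow> (\<lambda>t. indicat_real I t *\<^sub>R f t) \<in> borel_measurable lebesgue"
  for f :: "real \<Rightarrow> 'b::euclidean_space"
  unfolding measurable_M by (subst borel_measurable_restrict_space_iff) auto

lemma lebesgue_imp_M: "f \<in> borel_measurable lebesgue \<Longrightarrow> f \<in> borel_measurable M"
  unfolding measurable_M by (rule measurable_restrict_space1)

lemma R_scaleR_measurable:
  fixes f :: "real \<Rightarrow> 'b::euclidean_space"
  assumes "f \<in> borel_measurable M"
  shows "(\<lambda>t. R t *\<^sub>R f t) \<in> borel_measurable lebesgue"
proof -
  have "(\<lambda>t. R t *\<^sub>R f t) = (\<lambda>t. R t *\<^sub>R (indicat_real I t *\<^sub>R f t))"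
    using PQRS_outside(3) by (auto simp: fun_eq_iff indicator_def)
  also have "\<dots> \<in> borel_measurable lebesgue"
    by (rule borel_measurable_scaleR[OF borel_measurable_integrable[OF R_int] assms[unfolded measurable_M_iff]])
  finally show ?thesis .
qed

lemma AE_R:
  fixes f :: "real \<Rightarrow> 'b::real_vector"
  shows "AE t in lebesgue. indicat_real I t *\<^sub>R r t *\<^sub>R f t = R t *\<^sub>R f t"
  using AE_coefficients by eventually_elim (auto simp: indicator_def PQRS_outside)

lemma M_scaleR_measurable:
  fixes f :: "real \<Rightarrow> 'b::euclidean_space"
  assumes "f \<in> borel_measurable M"
  shows "(\<lambda>t. indicat_real I t *\<^sub>R r t *\<^sub>R f t) \<in> borel_measurable lebesgue"
proof -
  have "(\<lambda>t. r t *\<^sub>R f t) \<in> borel_measurable (lebesgue_on I)"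
    using assms r_meas unfolding measurable_M by measurable
  then show ?thesis by (subst (asm) borel_measurable_restrict_space_iff) auto
qed

lemma integrable_M_iff:
  fixes f :: "real \<Rightarrow> 'b::euclidean_space"
  assumes "f \<in> borel_measurable M"
  shows "integrable M f \<longleftrightarrow> integrable lebesgue (\<lambda>t. R t *\<^sub>R f t)"
proof -
  have "integrable M f \<longleftrightarrow> integrable (lebesgue_on I) (\<lambda>t. r t *\<^sub>R f t)"
    unfolding weighted_def using assms r_meas r_pos unfolding measurable_M
    by (intro integrable_density) (auto elim!: eventually_mono)
  also have "\<dots> \<longleftrightarrow> integrable lebesgue (\<lambda>t. indicat_real I t *\<^sub>R r t *\<^sub>R f t)"
    by (simp add: integrable_restrict_space)
  also have "\<dots> \<longleftrightarrow> integrable lebesgue (\<lambda>t. R t *\<^sub>R f t)"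
    using AE_R M_scaleR_measurable[OF assms] R_scaleR_measurable[OF assms] by (intro integrable_cong_AE)
  finally show ?thesis .
qed

lemma integral_M:
  fixes f :: "real \<Rightarrow> 'b::euclidean_space"
  assumes "f \<in> borel_measurable M"
  shows "integral\<^sup>L M f = (LINT t|lebesgue. R t *\<^sub>R f t)"
proof -
  have "integral\<^sup>L M f = integral\<^sup>L (lebesgue_on I) (\<lambda>t. r t *\<^sub>R f t)"
    unfolding weighted_def using assms r_meas r_pos unfolding measurable_M
    by (intro integral_density) (auto elim!: eventually_mono)
  also have "\<dots> = (LINT t|lebesgue. indicat_real I t *\<^sub>R r t *\<^sub>R f t)"
    by (simp add: integral_restrict_space)
  also have "\<dots> = (LINT t|lebesgue. R t *\<^sub>R f t)"
    using AE_R M_scaleR_measurable[OF assms] R_scaleR_measurable[OF assms] by (intro integral_cong_AE)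
  finally show ?thesis .
qed

lemma L2_bounded:
  assumes "f \<in> borel_measurable lebesgue" "\<And>t. cmod (f t) \<le> B"
  shows "f \<in> L2 M"
proof -
  have m: "f \<in> borel_measurable M" by (rule lebesgue_imp_M[OF assms(1)])
  have "integrable lebesgue (\<lambda>t. R t *\<^sub>R (cmod (f t))\<^sup>2)"
  proof (rule Bochner_Integration.integrable_bound)
    show "integrable lebesgue (\<lambda>t. B\<^sup>2 * R t)" using R_int by simp
    show "(\<lambda>t. R t *\<^sub>R (cmod (f t))\<^sup>2) \<in> borel_measurable lebesgue"
      using m by (intro R_scaleR_measurable) auto
    have "\<bar>R t * (cmod (f t))\<^sup>2\<bar> \<le> \<bar>B\<^sup>2 * R t\<bar>" for t
      using R_nonneg[of t] power_mono[OF assms(2)[of t], of 2] mult_left_mono[of "(cmod (f t))\<^sup>2" "B\<^sup>2" "R t"]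
      by (simp add: abs_mult mult.commute)
    then show "AE t in lebesgue. norm (R t *\<^sub>R (cmod (f t))\<^sup>2) \<le> norm (B\<^sup>2 * R t)" by simp
  qed
  then show ?thesis using m unfolding L2_def by (subst (asm) integrable_M_iff[symmetric]) auto
qed

lemma L2_norm_M: "f \<in> L2 M \<Longrightarrow> (L2_norm M f)\<^sup>2 = (LINT t|lebesgue. R t * (cmod (f t))\<^sup>2)"
  unfolding L2_norm_def using L2_measurable[of f M] R_nonneg
  by (subst integral_M) (auto intro!: Bochner_Integration.integral_nonneg)

lemma L2_inner_M:
  assumes "f \<in> L2 M" "g \<in> L2 M"
  shows "L2_inner M f g = (LINT t|lebesgue. R t *\<^sub>R (cnj (f t) * g t))"
    and "integrable lebesgue (\<lambda>t. R t *\<^sub>R (cnj (f t) * g t))"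
proof -
  have i: "integrable M (\<lambda>t. cnj (f t) * g t)" by (rule L2_inner_integrable[OF assms])
  then have m: "(\<lambda>t. cnj (f t) * g t) \<in> borel_measurable M" by auto
  show "L2_inner M f g = (LINT t|lebesgue. R t *\<^sub>R (cnj (f t) * g t))"
    unfolding L2_inner_def by (rule integral_M[OF m])
  show "integrable lebesgue (\<lambda>t. R t *\<^sub>R (cnj (f t) * g t))"
    using i by (subst (asm) integrable_M_iff[OF m])
qed

lemma L2_const: "(\<lambda>_. c) \<in> L2 M"
  by (rule L2_bounded[of _ "cmod c"]) auto

lemma L2_R_integrable: "h \<in> L2 M \<Longrightarrow> integrable lebesgue (\<lambda>t. R t *\<^sub>R h t)"
  using L2_inner_M(2)[OF L2_const[of 1], of h] by simp

lemma integrable_coeff_mult: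
  assumes "continuous_on UNIV f" "\<And>t. cmod (f t) \<le> B"
  shows "integrable lebesgue (\<lambda>t. P t *\<^sub>R f t)" "integrable lebesgue (\<lambda>t. Q t *\<^sub>R f t)"
    "integrable lebesgue (\<lambda>t. R t *\<^sub>R f t)" "integrable lebesgue (\<lambda>t. S t *\<^sub>R f t)"
  using integrable_bounded_mult[OF P_int assms] integrable_bounded_mult[OF Q_int assms]
    integrable_bounded_mult[OF R_int assms] integrable_bounded_mult[OF S_int assms] .

lemma continuous_compact_support_bounded:
  fixes g :: "real \<Rightarrow> complex"
  assumes "continuous_on UNIV g" "\<And>t. t \<notin> {x..y} \<Longrightarrow> g t = 0"
  shows "\<exists>B. \<forall>t. cmod (g t) \<le> B"
proof -
  have "compact (g ` {x..y})"
    using assms(1) by (intro compact_continuous_image continuous_on_subset[OF assms(1)]) auto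
  then obtain B where B: "\<And>t. t \<in> {x..y} \<Longrightarrow> cmod (g t) \<le> B"
    by (meson compact_imp_bounded bounded_iff imageI)
  have "cmod (g t) \<le> max 0 B" for t
    using B[of t] assms(2)[of t] by (cases "t \<in> {x..y}") auto
  then show ?thesis by blast
qed

text \<open>
  The value \<open>h = \<tau> f\<close> for a representative \<open>g\<close> of \<open>f\<close> with quasi-derivative \<open>w\<close>, both supported
  in \<open>[x, y]\<close>, as a first-order system of integral equations on the whole line.
\<close>

definition core :: "(real \<Rightarrow> complex) \<Rightarrow> (real \<Rightarrow> complex) \<Rightarrow> (real \<Rightarrow> complex) \<Rightarrow> (real \<Rightarrow> complex) \<Rightarrow> real \<Rightarrow> real \<Rightarrow> bool" where
  "core f h g w x y \<longleftrightarrow> a < x \<and> x \<le> y \<and> y < b \<and> f \<in> L2 M \<and> h \<in> L2 M \<and>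
     (AE t in lebesgue. t \<in> I \<longrightarrow> f t = g t) \<and> continuous_on UNIV g \<and> continuous_on UNIV w \<and>
     (\<forall>t. t \<notin> {x..y} \<longrightarrow> g t = 0 \<and> w t = 0) \<and>
     (\<forall>t. g t = prim (\<lambda>u. P u *\<^sub>R w u - S u *\<^sub>R g u) t) \<and>
     (\<forall>t. w t = prim (\<lambda>u. S u *\<^sub>R w u + Q u *\<^sub>R g u - R u *\<^sub>R h u) t)"

lemma coreD:
  assumes "core f h g w x y"
  shows "a < x" "x \<le> y" "y < b" "f \<in> L2 M" "h \<in> L2 M" "AE t in lebesgue. t \<in> I \<longrightarrow> f t = g t"
    "continuous_on UNIV g" "continuous_on UNIV w" "\<And>t. t \<notin> {x..y} \<Longrightarrow> g t = 0" "\<And>t. t \<notin> {x..y} \<Longrightarrow> w t = 0"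
    "\<And>t. g t = prim (\<lambda>u. P u *\<^sub>R w u - S u *\<^sub>R g u) t"
    "\<And>t. w t = prim (\<lambda>u. S u *\<^sub>R w u + Q u *\<^sub>R g u - R u *\<^sub>R h u) t"
  using assms unfolding core_def by blast+

lemma core_bounded:
  assumes "core f h g w x y"
  obtains B where "\<And>t. cmod (g t) \<le> B" "\<And>t. cmod (w t) \<le> B"
proof -
  note c = coreD[OF assms]
  obtain B1 where B1: "\<And>t. cmod (g t) \<le> B1" using continuous_compact_support_bounded[OF c(7), of x y] c(9) by blast
  obtain B2 where B2: "\<And>t. cmod (w t) \<le> B2" using continuous_compact_support_bounded[OF c(8), of x y] c(10) by blast
  show thesis by (rule that[of "max B1 B2"]) (use B1 B2 in \<open>auto simp: le_max_iff_disj\<close>)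
qed

lemma core_integrable:
  assumes "core f h g w x y"
  shows "integrable lebesgue (\<lambda>u. P u *\<^sub>R w u - S u *\<^sub>R g u)"
    "integrable lebesgue (\<lambda>u. S u *\<^sub>R w u + Q u *\<^sub>R g u - R u *\<^sub>R h u)"
proof -
  note c = coreD[OF assms]
  obtain B where B: "\<And>t. cmod (g t) \<le> B" "\<And>t. cmod (w t) \<le> B" by (rule core_bounded[OF assms]) (rule that)
  show "integrable lebesgue (\<lambda>u. P u *\<^sub>R w u - S u *\<^sub>R g u)"
    by (intro Bochner_Integration.integrable_diff integrable_coeff_mult[OF c(7) B(1)] integrable_coeff_mult[OF c(8) B(2)])
  show "integrable lebesgue (\<lambda>u. S u *\<^sub>R w u + Q u *\<^sub>R g u - R u *\<^sub>R h u)"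
    by (intro Bochner_Integration.integrable_diff Bochner_Integration.integrable_add L2_R_integrable c(5)
        integrable_coeff_mult[OF c(7) B(1)] integrable_coeff_mult[OF c(8) B(2)])
qed

section \<open>The compactly supported part of the maximal operator\<close>

definition T0 :: "(real \<Rightarrow> complex) rel" where
  "T0 = {(f, h) \<in> T_max p q r s a b.
        \<exists>K. compact K \<and> K \<subseteq> I \<and> (AE x in M. x \<notin> K \<longrightarrow> f x = 0)}"

lemma T_min_eq: "T_min p q r s a b = op_closure M T0"
  by (simp add: T_min_def T0_def)

lemma AC_loc_continuous: "g \<in> AC_loc a b \<Longrightarrow> continuous_on I g"
proof (rule continuous_at_imp_continuous_on, rule ballI)
  fix t assume g: "g \<in> AC_loc a b" and t: "t \<in> I"
  have "continuous_on {(a + t)/2..(t + b)/2} g"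
    using g t unfolding AC_loc_def by (intro absolutely_continuous_on_imp_continuous) auto
  then show "isCont g t" by (rule continuous_on_interior) (use t in auto)
qed

lemma has_vector_derivative_0_of_eq_0:
  assumes "open U" "t \<in> U" "\<And>z. z \<in> U \<Longrightarrow> g z = (0::complex)"
  shows "(g has_vector_derivative 0) (at t)"
  by (rule has_vector_derivative_transform_within_open[OF has_vector_derivative_const[of 0] assms(1,2)]) (simp add: assms(3))

text \<open>The function and its quasi-derivative vanish off the support by continuity, so cutting
  both to a slightly larger interval keeps them absolutely continuous and turns the almost
  everywhere equations into integral equations on the line.\<close>

lemma T0_imp_core:
  assumes fh: "(f, h) \<in> T0"
  obtains g w x y where "core f h g w x y"
proof -
  obtain K where L2: "f \<in> L2 M" "h \<in> L2 M" and K: "compact K" "K \<subseteq> I" and fK: "AE t in lebesgue. t \<in> I \<longrightarrow> t \<notin> K \<longrightarrow> f t = 0"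
    using fh by (auto simp: T0_def T_max_def AE_M)
  obtain g0 where g0: "g0 \<in> D_tau p s a b" and fg: "AE t in lebesgue. t \<in> I \<longrightarrow> f t = g0 t"
    and h: "AE t in lebesgue. t \<in> I \<longrightarrow> h t = tau p q r s a b g0 t"
    using fh by (auto simp: T0_def T_max_def AE_M)
  define w0 where "w0 = quasi_deriv p s a b g0"
  have w0: "is_quasi_deriv p s a b g0 w0"
    using g0 unfolding w0_def quasi_deriv_def D_tau_def
    by (auto intro: someI_ex[where P = "is_quasi_deriv p s a b g0"])
  have AC: "g0 \<in> AC_loc a b" "w0 \<in> AC_loc a b"
    using g0 w0 by (auto simp: D_tau_def is_quasi_deriv_def)
  have w0_eq: "AE t in lebesgue. t \<in> I \<longrightarrow> w0 t = p t *\<^sub>R (vector_derivative g0 (at t) + s t *\<^sub>R g0 t)"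
    using w0 by (simp add: is_quasi_deriv_def AE_lebesgue_on_I)
  obtain x0 y0 where xy0: "a < x0" "x0 \<le> y0" "y0 < b" "K \<subseteq> {x0..y0}"
  proof (cases "K = {}")
    case True
    then show thesis using that[of "(a+b)/2" "(a+b)/2"] ab by auto
  next
    case False
    obtain x0 y0 where "x0 \<in> K" "\<forall>t\<in>K. x0 \<le> t" "y0 \<in> K" "\<forall>t\<in>K. t \<le> y0"
      using compact_attains_inf[OF K(1) False] compact_attains_sup[OF K(1) False] by blast
    then show thesis using K(2) by (intro that[of x0 y0]) auto
  qed
  \<comment> \<open>A margin around the hull \<open>[x0, y0]\<close> of the support puts
    \<open>x\<close> and \<open>y\<close> into the open set \<open>U\<close>, where
    \<open>g0\<close> and then \<open>w0\<close> are 0; so cutting at these points creates no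
    jump.\<close>
  define x y where "x = (a + x0) / 2" and "y = (y0 + b) / 2"
  have xy: "a < x" "x < x0" "y0 < y" "y < b" "x \<le> y" using xy0 by (auto simp: x_def y_def)
  define U where "U = I - {x0..y0}"
  have U: "open U" unfolding U_def by (intro open_Diff) auto
  have UI: "U \<subseteq> I" "U \<inter> K = {}" using xy0 by (auto simp: U_def)
  have g0U: "g0 t = 0" if "t \<in> U" for t
  proof (rule continuous_AE_eq[OF U _ _ _ that])
    show "continuous_on U g0" using AC_loc_continuous[OF AC(1)] UI(1) by (rule continuous_on_subset)
    show "AE t in lebesgue. t \<in> U \<longrightarrow> g0 t = 0"
      using fg fK by eventually_elim (use UI in auto)
  qed simp
  have w0U: "w0 t = 0" if "t \<in> U" for t
  proof (rule continuous_AE_eq[OF U _ _ _ that])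
    show "continuous_on U w0" using AC_loc_continuous[OF AC(2)] UI(1) by (rule continuous_on_subset)
    show "AE t in lebesgue. t \<in> U \<longrightarrow> w0 t = 0"
      using w0_eq
    proof eventually_elim
      case (elim t)
      then show ?case
        using UI(1) g0U vector_derivative_at[OF has_vector_derivative_0_of_eq_0[OF U _ g0U], of t] by auto
    qed
  qed simp
  have ends: "x \<in> U" "y \<in> U" using xy xy0 by (auto simp: U_def)
  define g w where "g t = (if t \<in> {x..y} then g0 t else 0)" and "w t = (if t \<in> {x..y} then w0 t else 0)" for t
  have ACxy: "absolutely_continuous_on {x..y} g0" "absolutely_continuous_on {x..y} w0"
  proof -
    have "x < y" using xy xy0 by simp
    then show "absolutely_continuous_on {x..y} g0" "absolutely_continuous_on {x..y} w0"
      using AC xy(1,4) unfolding AC_loc_def by blast+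
  qed
  have rep: "\<exists>\<phi>. integrable lebesgue \<phi> \<and> (\<forall>t. t \<notin> {x<..<y} \<longrightarrow> \<phi> t = 0) \<and>
      (\<forall>t. (if t \<in> {x..y} then u t else 0) = prim \<phi> t) \<and> (AE t in lebesgue. t \<in> {x<..<y} \<longrightarrow> vector_derivative u (at t) = \<phi> t)"
    if ac: "absolutely_continuous_on {x..y} u" and u0: "\<And>t. t \<in> U \<Longrightarrow> u t = 0" for u
  proof -
    obtain \<phi> where \<phi>: "integrable lebesgue \<phi>" "\<And>t. t \<le> x \<Longrightarrow> \<phi> t = 0" "\<And>t. y \<le> t \<Longrightarrow> \<phi> t = 0"
      "\<And>t. x \<le> t \<Longrightarrow> t \<le> y \<Longrightarrow> u t = u x + prim \<phi> t"
      "AE t in lebesgue. x < t \<and> t < y \<longrightarrow> (u has_vector_derivative \<phi> t) (at t)"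
      by (rule AC_imp_prim[OF ac xy(5)]) (rule that)
    have "(if t \<in> {x..y} then u t else 0) = prim \<phi> t" for t
    proof -
      consider "t < x" | "t \<in> {x..y}" | "y < t" by fastforce
      then show ?thesis
      proof cases
        case 1
        then have "prim \<phi> t = 0" using \<phi>(2) by (intro prim_eq_0) auto
        then show ?thesis using 1 by simp
      next
        case 2
        then show ?thesis using \<phi>(4)[of t] u0[OF ends(1)] by simp
      next
        case 3
        then have "prim \<phi> t = prim \<phi> y" using \<phi>(1,3) by (intro prim_eq_const) auto
        also have "\<dots> = 0" using \<phi>(4)[of y] xy(5) u0[OF ends(1)] u0[OF ends(2)] by simp
        finally show ?thesis using 3 by simp
      qed
    qed
    moreover have "AE t in lebesgue. t \<in> {x<..<y} \<longrightarrow> vector_derivative u (at t) = \<phi> t"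
      using \<phi>(5) by eventually_elim (auto intro: vector_derivative_at)
    ultimately show ?thesis using \<phi>(1,2,3) by (intro exI[of _ \<phi>]) (auto simp: not_less)
  qed
  obtain \<phi> where \<phi>: "integrable lebesgue \<phi>" "\<And>t. t \<notin> {x<..<y} \<Longrightarrow> \<phi> t = 0" "\<And>t. g t = prim \<phi> t"
    "AE t in lebesgue. t \<in> {x<..<y} \<longrightarrow> vector_derivative g0 (at t) = \<phi> t"
    using rep[OF ACxy(1) g0U] unfolding g_def[symmetric] by blast
  obtain \<psi> where \<psi>: "integrable lebesgue \<psi>" "\<And>t. t \<notin> {x<..<y} \<Longrightarrow> \<psi> t = 0" "\<And>t. w t = prim \<psi> t"
    "AE t in lebesgue. t \<in> {x<..<y} \<longrightarrow> vector_derivative w0 (at t) = \<psi> t"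
    using rep[OF ACxy(2) w0U] unfolding w_def[symmetric] by blast
  have cont: "continuous_on UNIV g" "continuous_on UNIV w"
    unfolding \<phi>(3)[abs_def] \<psi>(3)[abs_def] by (intro continuous_on_prim \<phi> \<psi>)+
  have out: "g t = 0" "w t = 0" if "t \<notin> {x..y}" for t using that by (auto simp: g_def w_def)
  obtain B1 B2 where B: "\<And>t. cmod (g t) \<le> B1" "\<And>t. cmod (w t) \<le> B2"
    using continuous_compact_support_bounded[OF cont(1), of x y] continuous_compact_support_bounded[OF cont(2), of x y] out by blast
  have int: "integrable lebesgue (\<lambda>u. P u *\<^sub>R w u - S u *\<^sub>R g u)" "integrable lebesgue (\<lambda>u. S u *\<^sub>R w u + Q u *\<^sub>R g u - R u *\<^sub>R h u)"
    by (intro Bochner_Integration.integrable_diff Bochner_Integration.integrable_add L2_R_integrable L2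
        integrable_coeff_mult[OF cont(1) B(1)] integrable_coeff_mult[OF cont(2) B(2)])+
  have xyI: "{x<..<y} \<subseteq> I" "{x..y} \<subseteq> I" using xy by auto
  have fin: "AE t in lebesgue. t \<notin> {x, y}" by (rule AE_lebesgue_not_in_finite) simp
  have ae1: "AE t in lebesgue. \<phi> t = P t *\<^sub>R w t - S t *\<^sub>R g t"
    using \<phi>(4) w0_eq AE_coefficients fin
  proof eventually_elim
    case (elim t)
    show ?case
    proof (cases "t \<in> {x<..<y}")
      case True
      then have "t \<in> I" "g t = g0 t" "w t = w0 t" using xyI by (auto simp: g_def w_def)
      then show ?thesis using elim True by (simp add: scaleR_add_right)
    next
      case False
      then have "t \<notin> {x..y}" using elim by auto
      then show ?thesis using \<phi>(2)[OF False] out by simp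
    qed
  qed
  have ae2: "AE t in lebesgue. \<psi> t = S t *\<^sub>R w t + Q t *\<^sub>R g t - R t *\<^sub>R h t"
    using \<psi>(4) h AE_coefficients fin
  proof eventually_elim
    case (elim t)
    show ?case
    proof (cases "t \<in> {x<..<y}")
      case True
      then have t: "t \<in> I" "g t = g0 t" "w t = w0 t" using xyI by (auto simp: g_def w_def)
      then have "r t > 0" "R t = r t" "h t = (1 / r t) *\<^sub>R (- \<psi> t + s t *\<^sub>R w0 t + q t *\<^sub>R g0 t)"
        using elim True by (auto simp: tau_def w0_def)
      then have "R t *\<^sub>R h t = - \<psi> t + s t *\<^sub>R w0 t + q t *\<^sub>R g0 t" by simp
      moreover have "S t = s t" "Q t = q t" using elim t by auto
      ultimately show ?thesis using t by simp
    next
      case False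
      then have nxy: "t \<notin> {x..y}" using elim by auto
      \<comment> \<open>Off \<open>[x, y]\<close> the value \<open>h = tau g0\<close> vanishes too,
        as \<open>g0\<close> and \<open>w0\<close> are 0 near such points of \<open>I\<close>;
        otherwise \<open>w\<close> would pick up mass beyond \<open>y\<close>.\<close>
      have "R t *\<^sub>R h t = 0"
      proof (cases "t \<in> I")
        case True
        then have "t \<in> U" using nxy xy by (auto simp: U_def)
        then have "vector_derivative w0 (at t) = 0" "w0 t = 0" "g0 t = 0"
          using vector_derivative_at[OF has_vector_derivative_0_of_eq_0[OF U _ w0U], of t] w0U g0U by auto
        then have "h t = 0" using elim True by (auto simp: tau_def w0_def)
        then show ?thesis by simp
      qed (simp add: PQRS_outside)
      then show ?thesis using \<psi>(2)[OF False] out[OF nxy] by simp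
    qed
  qed
  have "core f h g w x y"
    unfolding core_def
  proof (intro conjI allI impI)
    show "AE t in lebesgue. t \<in> I \<longrightarrow> f t = g t"
      using fg
    proof eventually_elim
      case (elim t)
      then show ?case using g0U[of t] xy by (auto simp: g_def U_def)
    qed
    show "g t = prim (\<lambda>u. P u *\<^sub>R w u - S u *\<^sub>R g u) t" for t
      unfolding \<phi>(3)[of t] by (rule prim_cong_AE[OF ae1 \<phi>(1) int(1)])
    show "w t = prim (\<lambda>u. S u *\<^sub>R w u + Q u *\<^sub>R g u - R u *\<^sub>R h u) t" for t
      unfolding \<psi>(3)[of t] by (rule prim_cong_AE[OF ae2 \<psi>(1) int(2)])
  qed (use xy L2 cont out in auto)
  then show thesis by (rule that)
qed

text \<open>Differentiating the integral equations almost everywhere recovers the quasi-derivative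
  and the value of the expression. This is how elements of \<open>T0\<close> are constructed
  later.\<close>

lemma core_imp_T0:
  assumes core: "core f h g w x y"
  shows "(f, h) \<in> T0"
proof -
  note c = coreD[OF core]
  note int = core_integrable[OF core]
  have AC: "g \<in> AC_loc a b" "w \<in> AC_loc a b"
    unfolding AC_loc_def by (subst c(11)[abs_def], simp add: absolutely_continuous_on_prim int)
      (subst c(12)[abs_def], simp add: absolutely_continuous_on_prim int)
  have dg: "AE t in lebesgue. (g has_vector_derivative P t *\<^sub>R w t - S t *\<^sub>R g t) (at t)"
    using prim_has_vector_derivative[OF int(1)] unfolding c(11)[abs_def, symmetric] .
  have dw: "AE t in lebesgue. (w has_vector_derivative S t *\<^sub>R w t + Q t *\<^sub>R g t - R t *\<^sub>R h t) (at t)"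
    using prim_has_vector_derivative[OF int(2)] unfolding c(12)[abs_def, symmetric] .
  have qd: "is_quasi_deriv p s a b g w"
    unfolding is_quasi_deriv_def AE_lebesgue_on_I
  proof (intro conjI AC)
    show "AE t in lebesgue. t \<in> I \<longrightarrow> w t = p t *\<^sub>R (vector_derivative g (at t) + s t *\<^sub>R g t)"
      using dg AE_coefficients
    proof eventually_elim
      case (elim t)
      then show ?case using vector_derivative_at[OF elim(1)] by auto
    qed
  qed
  then have gD: "g \<in> D_tau p s a b" using AC by (auto simp: D_tau_def)
  \<comment> \<open>The choice operator in \<open>quasi_deriv\<close> may return another
    representative than \<open>w\<close>; continuity forces the two to agree on \<open>I\<close>,
    hence to have the same derivative there.\<close>
  define w2 where "w2 = quasi_deriv p s a b g"
  have w2: "is_quasi_deriv p s a b g w2"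
    unfolding w2_def quasi_deriv_def by (rule someI[where P = "is_quasi_deriv p s a b g", OF qd])
  have w2_eq: "w2 t = w t" if "t \<in> I" for t
  proof (rule continuous_AE_eq[OF _ _ _ _ that])
    show "continuous_on I w2" using w2 by (intro AC_loc_continuous) (simp add: is_quasi_deriv_def)
    show "continuous_on I w" using AC by (intro AC_loc_continuous)
    have "AE t in lebesgue. t \<in> I \<longrightarrow> w2 t = p t *\<^sub>R (vector_derivative g (at t) + s t *\<^sub>R g t)"
      "AE t in lebesgue. t \<in> I \<longrightarrow> w t = p t *\<^sub>R (vector_derivative g (at t) + s t *\<^sub>R g t)"
      using w2 qd by (simp_all add: is_quasi_deriv_def AE_lebesgue_on_I)
    then show "AE t in lebesgue. t \<in> I \<longrightarrow> w2 t = w t" by eventually_elim auto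
  qed simp
  have tau: "AE t in lebesgue. t \<in> I \<longrightarrow> h t = tau p q r s a b g t"
    using dw AE_coefficients
  proof eventually_elim
    case (elim t)
    show ?case
    proof
      assume t: "t \<in> I"
      have "(w2 has_vector_derivative S t *\<^sub>R w t + Q t *\<^sub>R g t - R t *\<^sub>R h t) (at t)"
        by (rule has_vector_derivative_transform_within_open[OF elim(1) _ t]) (use w2_eq in auto)
      then have "vector_derivative w2 (at t) = s t *\<^sub>R w t + q t *\<^sub>R g t - r t *\<^sub>R h t"
        using elim t by (simp add: vector_derivative_at)
      then show "h t = tau p q r s a b g t"
        using elim t w2_eq[OF t] by (simp add: tau_def w2_def[symmetric])
    qed
  qed
  have "(f, h) \<in> T_max p q r s a b"
    unfolding T_max_def AE_M using c(4-6) gD tau by blast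
  moreover have "\<exists>K. compact K \<and> K \<subseteq> I \<and> (AE t in M. t \<notin> K \<longrightarrow> f t = 0)"
  proof (intro exI[of _ "{x..y}"] conjI)
    show "{x..y} \<subseteq> I" using c(1-3) by auto
    show "AE t in M. t \<notin> {x..y} \<longrightarrow> f t = 0"
      unfolding AE_M using c(6) by eventually_elim (use c(9) in auto)
  qed simp
  ultimately show ?thesis by (simp add: T0_def)
qed

end

section \<open>The quadratic form\<close>

lemma prim_cnj: "prim (\<lambda>u. cnj (\<phi> u)) t = cnj (prim \<phi> t)"
proof -
  have "(\<lambda>u. indicat_real {..t} u *\<^sub>R cnj (\<phi> u)) = (\<lambda>u. cnj (indicat_real {..t} u *\<^sub>R \<phi> u))"
    by (simp add: fun_eq_iff)
  then show ?thesis unfolding prim_def set_lebesgue_integral_def by (simp only: Bochner_Integration.integral_cnj)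
qed

lemma lebesgue_integral_norm_bound_integral:
  fixes f :: "'a \<Rightarrow> 'b::{banach, second_countable_topology}"
  assumes "integrable N f" "integrable N g" "\<And>x. norm (f x) \<le> g x"
  shows "norm (integral\<^sup>L N f) \<le> integral\<^sup>L N g"
  by (rule order_trans[OF integral_norm_bound integral_mono]) (use assms in auto)

lemma prim_add_mult:
  fixes c :: complex
  assumes "integrable lebesgue \<phi>" "integrable lebesgue \<psi>"
  shows "prim (\<lambda>u. \<phi> u + c * \<psi> u) t = prim \<phi> t + c * prim \<psi> t"
  using prim_add[OF assms(1) integrable_mult_right[OF assms(2), of c]] by (simp only: prim_mult_left)

context SL_regular
begin

text \<open>Integration by parts for \<open>cnj (g t) * w' t\<close>; the boundary terms vanish by
  compact support. The result involves only the functions and their quasi-derivatives and shows the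
  Hermitian symmetry.\<close>

lemma core_form:
  assumes 1: "core f h g w x y" and 2: "core f' h' g' w' x' y'"
  shows "integrable lebesgue (\<lambda>t. P t *\<^sub>R (cnj (w t) * w' t) + Q t *\<^sub>R (cnj (g t) * g' t))"
    and "L2_inner M f h' = (LINT t|lebesgue. P t *\<^sub>R (cnj (w t) * w' t) + Q t *\<^sub>R (cnj (g t) * g' t))"
proof -
  note c = coreD[OF 1] and c' = coreD[OF 2]
  note int = core_integrable[OF 1] core_integrable[OF 2]
  let ?\<phi> = "\<lambda>u. cnj (P u *\<^sub>R w u - S u *\<^sub>R g u)" and ?\<psi> = "\<lambda>u. S u *\<^sub>R w' u + Q u *\<^sub>R g' u - R u *\<^sub>R h' u"
  have u: "cnj (g t) = 0 + prim ?\<phi> t" for t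
    unfolding prim_cnj using c(11)[of t] by simp
  have v: "w' t = 0 + prim ?\<psi> t" for t using c'(12)[of t] by simp
  have out: "?\<phi> t = 0" "?\<psi> t = 0" if "t \<le> a" for t using that by (auto simp: PQRS_outside)
  have int\<phi>: "integrable lebesgue ?\<phi>" using int(1) by (simp only: complex_integrable_cnj)
  note pp = prim_product[where a = a, OF int\<phi> int(4) out u v]
  let ?X = "\<lambda>t. P t *\<^sub>R (cnj (w t) * w' t) + Q t *\<^sub>R (cnj (g t) * g' t)" and ?Y = "\<lambda>t. R t *\<^sub>R (cnj (g t) * h' t)"
  \<comment> \<open>The two terms with \<open>S\<close> cancel, which is why \<open>s\<close> enters
    the form only through the quasi-derivatives.\<close>
  have XY: "?\<phi> t * w' t + cnj (g t) * ?\<psi> t = ?X t - ?Y t" for t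
    by (simp add: scaleR_conv_of_real algebra_simps)
  have intXY: "integrable lebesgue (\<lambda>t. ?X t - ?Y t)" using pp(1) unfolding XY .
  obtain B where B: "\<And>t. cmod (g t) \<le> B" "\<And>t. cmod (w t) \<le> B" by (rule core_bounded[OF 1]) (rule that)
  obtain B' where B': "\<And>t. cmod (g' t) \<le> B'" "\<And>t. cmod (w' t) \<le> B'" by (rule core_bounded[OF 2]) (rule that)
  have B0: "0 \<le> B" "0 \<le> B'" using order_trans[OF norm_ge_zero B(1)] order_trans[OF norm_ge_zero B'(1)] by auto
  show intX: "integrable lebesgue ?X"
  proof (intro Bochner_Integration.integrable_add integrable_coeff_mult)
    show "continuous_on UNIV (\<lambda>t. cnj (w t) * w' t)" "continuous_on UNIV (\<lambda>t. cnj (g t) * g' t)"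
      by (intro continuous_intros c c')+
    show "cmod (cnj (w t) * w' t) \<le> B * B'" "cmod (cnj (g t) * g' t) \<le> B * B'" for t
      using B B' B0 by (auto simp: norm_mult intro!: mult_mono)
  qed
  have intY: "integrable lebesgue ?Y"
    using Bochner_Integration.integrable_diff[OF intX intXY] by simp
  have "(LINT t|lebesgue. ?X t - ?Y t) = prim (\<lambda>t. ?X t - ?Y t) b"
    by (rule prim_eq_integral[symmetric]) (simp add: PQRS_outside)
  also have "\<dots> = cnj (g b) * w' b" using pp(2)[of b] unfolding XY by simp
  also have "\<dots> = 0" using c(3,9) by simp
  finally have "(LINT t|lebesgue. ?X t) = (LINT t|lebesgue. ?Y t)" using intX intY by simp
  moreover have "L2_inner M f h' = (LINT t|lebesgue. ?Y t)"
    unfolding L2_inner_M(1)[OF c(4) c'(5)]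
  proof (rule integral_cong_AE)
    show "AE t in lebesgue. R t *\<^sub>R (cnj (f t) * h' t) = R t *\<^sub>R (cnj (g t) * h' t)"
      using c(6)
    proof eventually_elim
      case (elim t)
      then show ?case by (cases "t \<in> I") (simp_all add: PQRS_outside(3))
    qed
  qed (use L2_inner_M(2)[OF c(4) c'(5)] intY in auto)
  ultimately show "L2_inner M f h' = (LINT t|lebesgue. ?X t)" by simp
qed

lemma T0_symmetric:
  assumes "(f, h) \<in> T0" "(f', h') \<in> T0"
  shows "L2_inner M f h' = L2_inner M h f'"
proof -
  obtain g w x y where 1: "core f h g w x y" by (rule T0_imp_core[OF assms(1)])
  obtain g' w' x' y' where 2: "core f' h' g' w' x' y'" by (rule T0_imp_core[OF assms(2)])
  have "L2_inner M h f' = cnj (L2_inner M f' h)" by (rule L2_inner_commute)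
  also have "\<dots> = cnj (LINT t|lebesgue. P t *\<^sub>R (cnj (w' t) * w t) + Q t *\<^sub>R (cnj (g' t) * g t))"
    by (simp only: core_form(2)[OF 2 1])
  also have "\<dots> = (LINT t|lebesgue. cnj (P t *\<^sub>R (cnj (w' t) * w t) + Q t *\<^sub>R (cnj (g' t) * g t)))"
    by (rule Bochner_Integration.integral_cnj[symmetric])
  also have "\<dots> = L2_inner M f h'"
    unfolding core_form(2)[OF 1 2] by (simp add: mult.commute)
  finally show ?thesis by simp
qed

lemma T0_L2: "(f, h) \<in> T0 \<Longrightarrow> f \<in> L2 M \<and> h \<in> L2 M"
  by (auto simp: T0_def T_max_def)

lemma T0_add_mult:
  assumes "(f, h) \<in> T0" "(f', h') \<in> T0"
  shows "(\<lambda>t. f t + c * f' t, \<lambda>t. h t + c * h' t) \<in> T0"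
proof -
  obtain g w x y where 1: "core f h g w x y" by (rule T0_imp_core[OF assms(1)])
  obtain g' w' x' y' where 2: "core f' h' g' w' x' y'" by (rule T0_imp_core[OF assms(2)])
  note c1 = coreD[OF 1] and c2 = coreD[OF 2]
  note int = core_integrable[OF 1] core_integrable[OF 2]
  have "core (\<lambda>t. f t + c * f' t) (\<lambda>t. h t + c * h' t) (\<lambda>t. g t + c * g' t) (\<lambda>t. w t + c * w' t) (min x x') (max y y')"
    unfolding core_def
  proof (intro conjI allI impI)
    show "a < min x x'" "min x x' \<le> max y y'" "max y y' < b" using c1(1-3) c2(1-3) by auto
    show "(\<lambda>t. f t + c * f' t) \<in> L2 M" "(\<lambda>t. h t + c * h' t) \<in> L2 M" using c1(4,5) c2(4,5) by (auto intro: L2_add_mult)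
    show "AE t in lebesgue. t \<in> I \<longrightarrow> f t + c * f' t = g t + c * g' t"
      using c1(6) c2(6) by eventually_elim auto
    show "continuous_on UNIV (\<lambda>t. g t + c * g' t)" "continuous_on UNIV (\<lambda>t. w t + c * w' t)"
      by (intro continuous_intros c1 c2)+
    show "g t + c * g' t = 0" "w t + c * w' t = 0" if "t \<notin> {min x x'..max y y'}" for t
    proof -
      have "t \<notin> {x..y}" "t \<notin> {x'..y'}" using that by auto
      then show "g t + c * g' t = 0" "w t + c * w' t = 0" using c1(9,10) c2(9,10) by auto
    qed
    show "g t + c * g' t = prim (\<lambda>u. P u *\<^sub>R (w u + c * w' u) - S u *\<^sub>R (g u + c * g' u)) t" for t
    proof -
      have eq: "(\<lambda>u. P u *\<^sub>R (w u + c * w' u) - S u *\<^sub>R (g u + c * g' u)) =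
          (\<lambda>u. (P u *\<^sub>R w u - S u *\<^sub>R g u) + c * (P u *\<^sub>R w' u - S u *\<^sub>R g' u))"
        by (simp add: fun_eq_iff scaleR_conv_of_real algebra_simps)
      have "g t + c * g' t = prim (\<lambda>u. (P u *\<^sub>R w u - S u *\<^sub>R g u) + c * (P u *\<^sub>R w' u - S u *\<^sub>R g' u)) t"
        by (simp only: prim_add_mult[OF int(1,3)] c1(11)[of t, symmetric] c2(11)[of t, symmetric])
      then show ?thesis unfolding eq .
    qed
    show "w t + c * w' t = prim (\<lambda>u. S u *\<^sub>R (w u + c * w' u) + Q u *\<^sub>R (g u + c * g' u) - R u *\<^sub>R (h u + c * h' u)) t" for t
    proof -
      have eq: "(\<lambda>u. S u *\<^sub>R (w u + c * w' u) + Q u *\<^sub>R (g u + c * g' u) - R u *\<^sub>R (h u + c * h' u)) =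
          (\<lambda>u. (S u *\<^sub>R w u + Q u *\<^sub>R g u - R u *\<^sub>R h u) + c * (S u *\<^sub>R w' u + Q u *\<^sub>R g' u - R u *\<^sub>R h' u))"
        by (simp add: fun_eq_iff scaleR_conv_of_real algebra_simps)
      have "w t + c * w' t = prim (\<lambda>u. (S u *\<^sub>R w u + Q u *\<^sub>R g u - R u *\<^sub>R h u) + c * (S u *\<^sub>R w' u + Q u *\<^sub>R g' u - R u *\<^sub>R h' u)) t"
        by (simp only: prim_add_mult[OF int(2,4)] c1(12)[of t, symmetric] c2(12)[of t, symmetric])
      then show ?thesis unfolding eq .
    qed
  qed
  then show ?thesis by (rule core_imp_T0)
qed

text \<open>The principal part of the form: with \<open>P = 1 / p\<close> and
  \<open>w = p (g' + s g)\<close>, it is the integral of p |g' + s g|^2.\<close>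

definition energy :: "(real \<Rightarrow> complex) \<Rightarrow> real" where
  "energy w = (LINT t|lebesgue. P t * (cmod (w t))\<^sup>2)"

lemma core_integrable_squares:
  assumes "core f h g w x y"
  shows "integrable lebesgue (\<lambda>t. P t * (cmod (w t))\<^sup>2)" "integrable lebesgue (\<lambda>t. Q t * (cmod (g t))\<^sup>2)"
    "integrable lebesgue (\<lambda>t. P t * cmod (w t))" "integrable lebesgue (\<lambda>t. R t * (cmod (g t))\<^sup>2)"
proof -
  note c = coreD[OF assms]
  obtain B where B: "\<And>t. cmod (g t) \<le> B" "\<And>t. cmod (w t) \<le> B" by (rule core_bounded[OF assms]) (rule that)
  have cont: "continuous_on UNIV (\<lambda>t. (cmod (w t))\<^sup>2)" "continuous_on UNIV (\<lambda>t. (cmod (g t))\<^sup>2)" "continuous_on UNIV (\<lambda>t. cmod (w t))"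
    by (intro continuous_intros c)+
  have b: "norm ((cmod (w t))\<^sup>2) \<le> B\<^sup>2" "norm ((cmod (g t))\<^sup>2) \<le> B\<^sup>2" "norm (cmod (w t)) \<le> B" for t
    using B by (auto intro: power_mono)
  show "integrable lebesgue (\<lambda>t. P t * (cmod (w t))\<^sup>2)" "integrable lebesgue (\<lambda>t. Q t * (cmod (g t))\<^sup>2)"
    "integrable lebesgue (\<lambda>t. P t * cmod (w t))" "integrable lebesgue (\<lambda>t. R t * (cmod (g t))\<^sup>2)"
    using integrable_bounded_mult[OF P_int cont(1) b(1)] integrable_bounded_mult[OF Q_int cont(2) b(2)]
      integrable_bounded_mult[OF P_int cont(3) b(3)] integrable_bounded_mult[OF R_int cont(2) b(2)] by simp_all
qed

lemma energy_nonneg: "0 \<le> energy w"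
  unfolding energy_def using P_nonneg by (auto intro!: Bochner_Integration.integral_nonneg)

lemma core_form_Re:
  assumes "core f h g w x y"
  shows "Re (L2_inner M f h) = energy w + (LINT t|lebesgue. Q t * (cmod (g t))\<^sup>2)"
proof -
  have "P t *\<^sub>R (cnj (w t) * w t) + Q t *\<^sub>R (cnj (g t) * g t) = complex_of_real (P t * (cmod (w t))\<^sup>2 + Q t * (cmod (g t))\<^sup>2)" for t
    by (simp add: scaleR_conv_of_real mult.commute[of "cnj _"] complex_norm_square[symmetric] del: of_real_power)
  then have "L2_inner M f h = complex_of_real (LINT t|lebesgue. P t * (cmod (w t))\<^sup>2 + Q t * (cmod (g t))\<^sup>2)"
    unfolding core_form(2)[OF assms assms] by (simp only: integral_complex_of_real)
  then show ?thesis using core_integrable_squares[OF assms] by (simp add: energy_def)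
qed

lemma core_norm:
  assumes "core f h g w x y"
  shows "(L2_norm M f)\<^sup>2 = (LINT t|lebesgue. R t * (cmod (g t))\<^sup>2)"
proof -
  note c = coreD[OF assms]
  have "integrable lebesgue (\<lambda>t. R t * (cmod (f t))\<^sup>2)"
  proof -
    have m: "(\<lambda>t. (cmod (f t))\<^sup>2) \<in> borel_measurable M" using L2_measurable[OF c(4)] by simp
    show ?thesis using L2_integrable[OF c(4)] unfolding integrable_M_iff[OF m] by simp
  qed
  moreover have "AE t in lebesgue. R t * (cmod (f t))\<^sup>2 = R t * (cmod (g t))\<^sup>2"
    using c(6)
  proof eventually_elim
    case (elim t)
    then show ?case by (cases "t \<in> I") (simp_all add: PQRS_outside(3))
  qed
  ultimately show ?thesis unfolding L2_norm_M[OF c(4)] using core_integrable_squares(4)[OF assms]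
    by (intro integral_cong_AE) auto
qed

text \<open>Cauchy-Schwarz for the measure with density \<open>P\<close> on \<open>[u, t]\<close>,
  applied to \<open>cmod (w z)\<close> and the constant 1.\<close>

lemma weighted_Cauchy_Schwarz:
  assumes core: "core f h g w x y" and "u \<le> t"
  shows "(LINT z:{u..t}|lebesgue. P z * cmod (w z)) \<le> sqrt (prim P t - prim P u) * sqrt (energy w)"
proof -
  note i = core_integrable_squares[OF core]
  define \<beta> where "\<beta> = (LINT z:{u..t}|lebesgue. P z * cmod (w z))"
  define C where "C = (LINT z:{u..t}|lebesgue. P z)"
  have C: "C = prim P t - prim P u" unfolding C_def by (rule prim_increment[OF P_int assms(2), symmetric])
  have C0: "0 \<le> C" unfolding C using prim_increasing[OF P_int P_nonneg assms(2)] by simp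
  have iC: "integrable lebesgue (\<lambda>z. indicat_real {u..t} z * P z)" and ib: "integrable lebesgue (\<lambda>z. indicat_real {u..t} z * (P z * cmod (w z)))"
    using integrable_mult_indicator[OF _ P_int, of "{u..t}"] integrable_mult_indicator[OF _ i(3), of "{u..t}"] by simp_all
  have "(cmod (complex_of_real \<beta>))\<^sup>2 \<le> energy w * C"
  proof (rule quadratic_nonneg_imp_bound[OF C0])
    fix c :: complex
    \<comment> \<open>\<open>quadratic_nonneg_imp_bound\<close> asks for complex \<open>c\<close>;
      as \<open>\<beta>\<close> is real, only \<open>Re c\<close> matters, and its square is at most
      that of \<open>cmod c\<close>.\<close>
    let ?l = "Re c"
    have "0 \<le> (LINT z|lebesgue. P z * (cmod (w z) + ?l * indicat_real {u..t} z)\<^sup>2)"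
      using P_nonneg by (auto intro!: Bochner_Integration.integral_nonneg)
    also have "\<dots> = (LINT z|lebesgue. P z * (cmod (w z))\<^sup>2 + (2 * ?l * (indicat_real {u..t} z * (P z * cmod (w z))) + ?l\<^sup>2 * (indicat_real {u..t} z * P z)))"
      by (intro Bochner_Integration.integral_cong refl) (auto simp: indicator_def power2_eq_square algebra_simps)
    also have "\<dots> = energy w + (2 * ?l * \<beta> + ?l\<^sup>2 * C)"
      using i(1) iC ib by (simp add: energy_def \<beta>_def C_def set_lebesgue_integral_def)
    also have "\<dots> \<le> energy w + (2 * ?l * \<beta> + (cmod c)\<^sup>2 * C)"
      using C0 by (intro add_left_mono mult_right_mono) (simp_all add: cmod_power2)
    finally show "0 \<le> energy w + 2 * Re (c * complex_of_real \<beta>) + (cmod c)\<^sup>2 * C" by simp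
  qed
  then have "\<beta>\<^sup>2 \<le> energy w * C" by simp
  then have "\<beta> \<le> sqrt (energy w * C)" by (rule real_le_rsqrt)
  then show ?thesis unfolding \<beta>_def[symmetric] C[symmetric] by (simp add: real_sqrt_mult mult.commute)
qed

section \<open>Pointwise bounds by norm and energy\<close>

definition absS :: "real \<Rightarrow> real" where "absS t = \<bar>S t\<bar>"

lemma absS_int: "integrable lebesgue absS"
  unfolding absS_def[abs_def] using S_int by simp

text \<open>The derivative of \<open>g\<close> is \<open>P w - S g\<close> almost everywhere; the
  first term is estimated by Cauchy-Schwarz, the second by the bound on \<open>g\<close>. The
  modulus of continuity depends on \<open>g\<close> only through its energy and its bound, which is
  the source of equicontinuity.\<close>

lemma core_increment:
  assumes core: "core f h g w x y" and \<sigma>: "\<And>t. cmod (g t) \<le> \<sigma>"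
  shows "cmod (g t - g u) \<le> sqrt \<bar>prim P t - prim P u\<bar> * sqrt (energy w) + \<sigma> * \<bar>prim absS t - prim absS u\<bar>"
proof -
  have le: "cmod (g t - g u) \<le> sqrt \<bar>prim P t - prim P u\<bar> * sqrt (energy w) + \<sigma> * \<bar>prim absS t - prim absS u\<bar>" if ut: "u \<le> t" for u t
  proof -
    note c = coreD[OF core] and i = core_integrable_squares[OF core] and int = core_integrable[OF core]
    have eq: "g t - g u = (LINT z:{u..t}|lebesgue. P z *\<^sub>R w z - S z *\<^sub>R g z)"
      using prim_increment[OF int(1) ut] c(11)[of t] c(11)[of u] by simp
    have le1: "cmod (LINT z:{u..t}|lebesgue. P z *\<^sub>R w z - S z *\<^sub>R g z) \<le> (LINT z:{u..t}|lebesgue. P z * cmod (w z) + \<sigma> * absS z)"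
      unfolding set_lebesgue_integral_def
    proof (rule lebesgue_integral_norm_bound_integral)
      show "integrable lebesgue (\<lambda>z. indicat_real {u..t} z *\<^sub>R (P z *\<^sub>R w z - S z *\<^sub>R g z))"
        by (intro integrable_mult_indicator int) auto
      show "integrable lebesgue (\<lambda>z. indicat_real {u..t} z *\<^sub>R (P z * cmod (w z) + \<sigma> * absS z))"
        by (intro integrable_mult_indicator Bochner_Integration.integrable_add i integrable_mult_right absS_int) auto
      fix z
      have "cmod (P z *\<^sub>R w z - S z *\<^sub>R g z) \<le> P z * cmod (w z) + \<bar>S z\<bar> * cmod (g z)"
        using norm_triangle_ineq4[of "P z *\<^sub>R w z" "S z *\<^sub>R g z"] P_nonneg[of z] by simp
      also have "\<bar>S z\<bar> * cmod (g z) \<le> \<sigma> * absS z"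
        unfolding absS_def using mult_left_mono[OF \<sigma>, of "\<bar>S z\<bar>" z] by (simp add: mult.commute)
      finally have "cmod (P z *\<^sub>R w z - S z *\<^sub>R g z) \<le> P z * cmod (w z) + \<sigma> * absS z" by simp
      then show "norm (indicat_real {u..t} z *\<^sub>R (P z *\<^sub>R w z - S z *\<^sub>R g z)) \<le> indicat_real {u..t} z *\<^sub>R (P z * cmod (w z) + \<sigma> * absS z)"
        by (auto simp: indicator_def)
    qed
    have eq2: "(LINT z:{u..t}|lebesgue. P z * cmod (w z) + \<sigma> * absS z) = (LINT z:{u..t}|lebesgue. P z * cmod (w z)) + \<sigma> * (LINT z:{u..t}|lebesgue. absS z)"
      using set_integral_add(2)[OF integrable_imp_set_integrable[OF i(3)]
          integrable_imp_set_integrable[OF integrable_mult_right[OF absS_int, of \<sigma>]], of "{u..t}"] by simp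
    have le2: "(LINT z:{u..t}|lebesgue. P z * cmod (w z)) \<le> sqrt (prim P t - prim P u) * sqrt (energy w)"
      by (rule weighted_Cauchy_Schwarz[OF core ut])
    have eq3: "(LINT z:{u..t}|lebesgue. absS z) = prim absS t - prim absS u"
      by (rule prim_increment[OF absS_int ut, symmetric])
    have "\<bar>prim P t - prim P u\<bar> = prim P t - prim P u" "\<bar>prim absS t - prim absS u\<bar> = prim absS t - prim absS u"
      using prim_increasing[OF P_int P_nonneg ut] prim_increasing[OF absS_int _ ut] by (simp_all add: absS_def)
    then show ?thesis using le1 le2 unfolding eq eq2 eq3 by linarith
  qed
  show ?thesis
  proof (cases "u \<le> t")
    case False
    then show ?thesis using le[of t u] by (simp add: norm_minus_commute abs_minus_commute)
  qed (rule le)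
qed

text \<open>An interval of positive length cannot be null for a density that is positive almost
  everywhere on it. This lets the weighted norm detect the size of a function on any short
  window.\<close>

lemma prim_R_pos:
  assumes "a \<le> u" "u < t" "t \<le> b"
  shows "0 < prim R t - prim R u"
proof -
  have eq: "prim R t - prim R u = (LINT z|lebesgue. indicat_real {u..t} z * R z)"
    using prim_increment[OF R_int, of u t] assms by (simp add: set_lebesgue_integral_def)
  have int: "integrable lebesgue (\<lambda>z. indicat_real {u..t} z * R z)"
    using integrable_mult_indicator[OF _ R_int, of "{u..t}"] by simp
  have nn: "0 \<le> prim R t - prim R u" using prim_increasing[OF R_int R_nonneg, of u t] assms by simp
  have "prim R t - prim R u \<noteq> 0"
  proof
    assume "prim R t - prim R u = 0"
    then have "AE z in lebesgue. indicat_real {u..t} z * R z = 0"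
      using integral_nonneg_eq_0_iff_AE[OF int] R_nonneg unfolding eq by auto
    then have "AE z in lebesgue. z \<notin> {u<..<t}"
      using AE_coefficients by eventually_elim (use assms in \<open>auto simp: indicator_def\<close>)
    then have "{u<..<t} \<in> null_sets lebesgue"
      using AE_iff_null_sets[of "{u<..<t}" lebesgue] by simp
    then show False using assms by (simp add: null_sets_def)
  qed
  then show ?thesis using nn by simp
qed

text \<open>Near a maximum point of \<open>cmod g\<close>, the function stays comparable to its
  maximum on a whole window, up to an energy term; integrating over the window against
  \<open>R\<close> brings in the norm. That \<open>\<kappa>\<close> may be arbitrarily small is what
  allows \<open>energy_bound\<close> to absorb the potential.\<close>

lemma sup_bound:
  assumes "0 < \<kappa>"
  obtains C where "0 \<le> C"
    "\<And>f h g w x y t. core f h g w x y \<Longrightarrow> (cmod (g t))\<^sup>2 \<le> C * (L2_norm M f)\<^sup>2 + \<kappa> * energy w"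
proof -
  have uc: "uniformly_continuous_on {a..b} (prim P)" "uniformly_continuous_on {a..b} (prim absS)"
    by (intro compact_uniformly_continuous continuous_on_prim P_int absS_int; simp)+
  obtain d1 where d1: "d1 > 0" "\<And>u t. u \<in> {a..b} \<Longrightarrow> t \<in> {a..b} \<Longrightarrow> dist u t < d1 \<Longrightarrow> dist (prim P u) (prim P t) < \<kappa> / 4"
    using uc(1) \<open>0 < \<kappa>\<close> unfolding uniformly_continuous_on_def by (metis divide_pos_pos zero_less_numeral)
  obtain d2 where d2: "d2 > 0" "\<And>u t. u \<in> {a..b} \<Longrightarrow> t \<in> {a..b} \<Longrightarrow> dist u t < d2 \<Longrightarrow> dist (prim absS u) (prim absS t) < 1 / 4"
    using uc(2) unfolding uniformly_continuous_on_def by (metis zero_less_divide_1_iff zero_less_numeral)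
  \<comment> \<open>Over distances up to \<open>\<eta>\<close>, \<open>prim P\<close> changes by
    less than \<open>\<kappa> / 4\<close> and \<open>prim absS\<close> by less than
    \<open>1 / 4\<close>; the last entry lets a window fit into \<open>[a, b]\<close>.\<close>
  define \<eta> where "\<eta> = min (min (d1/2) (d2/2)) (b - a)"
  have \<eta>: "0 < \<eta>" "\<eta> < d1" "\<eta> < d2" "\<eta> \<le> b - a" using d1 d2 ab by (auto simp: \<eta>_def)
  let ?\<rho> = "\<lambda>u. prim R (u + \<eta>) - prim R u"
  have "continuous_on {a..b - \<eta>} ?\<rho>"
    by (intro continuous_intros continuous_on_compose2[OF continuous_on_prim[OF R_int, of UNIV]] continuous_on_prim R_int) auto
  then obtain u1 where u1: "u1 \<in> {a..b - \<eta>}" "\<And>u. u \<in> {a..b - \<eta>} \<Longrightarrow> ?\<rho> u1 \<le> ?\<rho> u"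
    using continuous_attains_inf[of "{a..b - \<eta>}" ?\<rho>] \<eta> by auto
  \<comment> \<open>The least \<open>R\<close>-mass of a window of length \<open>\<eta>\<close>:
    positive by compactness and \<open>prim_R_pos\<close>, and independent of where the maximum
    lies.\<close>
  define \<rho> where "\<rho> = ?\<rho> u1"
  have \<rho>: "0 < \<rho>" unfolding \<rho>_def using u1(1) \<eta> by (intro prim_R_pos) auto
  show thesis
  proof (rule that[of "4 / \<rho>"])
    show "0 \<le> 4 / \<rho>" using \<rho> by simp
    fix f h g w x y t assume core: "core f h g w x y"
    note c = coreD[OF core]
    have "\<exists>m\<in>{a..b}. \<forall>t\<in>{a..b}. cmod (g t) \<le> cmod (g m)"
      using ab by (intro continuous_attains_sup continuous_intros continuous_on_subset[OF c(7)]) auto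
    then obtain m where m: "m \<in> {a..b}" "\<And>t. t \<in> {a..b} \<Longrightarrow> cmod (g t) \<le> cmod (g m)" by blast
    define \<sigma> where "\<sigma> = cmod (g m)"
    have \<sigma>: "cmod (g t) \<le> \<sigma>" for t
    proof (cases "t \<in> {a..b}")
      case False
      then have "t \<notin> {x..y}" using c(1-3) by auto
      then show ?thesis using c(9) by (simp add: \<sigma>_def)
    qed (use m in \<open>simp add: \<sigma>_def\<close>)
    \<comment> \<open>The window starts at distance \<open>\<eta>\<close> left of \<open>m\<close>,
      pushed right if that would leave \<open>[a, b]\<close>; it contains \<open>m\<close> in either
      case.\<close>
    define u0 where "u0 = max a (m - \<eta>)"
    have u0: "u0 \<in> {a..b - \<eta>}" "m \<in> {u0..u0 + \<eta>}" "{u0..u0 + \<eta>} \<subseteq> {a..b}"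
      using m(1) \<eta> by (auto simp: u0_def)
    define \<delta> where "\<delta> = \<sigma>\<^sup>2 - \<kappa> * energy w"
    \<comment> \<open>The \<open>absS\<close> term costs a quarter of \<open>\<sigma>\<close>,
      absorbed on the left. Squaring the remaining \<open>3/4\<close> and doubling gives the factor
      \<open>9/8\<close>, which exceeds the 1 that is needed.\<close>
    have pt: "\<delta> \<le> 4 * (cmod (g u))\<^sup>2" if u: "u \<in> {u0..u0 + \<eta>}" for u
    proof -
      have uab: "u \<in> {a..b}" "dist m u < d1" "dist m u < d2"
        using u u0 \<eta> by (auto simp: dist_real_def)
      have P4: "\<bar>prim P m - prim P u\<bar> \<le> \<kappa> / 4" and S4: "\<bar>prim absS m - prim absS u\<bar> \<le> 1 / 4"
        using d1(2)[OF m(1) uab(1,2)] d2(2)[OF m(1) uab(1,3)] by (auto simp: dist_real_def)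
      have "\<sigma> \<le> cmod (g u) + cmod (g m - g u)"
        unfolding \<sigma>_def using norm_triangle_ineq[of "g u" "g m - g u"] by simp
      also have "\<dots> \<le> cmod (g u) + (sqrt \<bar>prim P m - prim P u\<bar> * sqrt (energy w) + \<sigma> * \<bar>prim absS m - prim absS u\<bar>)"
        by (intro add_left_mono core_increment[OF core \<sigma>])
      also have "\<dots> \<le> cmod (g u) + (sqrt (\<kappa> / 4) * sqrt (energy w) + \<sigma> * (1 / 4))"
        using P4 S4 energy_nonneg[of w] by (intro add_left_mono add_mono mult_right_mono mult_left_mono) (auto simp: \<sigma>_def)
      also have "sqrt (\<kappa> / 4) * sqrt (energy w) = sqrt (\<kappa> / 4 * energy w)" by (rule real_sqrt_mult[symmetric])
      finally have "(3/4) * \<sigma> \<le> cmod (g u) + sqrt (\<kappa> / 4 * energy w)" by linarith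
      then have "((3/4) * \<sigma>)\<^sup>2 \<le> (cmod (g u) + sqrt (\<kappa> / 4 * energy w))\<^sup>2"
        by (intro power_mono) (auto simp: \<sigma>_def)
      also have "\<dots> \<le> 2 * (cmod (g u))\<^sup>2 + 2 * (sqrt (\<kappa> / 4 * energy w))\<^sup>2"
        using sum_squares_bound[of "cmod (g u)" "sqrt (\<kappa> / 4 * energy w)"] by (simp add: power2_sum)
      also have "(sqrt (\<kappa> / 4 * energy w))\<^sup>2 = \<kappa> / 4 * energy w"
        using \<open>0 < \<kappa>\<close> energy_nonneg[of w] by simp
      finally have "9/16 * \<sigma>\<^sup>2 \<le> 2 * (cmod (g u))\<^sup>2 + \<kappa> / 2 * energy w"
        by (simp add: power_mult_distrib power2_eq_square)
      moreover have "0 \<le> \<sigma>\<^sup>2" "0 \<le> \<kappa> * energy w" using \<open>0 < \<kappa>\<close> energy_nonneg[of w] by auto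
      ultimately show ?thesis unfolding \<delta>_def by linarith
    qed
    have iR: "integrable lebesgue (\<lambda>z. indicat_real {u0..u0 + \<eta>} z *\<^sub>R R z)"
      by (intro integrable_mult_indicator R_int) auto
    have "\<delta> * (prim R (u0 + \<eta>) - prim R u0) = (LINT z|lebesgue. \<delta> * (indicat_real {u0..u0 + \<eta>} z *\<^sub>R R z))"
      using prim_increment[OF R_int, of u0 "u0 + \<eta>"] \<eta> by (simp add: set_lebesgue_integral_def)
    also have "\<dots> \<le> (LINT z|lebesgue. 4 * (R z * (cmod (g z))\<^sup>2))"
    proof (rule integral_mono)
      show "integrable lebesgue (\<lambda>z. \<delta> * (indicat_real {u0..u0 + \<eta>} z *\<^sub>R R z))"
        by (intro integrable_mult_right iR)
      show "integrable lebesgue (\<lambda>z. 4 * (R z * (cmod (g z))\<^sup>2))"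
        by (intro integrable_mult_right core_integrable_squares(4)[OF core])
      fix z
      show "\<delta> * (indicat_real {u0..u0 + \<eta>} z *\<^sub>R R z) \<le> 4 * (R z * (cmod (g z))\<^sup>2)"
        using mult_left_mono[OF pt R_nonneg, of z z] R_nonneg[of z] by (cases "z \<in> {u0..u0 + \<eta>}") (auto simp: mult_ac)
    qed
    also have "\<dots> = 4 * (L2_norm M f)\<^sup>2" using core_norm[OF core] by simp
    finally have le: "\<delta> * (prim R (u0 + \<eta>) - prim R u0) \<le> 4 * (L2_norm M f)\<^sup>2" .
    have "\<delta> \<le> 4 / \<rho> * (L2_norm M f)\<^sup>2"
    proof (cases "\<delta> \<le> 0")
      case True
      also have "0 \<le> 4 / \<rho> * (L2_norm M f)\<^sup>2" using \<rho> by simp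
      finally show ?thesis .
    next
      case False
      then have "\<delta> * \<rho> \<le> \<delta> * (prim R (u0 + \<eta>) - prim R u0)"
        unfolding \<rho>_def using u1(2)[OF u0(1)] by (intro mult_left_mono) auto
      then have "\<delta> * \<rho> \<le> 4 * (L2_norm M f)\<^sup>2" using le by simp
      then show ?thesis using \<rho> by (simp add: field_simps)
    qed
    moreover have "(cmod (g t))\<^sup>2 \<le> \<sigma>\<^sup>2" using \<sigma>[of t] by (intro power_mono) auto
    ultimately show "(cmod (g t))\<^sup>2 \<le> 4 / \<rho> * (L2_norm M f)\<^sup>2 + \<kappa> * energy w" unfolding \<delta>_def by linarith
  qed
qed

text \<open>The term with \<open>Q\<close>, of arbitrary sign, is at most the L^1 norm of
  \<open>Q\<close> times the squared maximum, and \<open>sup_bound\<close> makes its energy share at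
  most one half. Semiboundedness and control of the energy by the form both follow.\<close>

lemma energy_bound:
  obtains C where "0 \<le> C"
    "\<And>f h g w x y. core f h g w x y \<Longrightarrow> energy w / 2 \<le> Re (L2_inner M f h) + C * (L2_norm M f)\<^sup>2"
proof -
  define B where "B = (LINT t|lebesgue. \<bar>Q t\<bar>)"
  have B: "0 \<le> B" unfolding B_def by (auto intro!: Bochner_Integration.integral_nonneg)
  \<comment> \<open>Gives \<open>B * \<kappa> \<le> 1 / 2\<close>, including the case
    \<open>B = 0\<close>.\<close>
  define \<kappa> where "\<kappa> = 1 / (2 * (B + 1))"
  have \<kappa>: "0 < \<kappa>" "B * \<kappa> \<le> 1 / 2" using B by (auto simp: \<kappa>_def field_simps)
  obtain C where C: "0 \<le> C" "\<And>f h g w x y t. core f h g w x y \<Longrightarrow> (cmod (g t))\<^sup>2 \<le> C * (L2_norm M f)\<^sup>2 + \<kappa> * energy w"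
    by (rule sup_bound[OF \<kappa>(1)]) (rule that)
  show thesis
  proof (rule that[of "B * C"])
    show "0 \<le> B * C" using B C by simp
    fix f h g w x y assume core: "core f h g w x y"
    let ?s = "C * (L2_norm M f)\<^sup>2 + \<kappa> * energy w"
    have "\<bar>LINT t|lebesgue. Q t * (cmod (g t))\<^sup>2\<bar> \<le> (LINT t|lebesgue. \<bar>Q t\<bar> * ?s)"
      unfolding real_norm_def[symmetric]
    proof (rule lebesgue_integral_norm_bound_integral)
      show "integrable lebesgue (\<lambda>t. Q t * (cmod (g t))\<^sup>2)" by (rule core_integrable_squares[OF core])
      show "integrable lebesgue (\<lambda>t. norm (Q t) * ?s)" using Q_int by simp
      show "norm (Q t * (cmod (g t))\<^sup>2) \<le> norm (Q t) * ?s" for t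
        using mult_left_mono[OF C(2)[OF core, of t], of "\<bar>Q t\<bar>"] by (simp add: abs_mult)
    qed
    also have "\<dots> = B * ?s" by (simp add: B_def)
    also have "\<dots> = B * C * (L2_norm M f)\<^sup>2 + (B * \<kappa>) * energy w" by (simp add: algebra_simps)
    also have "\<dots> \<le> B * C * (L2_norm M f)\<^sup>2 + 1/2 * energy w"
      using \<kappa>(2) energy_nonneg by (intro add_left_mono mult_right_mono) auto
    finally show "energy w / 2 \<le> Re (L2_inner M f h) + B * C * (L2_norm M f)\<^sup>2"
      unfolding core_form_Re[OF core] by linarith
  qed
qed

lemma T0_bounded_below: "\<exists>m. \<forall>f h. (f, h) \<in> T0 \<longrightarrow> m * (L2_norm M f)\<^sup>2 \<le> Re (L2_inner M f h)"
proof -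
  obtain C where C: "0 \<le> C" "\<And>f h g w x y. core f h g w x y \<Longrightarrow> energy w / 2 \<le> Re (L2_inner M f h) + C * (L2_norm M f)\<^sup>2"
    by (rule energy_bound) (rule that)
  have "- C * (L2_norm M f)\<^sup>2 \<le> Re (L2_inner M f h)" if T: "(f, h) \<in> T0" for f h
  proof -
    obtain g w x y where core: "core f h g w x y" by (rule T0_imp_core[OF T])
    show ?thesis using C(2)[OF core] energy_nonneg[of w] by simp
  qed
  then show ?thesis by blast
qed

section \<open>Compactness of sets bounded in form and norm\<close>

lemma uniform_limit_L2:
  assumes F: "\<And>n. F n \<in> L2 M" "\<And>n. AE t in lebesgue. t \<in> I \<longrightarrow> F n t = g n t" and f: "f \<in> L2 M"
    and unif: "\<And>e. 0 < e \<Longrightarrow> \<exists>N. \<forall>n t. n \<ge> N \<and> t \<in> I \<longrightarrow> cmod (g n t - f t) < e"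
  shows "L2_tendsto M F f"
  unfolding L2_tendsto_def
proof (rule LIMSEQ_I)
  fix e :: real assume "0 < e"
  define B where "B = (LINT t|lebesgue. R t)"
  have B: "0 \<le> B" unfolding B_def using R_nonneg by (auto intro!: Bochner_Integration.integral_nonneg)
  define e' where "e' = e / (sqrt B + 1)"
  have e': "0 < e'" "e' * sqrt B < e"
    using \<open>0 < e\<close> B by (auto simp: e'_def field_simps add_pos_nonneg)
  obtain N where N: "\<And>n t. n \<ge> N \<Longrightarrow> t \<in> I \<Longrightarrow> cmod (g n t - f t) < e'" using unif[OF e'(1)] by blast
  have "L2_norm M (\<lambda>t. F n t - f t) < e" if n: "n \<ge> N" for n
  proof -
    have d: "(\<lambda>t. F n t - f t) \<in> L2 M" by (rule L2_diff[OF F(1) f])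
    have "(L2_norm M (\<lambda>t. F n t - f t))\<^sup>2 \<le> (LINT t|lebesgue. e'\<^sup>2 * R t)"
      unfolding L2_norm_M[OF d]
    proof (rule integral_mono_AE)
      have m: "(\<lambda>t. (cmod (F n t - f t))\<^sup>2) \<in> borel_measurable M" using L2_measurable[OF d] by simp
      show "integrable lebesgue (\<lambda>t. R t * (cmod (F n t - f t))\<^sup>2)"
        using L2_integrable[OF d] unfolding integrable_M_iff[OF m] by simp
      show "integrable lebesgue (\<lambda>t. e'\<^sup>2 * R t)" using R_int by simp
      show "AE t in lebesgue. R t * (cmod (F n t - f t))\<^sup>2 \<le> e'\<^sup>2 * R t"
        using F(2)[of n]
      proof eventually_elim
        case (elim t)
        show ?case
        proof (cases "t \<in> I")
          case True
          then have "(cmod (F n t - f t))\<^sup>2 \<le> e'\<^sup>2" using elim N[OF n True] by (intro power_mono) auto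
          from mult_left_mono[OF this R_nonneg] show ?thesis by (simp add: mult.commute)
        qed (simp add: PQRS_outside)
      qed
    qed
    also have "\<dots> = (e' * sqrt B)\<^sup>2" using B by (simp add: B_def power_mult_distrib)
    finally have "L2_norm M (\<lambda>t. F n t - f t) \<le> e' * sqrt B"
      by (rule power2_le_imp_le) (use e'(1) B in simp)
    then show ?thesis using e'(2) by simp
  qed
  then show "\<exists>N. \<forall>n\<ge>N. norm (L2_norm M (\<lambda>t. F n t - f t) - 0) < e"
    by (auto simp: L2_norm_nonneg)
qed

text \<open>The bounds on norm and form give a common energy bound \<open>E\<close>, hence a common
  supremum bound and a common modulus of continuity for the representatives \<open>g n\<close>;
  uniform convergence suffices because the total weight is finite.\<close>

lemma T0_compact:
  fixes F H :: "nat \<Rightarrow> real \<Rightarrow> complex"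
  assumes T: "\<And>n. (F n, H n) \<in> T0" and le1: "\<And>n. L2_norm M (F n) \<le> 1" and leK: "\<And>n. Re (L2_inner M (F n) (H n)) \<le> K"
  shows "\<exists>f\<in>L2 M. \<exists>k. strict_mono k \<and> L2_tendsto M (F \<circ> k) f"
proof -
  have "\<forall>n. \<exists>g w x y. core (F n) (H n) g w x y" using T0_imp_core[OF T] by metis
  then obtain g w x y where core: "\<And>n. core (F n) (H n) (g n) (w n) (x n) (y n)" by metis
  obtain C where C: "0 \<le> C" "\<And>f h g w x y. core f h g w x y \<Longrightarrow> energy w / 2 \<le> Re (L2_inner M f h) + C * (L2_norm M f)\<^sup>2"
    by (rule energy_bound) (rule that)
  obtain D where D: "0 \<le> D" "\<And>f h g w x y t. core f h g w x y \<Longrightarrow> (cmod (g t))\<^sup>2 \<le> D * (L2_norm M f)\<^sup>2 + 1 * energy w"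
    by (rule sup_bound[OF zero_less_one]) (rule that)
  have sq: "(L2_norm M (F n))\<^sup>2 \<le> 1" for n using le1[of n] L2_norm_nonneg[of M "F n"] by (simp add: power_le_one)
  define E where "E = 2 * (K + C)"
  have E: "energy (w n) \<le> E" for n
    using C(2)[OF core, of n] leK[of n] mult_left_mono[OF sq C(1), of n] by (simp add: E_def)
  define \<sigma> where "\<sigma> = sqrt (D + E)"
  have \<sigma>: "cmod (g n t) \<le> \<sigma>" for n t
    unfolding \<sigma>_def using D(2)[OF core, of n t] E[of n] mult_left_mono[OF sq D(1), of n]
    by (intro real_le_rsqrt) simp
  have \<sigma>0: "0 \<le> \<sigma>" using order_trans[OF norm_ge_zero \<sigma>] .
  have E0: "0 \<le> E" using E energy_nonneg order_trans by blast
  let ?\<omega> = "\<lambda>t u. sqrt \<bar>prim P t - prim P u\<bar> * sqrt E + \<sigma> * \<bar>prim absS t - prim absS u\<bar>"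
  have inc: "cmod (g n t - g n u) \<le> ?\<omega> t u" for n t u
  proof -
    have "cmod (g n t - g n u) \<le> sqrt \<bar>prim P t - prim P u\<bar> * sqrt (energy (w n)) + \<sigma> * \<bar>prim absS t - prim absS u\<bar>"
      by (rule core_increment[OF core \<sigma>])
    also have "\<dots> \<le> ?\<omega> t u" using E[of n] by (intro add_right_mono mult_left_mono) auto
    finally show ?thesis .
  qed
  have equi: "\<exists>d>0. \<forall>n u. u \<in> {a..b} \<and> norm (t - u) < d \<longrightarrow> norm (g n t - g n u) < e" if e: "0 < e" for t e
  proof -
    have "continuous_on UNIV (?\<omega> t)"
      by (intro continuous_intros continuous_on_prim P_int absS_int)
    then have "isCont (?\<omega> t) t" by (simp add: continuous_on_eq_continuous_at)
    then obtain d where d: "d > 0" "\<And>u. dist u t < d \<Longrightarrow> dist (?\<omega> t u) (?\<omega> t t) < e"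
      using e unfolding continuous_at_eps_delta by blast
    have "norm (g n t - g n u) < e" if "norm (t - u) < d" for n u
    proof -
      have "dist u t < d" using that by (simp add: dist_norm norm_minus_commute)
      from d(2)[OF this] inc[of n t u] show ?thesis by (simp add: dist_real_def)
    qed
    then show ?thesis using d(1) by blast
  qed
  \<comment> \<open>The representatives live on the whole line, so Arzela-Ascoli can be applied on
    the closed interval, including its endpoints.\<close>
  obtain gl and k :: "nat \<Rightarrow> nat" where gl: "continuous_on {a..b} gl" "strict_mono k"
    "\<And>e. 0 < e \<Longrightarrow> \<exists>N. \<forall>n t. n \<ge> N \<and> t \<in> {a..b} \<longrightarrow> norm (g (k n) t - gl t) < e"
    by (rule Arzela_Ascoli[of "{a..b}" g \<sigma>]) (use \<sigma> equi in auto)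
  define f where "f t = indicat_real {a..b} t *\<^sub>R gl t" for t
  have fL2: "f \<in> L2 M"
  proof -
    have "f \<in> borel_measurable borel"
      unfolding f_def by (rule borel_measurable_continuous_on_indicator) (use gl in auto)
    then have m: "f \<in> borel_measurable lebesgue" by (intro measurable_completion) simp
    have "bounded (gl ` {a..b})" using gl(1) by (intro compact_imp_bounded compact_continuous_image) auto
    then obtain B where B: "\<And>t. t \<in> {a..b} \<Longrightarrow> cmod (gl t) \<le> B" unfolding bounded_iff by blast
    have "cmod (f t) \<le> max 0 B" for t using B[of t] by (cases "t \<in> {a..b}") (auto simp: f_def)
    then show ?thesis by (rule L2_bounded[OF m])
  qed
  have "L2_tendsto M (F \<circ> k) f"
  proof (rule uniform_limit_L2[OF _ _ fL2])
    show "(F \<circ> k) n \<in> L2 M" for n using T0_L2[OF T] by simp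
    show "AE t in lebesgue. t \<in> I \<longrightarrow> (F \<circ> k) n t = g (k n) t" for n using coreD(6)[OF core, of "k n"] by simp
    show "\<exists>N. \<forall>n t. n \<ge> N \<and> t \<in> I \<longrightarrow> cmod (g (k n) t - f t) < e" if e: "0 < e" for e
    proof -
      obtain N where N: "\<forall>n t. n \<ge> N \<and> t \<in> {a..b} \<longrightarrow> norm (g (k n) t - gl t) < e" using gl(3)[OF e] by blast
      then show ?thesis by (intro exI[of _ N]) (auto simp: f_def)
    qed
  qed
  then show ?thesis using fL2 gl(2) by blast
qed

end

section \<open>Unique continuation\<close>

lemma L2_projection:
  assumes "e \<in> L2 N" "f \<in> L2 N"
  shows "\<exists>c. L2_inner N e (\<lambda>x. f x - c * e x) = 0"
proof (cases "L2_norm N e = 0")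
  case True
  have "cmod (L2_inner N e f) \<le> 0" using L2_Cauchy_Schwarz[OF assms] True by simp
  then have "L2_inner N e (\<lambda>x. f x - 0 * e x) = 0" by simp
  then show ?thesis by blast
next
  case False
  define c where "c = L2_inner N e f / L2_inner N e e"
  have "L2_inner N e e \<noteq> 0" using False by (simp add: L2_inner_self)
  then have c: "c * L2_inner N e e = L2_inner N e f" by (simp add: c_def)
  have "L2_inner N e (\<lambda>x. f x - c * e x) = 0"
    using assms c by (simp add: L2_inner_diff L2_mult L2_inner_mult)
  then show ?thesis by blast
qed

text \<open>Gram-Schmidt: \<open>e2\<close> is first made orthogonal to \<open>e1\<close>, and
  degenerate vectors are absorbed by the norm 0 case of \<open>L2_projection\<close>.\<close>

lemma L2_projection2:
  assumes "e1 \<in> L2 N" "e2 \<in> L2 N" "f \<in> L2 N"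
  obtains c1 c2 where "L2_inner N e1 (\<lambda>x. f x - c1 * e1 x - c2 * e2 x) = 0" "L2_inner N e2 (\<lambda>x. f x - c1 * e1 x - c2 * e2 x) = 0"
proof -
  obtain c where c: "L2_inner N e1 (\<lambda>x. e2 x - c * e1 x) = 0" using L2_projection[OF assms(1,2)] by blast
  define e where "e x = e2 x - c * e1 x" for x
  have e: "e \<in> L2 N" unfolding e_def using assms by (intro L2_diff L2_mult)
  obtain d1 where d1: "L2_inner N e1 (\<lambda>x. f x - d1 * e1 x) = 0" using L2_projection[OF assms(1,3)] by blast
  obtain d2 where d2: "L2_inner N e (\<lambda>x. f x - d2 * e x) = 0" using L2_projection[OF e assms(3)] by blast
  have c': "L2_inner N e1 e = 0" using c unfolding e_def .
  have c'': "L2_inner N e e1 = 0" using c' by (subst L2_inner_commute) simp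
  let ?k = "\<lambda>x. f x - d1 * e1 x - d2 * e x"
  have k1: "L2_inner N e1 ?k = 0"
    using d1 c' assms e by (simp add: L2_inner_diff L2_diff L2_mult L2_inner_mult)
  have k2: "L2_inner N e ?k = 0"
    using d2 c'' assms e by (simp add: L2_inner_diff L2_diff L2_mult L2_inner_mult)
  have k: "?k \<in> L2 N" using assms e by (intro L2_diff L2_mult)
  have e2: "e2 = (\<lambda>x. e x + c * e1 x)" by (simp add: e_def)
  have k3: "L2_inner N e2 ?k = 0"
    unfolding e2 using k1 k2 by (subst L2_inner_add_mult_left[OF k e assms(1)]) simp
  have "?k = (\<lambda>x. f x - (d1 - d2 * c) * e1 x - d2 * e2 x)"
    by (simp add: e_def fun_eq_iff algebra_simps)
  then show thesis using that[of "d1 - d2 * c" d2] k1 k3 by simp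
qed

context SL_regular
begin

text \<open>The equation tau g = \<mu> g + k as a first-order system, with initial values
  \<open>g0\<close> and \<open>w0\<close> at \<open>a\<close>, where \<open>prim\<close> is still 0.
  As the coefficients vanish off \<open>I\<close>, solutions are constant there, so they are bounded
  on the line.\<close>

definition ode :: "real \<Rightarrow> (real \<Rightarrow> complex) \<Rightarrow> complex \<Rightarrow> complex \<Rightarrow> (real \<Rightarrow> complex) \<Rightarrow> (real \<Rightarrow> complex) \<Rightarrow> bool" where
  "ode \<mu> k g0 w0 g w \<longleftrightarrow> continuous_on UNIV g \<and> continuous_on UNIV w \<and> (\<exists>B. \<forall>t. cmod (g t) \<le> B \<and> cmod (w t) \<le> B) \<and>
     (\<forall>t. g t = g0 + prim (\<lambda>u. P u *\<^sub>R w u - S u *\<^sub>R g u) t) \<and>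
     (\<forall>t. w t = w0 + prim (\<lambda>u. S u *\<^sub>R w u + (Q u - \<mu> * R u) *\<^sub>R g u - R u *\<^sub>R k u) t)"

lemma odeD:
  assumes "ode \<mu> k g0 w0 g w"
  shows "continuous_on UNIV g" "continuous_on UNIV w" "\<exists>B. \<forall>t. cmod (g t) \<le> B \<and> cmod (w t) \<le> B"
    "\<And>t. g t = g0 + prim (\<lambda>u. P u *\<^sub>R w u - S u *\<^sub>R g u) t"
    "\<And>t. w t = w0 + prim (\<lambda>u. S u *\<^sub>R w u + (Q u - \<mu> * R u) *\<^sub>R g u - R u *\<^sub>R k u) t"
  using assms unfolding ode_def by blast+

lemma ode_integrable_aux:
  assumes "continuous_on UNIV g" "continuous_on UNIV w" "\<And>t. cmod (g t) \<le> B" "\<And>t. cmod (w t) \<le> B" "k \<in> L2 M"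
  shows "integrable lebesgue (\<lambda>u. P u *\<^sub>R w u - S u *\<^sub>R g u)"
    "integrable lebesgue (\<lambda>u. S u *\<^sub>R w u + (Q u - \<mu> * R u) *\<^sub>R g u - R u *\<^sub>R k u)"
proof -
  note i = integrable_coeff_mult[OF assms(1,3)] integrable_coeff_mult[OF assms(2,4)]
  show "integrable lebesgue (\<lambda>u. P u *\<^sub>R w u - S u *\<^sub>R g u)"
    by (intro Bochner_Integration.integrable_diff i)
  have "integrable lebesgue (\<lambda>u. S u *\<^sub>R w u + (Q u *\<^sub>R g u - \<mu> *\<^sub>R (R u *\<^sub>R g u)) - R u *\<^sub>R k u)"
    by (intro Bochner_Integration.integrable_diff Bochner_Integration.integrable_add i integrable_scaleR_right L2_R_integrable assms(5))
  then show "integrable lebesgue (\<lambda>u. S u *\<^sub>R w u + (Q u - \<mu> * R u) *\<^sub>R g u - R u *\<^sub>R k u)"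
    by (simp add: scaleR_left_diff_distrib)
qed

lemma ode_integrable:
  assumes "ode \<mu> k g0 w0 g w" "k \<in> L2 M"
  shows "integrable lebesgue (\<lambda>u. P u *\<^sub>R w u - S u *\<^sub>R g u)"
    "integrable lebesgue (\<lambda>u. S u *\<^sub>R w u + (Q u - \<mu> * R u) *\<^sub>R g u - R u *\<^sub>R k u)"
proof -
  note o = odeD[OF assms(1)]
  obtain B where B: "\<And>t. cmod (g t) \<le> B" "\<And>t. cmod (w t) \<le> B" using o(3) by blast
  show "integrable lebesgue (\<lambda>u. P u *\<^sub>R w u - S u *\<^sub>R g u)"
    "integrable lebesgue (\<lambda>u. S u *\<^sub>R w u + (Q u - \<mu> * R u) *\<^sub>R g u - R u *\<^sub>R k u)"
    by (rule ode_integrable_aux[OF o(1,2) B assms(2)])+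
qed

lemma ode_solution:
  assumes k: "k \<in> L2 M"
  obtains g w where "ode \<mu> k g0 w0 g w"
proof -
  \<comment> \<open>A Lipschitz constant in the norm of pairs; the factor 2 accounts for
    \<open>S\<close> occurring in both components.\<close>
  define L where "L t = 2 * (P t + \<bar>S t\<bar> + \<bar>Q t\<bar> + \<bar>\<mu>\<bar> * R t)" for t
  define F where "F t z = (P t *\<^sub>R snd z - S t *\<^sub>R fst z, S t *\<^sub>R snd z + (Q t - \<mu> * R t) *\<^sub>R fst z - R t *\<^sub>R k t)" for t and z :: "complex \<times> complex"
  have cont: "continuous_on UNIV (\<lambda>t. fst (z t))" "continuous_on UNIV (\<lambda>t. snd (z t))" 
    if "continuous_on UNIV z" for z :: "real \<Rightarrow> complex \<times> complex"
    by (rule continuous_on_fst[OF that], rule continuous_on_snd[OF that])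
  have bd: "cmod (fst (z t)) \<le> B" "cmod (snd (z t)) \<le> B" if "\<And>t. norm (z t) \<le> B" for z :: "real \<Rightarrow> complex \<times> complex" and B t
    using that[of t] norm_fst_le[of "fst (z t)" "snd (z t)"] norm_snd_le[of "snd (z t)" "fst (z t)"] by auto
  have int: "integrable lebesgue (\<lambda>t. F t (z t))" if z: "continuous_on UNIV z" "\<And>t. norm (z t) \<le> B" for z B
  proof -
    note i = ode_integrable_aux[where g = "\<lambda>t. fst (z t)" and w = "\<lambda>t. snd (z t)" and B = B,
        OF cont[OF z(1)] bd[of z B, OF z(2)] k]
    have i1: "integrable lebesgue (\<lambda>t. (P t *\<^sub>R snd (z t) - S t *\<^sub>R fst (z t), 0::complex))"
      by (rule integrable_bounded_linear[OF bounded_linear_Pair[OF bounded_linear_ident bounded_linear_zero] i(1)])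
    have i2: "integrable lebesgue (\<lambda>t. (0::complex, S t *\<^sub>R snd (z t) + (Q t - \<mu> * R t) *\<^sub>R fst (z t) - R t *\<^sub>R k t))"
      by (rule integrable_bounded_linear[OF bounded_linear_Pair[OF bounded_linear_zero bounded_linear_ident] i(2)])
    show ?thesis using Bochner_Integration.integrable_add[OF i1 i2] by (simp add: F_def)
  qed
  have lip: "norm (F t z - F t z') \<le> L t * norm (z - z')" for t z z'
  proof -
    define u v where "u = fst z - fst z'" and "v = snd z - snd z'"
    have uv: "cmod u \<le> norm (z - z')" "cmod v \<le> norm (z - z')"
      using norm_fst_le[of u v] norm_snd_le[of v u] by (simp_all add: u_def v_def minus_prod_def)
    have "F t z - F t z' = (P t *\<^sub>R v - S t *\<^sub>R u, S t *\<^sub>R v + (Q t - \<mu> * R t) *\<^sub>R u)"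
      by (simp add: F_def u_def v_def minus_prod_def algebra_simps)
    also have "norm \<dots> \<le> cmod (P t *\<^sub>R v - S t *\<^sub>R u) + cmod (S t *\<^sub>R v + (Q t - \<mu> * R t) *\<^sub>R u)"
      by (rule norm_Pair_le)
    also have "\<dots> \<le> (P t * cmod v + \<bar>S t\<bar> * cmod u) + (\<bar>S t\<bar> * cmod v + (\<bar>Q t\<bar> + \<bar>\<mu>\<bar> * R t) * cmod u)"
    proof (rule add_mono)
      show "cmod (P t *\<^sub>R v - S t *\<^sub>R u) \<le> P t * cmod v + \<bar>S t\<bar> * cmod u"
        using norm_triangle_ineq4[of "P t *\<^sub>R v" "S t *\<^sub>R u"] P_nonneg[of t] by simp
      have "\<bar>Q t - \<mu> * R t\<bar> \<le> \<bar>Q t\<bar> + \<bar>\<mu>\<bar> * R t"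
        using abs_triangle_ineq4[of "Q t" "\<mu> * R t"] R_nonneg[of t] by (simp add: abs_mult)
      from mult_right_mono[OF this norm_ge_zero[of u]]
      show "cmod (S t *\<^sub>R v + (Q t - \<mu> * R t) *\<^sub>R u) \<le> \<bar>S t\<bar> * cmod v + (\<bar>Q t\<bar> + \<bar>\<mu>\<bar> * R t) * cmod u"
        using norm_triangle_ineq[of "S t *\<^sub>R v" "(Q t - \<mu> * R t) *\<^sub>R u"] by simp
    qed
    also have "\<dots> \<le> (P t * norm (z - z') + \<bar>S t\<bar> * norm (z - z')) + (\<bar>S t\<bar> * norm (z - z') + (\<bar>Q t\<bar> + \<bar>\<mu>\<bar> * R t) * norm (z - z'))"
      using uv P_nonneg[of t] R_nonneg[of t] by (intro add_mono mult_left_mono) auto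
    also have "\<dots> \<le> L t * norm (z - z')"
    proof -
      have "(P t + \<bar>S t\<bar>) + (\<bar>S t\<bar> + (\<bar>Q t\<bar> + \<bar>\<mu>\<bar> * R t)) \<le> L t"
        using P_nonneg[of t] R_nonneg[of t] by (simp add: L_def)
      from mult_right_mono[OF this norm_ge_zero[of "z - z'"]] show ?thesis by (simp add: algebra_simps)
    qed
    finally show ?thesis .
  qed
  have L: "integrable lebesgue L" "\<And>t. 0 \<le> L t" "\<And>t. t \<le> a \<Longrightarrow> L t = 0"
    unfolding L_def using P_int Q_int R_int S_int P_nonneg R_nonneg by (auto simp: PQRS_outside)
  obtain z B where z: "continuous_on UNIV z" "\<And>t. norm (z t) \<le> B" "\<And>t. z t = (g0, w0) + prim (\<lambda>u. F u (z u)) t"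
  proof (rule integral_equation_solution[of L a F "(g0, w0)"])
    show "integrable lebesgue (\<lambda>t. F t (y t))" if "continuous_on UNIV y" "\<And>t. norm (y t) \<le> B" for y B
      by (rule int[OF that])
    show "integrable lebesgue L" by (rule L(1))
    show "0 \<le> L t" for t by (rule L(2))
    show "L t = 0" if "t \<le> a" for t by (rule L(3)[OF that])
    show "norm (F t y - F t z) \<le> L t * norm (y - z)" for t y z by (rule lip)
  qed (rule that)
  define g w where "g t = fst (z t)" and "w t = snd (z t)" for t
  have prim_fst: "fst (prim \<phi> t) = prim (\<lambda>u. fst (\<phi> u)) t" "snd (prim \<phi> t) = prim (\<lambda>u. snd (\<phi> u)) t"
    if "integrable lebesgue \<phi>" for \<phi> :: "real \<Rightarrow> complex \<times> complex" and t
  proof -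
    have i: "integrable lebesgue (\<lambda>u. indicat_real {..t} u *\<^sub>R \<phi> u)" by (intro integrable_mult_indicator that) auto
    show "fst (prim \<phi> t) = prim (\<lambda>u. fst (\<phi> u)) t" "snd (prim \<phi> t) = prim (\<lambda>u. snd (\<phi> u)) t"
      unfolding prim_def set_lebesgue_integral_def
      using integral_bounded_linear[OF bounded_linear_fst i] integral_bounded_linear[OF bounded_linear_snd i] by simp_all
  qed
  have "ode \<mu> k g0 w0 g w"
    unfolding ode_def
  proof (intro conjI allI)
    show "continuous_on UNIV g" "continuous_on UNIV w" unfolding g_def[abs_def] w_def[abs_def] by (rule cont[OF z(1)])+
    show "\<exists>B. \<forall>t. cmod (g t) \<le> B \<and> cmod (w t) \<le> B" unfolding g_def w_def using bd[of z B, OF z(2)] by blast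
    fix t
    have "fst (z t) = g0 + prim (\<lambda>u. fst (F u (z u))) t" "snd (z t) = w0 + prim (\<lambda>u. snd (F u (z u))) t"
      using z(3)[of t] prim_fst[OF int[OF z(1,2)], of t] by (metis fst_add fst_conv, metis snd_add snd_conv)
    then show "g t = g0 + prim (\<lambda>u. P u *\<^sub>R w u - S u *\<^sub>R g u) t"
      "w t = w0 + prim (\<lambda>u. S u *\<^sub>R w u + (Q u - \<mu> * R u) *\<^sub>R g u - R u *\<^sub>R k u) t"
      by (simp_all add: g_def w_def F_def)
  qed
  then show thesis by (rule that)
qed

text \<open>All terms of the product rule cancel except the one with \<open>k\<close>. The identity
  is bilinear, without conjugation, so that homogeneous solutions enter as they are.\<close>

lemma lagrange_identity:
  assumes 1: "ode \<mu> k g0 w0 g w" "k \<in> L2 M" and 2: "ode \<mu> (\<lambda>_. 0) G0 W0 G W"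
  shows "integrable lebesgue (\<lambda>u. R u *\<^sub>R (k u * G u))"
    and "g t * W t - w t * G t = g0 * W0 - w0 * G0 + prim (\<lambda>u. R u *\<^sub>R (k u * G u)) t"
proof -
  note o1 = odeD[OF 1(1)] and o2 = odeD[OF 2]
  note i1 = ode_integrable[OF 1] and i2 = ode_integrable[OF 2 L2_zero]
  have out: "P u *\<^sub>R w u - S u *\<^sub>R g u = 0" "S u *\<^sub>R w u + (Q u - \<mu> * R u) *\<^sub>R g u - R u *\<^sub>R k u = 0"
    "P u *\<^sub>R W u - S u *\<^sub>R G u = 0" "S u *\<^sub>R W u + (Q u - \<mu> * R u) *\<^sub>R G u - R u *\<^sub>R 0 = 0" if "u \<le> a" for u
    using that by (simp_all add: PQRS_outside)
  note A = prim_product[where a = a and u = g and v = W, OF i1(1) i2(2) out(1,4) o1(4) o2(5)]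
  note B = prim_product[where a = a and u = w and v = G, OF i1(2) i2(1) out(2,3) o1(5) o2(4)]
  let ?A = "\<lambda>t. (P t *\<^sub>R w t - S t *\<^sub>R g t) * W t + g t * (S t *\<^sub>R W t + (Q t - \<mu> * R t) *\<^sub>R G t - R t *\<^sub>R 0)"
  let ?B = "\<lambda>t. (S t *\<^sub>R w t + (Q t - \<mu> * R t) *\<^sub>R g t - R t *\<^sub>R k t) * G t + w t * (P t *\<^sub>R W t - S t *\<^sub>R G t)"
  have A1: "integrable lebesgue ?A" by (rule A(1))
  have B1: "integrable lebesgue ?B" by (rule B(1))
  have eq: "(\<lambda>t. ?A t - ?B t) = (\<lambda>t. R t *\<^sub>R (k t * G t))"
    by (simp add: fun_eq_iff scaleR_conv_of_real algebra_simps)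
  show "integrable lebesgue (\<lambda>u. R u *\<^sub>R (k u * G u))"
    using Bochner_Integration.integrable_diff[OF A1 B1] unfolding eq .
  have a2: "g t * W t = g0 * W0 + prim ?A t" by (rule A(2))
  have b2: "w t * G t = w0 * G0 + prim ?B t" by (rule B(2))
  have "g t * W t - w t * G t = g0 * W0 - w0 * G0 + (prim ?A t - prim ?B t)"
    unfolding a2 b2 by (simp only: add_diff_eq add_diff_add)
  also have "prim ?A t - prim ?B t = prim (\<lambda>u. R u *\<^sub>R (k u * G u)) t"
    unfolding prim_diff[OF A1 B1, symmetric] eq ..
  finally show "g t * W t - w t * G t = g0 * W0 - w0 * G0 + prim (\<lambda>u. R u *\<^sub>R (k u * G u)) t" .
qed

lemma wronskian:
  assumes "ode \<mu> (\<lambda>_. 0) g0 w0 g w" "ode \<mu> (\<lambda>_. 0) G0 W0 G W"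
  shows "g t * W t - w t * G t = g0 * W0 - w0 * G0"
  using lagrange_identity(2)[OF assms(1) L2_zero assms(2), of t] by (simp add: prim_def set_lebesgue_integral_def)

text \<open>On \<open>U\<close> the derivative of \<open>g\<close> gives \<open>P w = 0\<close>
  almost everywhere, and \<open>P\<close> is positive almost everywhere on \<open>I\<close>;
  continuity of \<open>w\<close> removes the exceptional set.\<close>

lemma quasi_deriv_eq_0:
  fixes g w :: "real \<Rightarrow> complex"
  assumes cont: "continuous_on UNIV w" and int: "integrable lebesgue (\<lambda>u. P u *\<^sub>R w u - S u *\<^sub>R g u)"
    and g: "\<And>t. g t = g0 + prim (\<lambda>u. P u *\<^sub>R w u - S u *\<^sub>R g u) t"
    and U: "open U" "U \<subseteq> I" "\<And>t. t \<in> U \<Longrightarrow> g t = 0" and t: "t \<in> U"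
  shows "w t = 0"
proof (rule continuous_AE_eq[OF U(1) _ _ _ t])
  show "continuous_on U w" using cont by (rule continuous_on_subset) simp
  show "AE t in lebesgue. t \<in> U \<longrightarrow> w t = 0"
    using prim_has_vector_derivative[OF int] AE_coefficients
  proof eventually_elim
    case (elim t)
    show ?case
    proof
      assume tU: "t \<in> U"
      have "((\<lambda>t. g0 + prim (\<lambda>u. P u *\<^sub>R w u - S u *\<^sub>R g u) t) has_vector_derivative P t *\<^sub>R w t - S t *\<^sub>R g t) (at t)"
        using elim(1) by (auto intro!: derivative_eq_intros)
      then have "(g has_vector_derivative P t *\<^sub>R w t - S t *\<^sub>R g t) (at t)"
        unfolding g[abs_def, symmetric] .
      moreover have "(g has_vector_derivative 0) (at t)" by (rule has_vector_derivative_0_of_eq_0[OF U(1) tU U(3)])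
      ultimately have "P t *\<^sub>R w t - S t *\<^sub>R g t = 0" by (rule vector_derivative_unique_at)
      then show "w t = 0" using elim(2) U(2,3) tU by auto
    qed
  qed
qed simp

text \<open>By linearity this says that \<open>T0\<close> is an operator modulo null functions. It
  is needed to see that trivial first components force trivial values.\<close>

lemma core_single_valued:
  assumes core: "core f h g w x y" and f: "AE t in lebesgue. t \<in> I \<longrightarrow> f t = 0"
  shows "AE t in lebesgue. t \<in> I \<longrightarrow> h t = 0"
proof -
  note c = coreD[OF core] and int = core_integrable[OF core]
  have g: "g t = 0" if "t \<in> I" for t
  proof (rule continuous_AE_eq[OF _ _ _ _ that])
    show "continuous_on I g" using c(7) by (rule continuous_on_subset) simp
    show "AE t in lebesgue. t \<in> I \<longrightarrow> g t = 0" using f c(6) by eventually_elim auto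
  qed auto
  have g': "g t = 0 + prim (\<lambda>u. P u *\<^sub>R w u - S u *\<^sub>R g u) t" for t using c(11)[of t] by simp
  have w: "w t = 0" if "t \<in> I" for t
    by (rule quasi_deriv_eq_0[OF c(8) int(1) g' _ _ g that]) auto
  show ?thesis
    using prim_has_vector_derivative[OF int(2)] AE_coefficients
  proof eventually_elim
    case (elim t)
    show ?case
    proof
      assume t: "t \<in> I"
      have "(w has_vector_derivative S t *\<^sub>R w t + Q t *\<^sub>R g t - R t *\<^sub>R h t) (at t)"
        using elim(1) unfolding c(12)[abs_def, symmetric] .
      moreover have "(w has_vector_derivative 0) (at t)" by (rule has_vector_derivative_0_of_eq_0[OF _ t w]) auto
      ultimately have "S t *\<^sub>R w t + Q t *\<^sub>R g t - R t *\<^sub>R h t = 0" by (rule vector_derivative_unique_at)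
      then show "h t = 0" using elim(2) t g w by auto
    qed
  qed
qed

section \<open>Compactly supported solutions as test functions for weak eigenfunctions\<close>

lemma L2_indicator:
  assumes "f \<in> L2 M" "A \<in> sets lebesgue"
  shows "(\<lambda>t. indicat_real A t *\<^sub>R f t) \<in> L2 M"
proof -
  have A: "(indicat_real A :: real \<Rightarrow> real) \<in> borel_measurable M"
    by (rule lebesgue_imp_M) (use assms(2) in simp)
  have m: "(\<lambda>t. indicat_real A t *\<^sub>R f t) \<in> borel_measurable M"
    using L2_measurable[OF assms(1)] A by (intro borel_measurable_scaleR)
  have "integrable M (\<lambda>t. (cmod (indicat_real A t *\<^sub>R f t))\<^sup>2)"
  proof (rule Bochner_Integration.integrable_bound[OF L2_integrable[OF assms(1)]])
    show "(\<lambda>t. (cmod (indicat_real A t *\<^sub>R f t))\<^sup>2) \<in> borel_measurable M"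
      by (rule borel_measurable_power[OF measurable_compose[OF m borel_measurable_norm]])
  qed (auto simp: indicator_def)
  then show ?thesis using m by (simp add: L2_def)
qed

text \<open>If \<open>k\<close> is orthogonal to the conjugated homogeneous solutions, the solution of the
  inhomogeneous equation with zero initial data vanishes again beyond the support of \<open>k\<close>.\<close>

lemma compactly_supported_solution:
  assumes e: "ode \<mu> (\<lambda>_. 0) 1 0 \<phi>1 \<psi>1" "ode \<mu> (\<lambda>_. 0) 0 1 \<phi>2 \<psi>2"
    and xy: "a < x" "x \<le> y" "y < b" and k: "k \<in> L2 M" "\<And>t. t \<notin> {x..y} \<Longrightarrow> k t = 0"
    and orth: "(LINT t|lebesgue. R t *\<^sub>R (k t * \<phi>1 t)) = 0" "(LINT t|lebesgue. R t *\<^sub>R (k t * \<phi>2 t)) = 0"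
  obtains g where "(g, \<lambda>t. \<mu> * g t + k t) \<in> T0" "g \<in> L2 M"
proof -
  obtain g w where gw: "ode \<mu> k 0 0 g w" by (rule ode_solution[OF k(1)])
  note o = odeD[OF gw]
  have zero: "g t * W t = w t * G t" if t: "t \<notin> {x..y}" and E: "ode \<mu> (\<lambda>_. 0) G0 W0 G W" and G: "(LINT t|lebesgue. R t *\<^sub>R (k t * G t)) = 0"
    for t G0 W0 G W
  proof -
    have "prim (\<lambda>u. R u *\<^sub>R (k u * G u)) t = 0"
    proof (cases "t < x")
      case True
      then show ?thesis using k(2) by (intro prim_eq_0) auto
    next
      case False
      then have "y < t" using t xy by auto
      then have "prim (\<lambda>u. R u *\<^sub>R (k u * G u)) t = (LINT u|lebesgue. R u *\<^sub>R (k u * G u))"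
        using k(2) by (intro prim_eq_integral) auto
      then show ?thesis using G by simp
    qed
    then show ?thesis using lagrange_identity(2)[OF gw k(1) E, of t] by simp
  qed
  \<comment> \<open>With Wronskian 1 the linear system in \<open>g t\<close> and \<open>w t\<close>
    given by the two vanishing Lagrange expressions is invertible, so both unknowns are 0.\<close>
  have W: "\<phi>1 t * \<psi>2 t - \<psi>1 t * \<phi>2 t = 1" for t using wronskian[OF e, of t] by simp
  have out: "g t = 0" "w t = 0" if "t \<notin> {x..y}" for t
  proof -
    have 1: "g t * \<psi>1 t = w t * \<phi>1 t" by (rule zero[OF that e(1) orth(1)])
    have 2: "g t * \<psi>2 t = w t * \<phi>2 t" by (rule zero[OF that e(2) orth(2)])
    have "g t = g t * (\<phi>1 t * \<psi>2 t - \<psi>1 t * \<phi>2 t)" by (simp add: W)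
    also have "\<dots> = \<phi>1 t * (g t * \<psi>2 t) - \<phi>2 t * (g t * \<psi>1 t)" by (simp add: algebra_simps)
    also have "\<dots> = 0" unfolding 1 2 by (simp add: algebra_simps)
    finally show "g t = 0" .
    have "w t = w t * (\<phi>1 t * \<psi>2 t - \<psi>1 t * \<phi>2 t)" by (simp add: W)
    also have "\<dots> = (w t * \<phi>1 t) * \<psi>2 t - (w t * \<phi>2 t) * \<psi>1 t" by (simp add: algebra_simps)
    also have "\<dots> = 0" unfolding 1[symmetric] 2[symmetric] by (simp add: algebra_simps)
    finally show "w t = 0" .
  qed
  obtain B where B: "\<And>t. cmod (g t) \<le> B" using o(3) by blast
  have g: "g \<in> L2 M" by (rule L2_bounded[OF continuous_imp_lebesgue_measurable[OF o(1)] B])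
  have "core g (\<lambda>t. \<mu> * g t + k t) g w x y"
    unfolding core_def
  proof (intro conjI allI impI)
    show "(\<lambda>t. \<mu> * g t + k t) \<in> L2 M" using L2_add_mult[OF k(1) g, of \<mu>] by (simp add: add.commute)
    show "g t = prim (\<lambda>u. P u *\<^sub>R w u - S u *\<^sub>R g u) t" for t using o(4)[of t] by simp
    have "(\<lambda>u. S u *\<^sub>R w u + (Q u - \<mu> * R u) *\<^sub>R g u - R u *\<^sub>R k u) = (\<lambda>u. S u *\<^sub>R w u + Q u *\<^sub>R g u - R u *\<^sub>R (\<mu> * g u + k u))"
      by (simp add: fun_eq_iff scaleR_conv_of_real algebra_simps)
    then show "w t = prim (\<lambda>u. S u *\<^sub>R w u + Q u *\<^sub>R g u - R u *\<^sub>R (\<mu> * g u + k u)) t" for t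
      using o(5)[of t] by simp
  qed (use xy g o(1,2) out in auto)
  then have "(g, \<lambda>t. \<mu> * g t + k t) \<in> T0" by (rule core_imp_T0)
  then show thesis using g by (rule that)
qed

text \<open>Let \<open>k\<close> be the component of \<open>f\<close> on \<open>[x, y]\<close>
  orthogonal to the conjugated homogeneous solutions. It is an admissible right-hand side, so the
  weak identity makes \<open>f\<close> orthogonal to \<open>k\<close>, hence \<open>k\<close> is
  null and \<open>f\<close> is a combination of those solutions on \<open>[x, y]\<close>. Vanishing
  on an interval kills its coefficients.\<close>

lemma unique_continuation_interval:
  assumes f: "f \<in> L2 M" and U: "a < x" "x < u1" "u1 < u2" "u2 < y" "y < b"
    and fU: "AE t in lebesgue. t \<in> {u1<..<u2} \<longrightarrow> f t = 0"
    and orth: "\<And>g h. (g, h) \<in> T0 \<Longrightarrow> L2_inner M h f = of_real \<mu> * L2_inner M g f"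
  shows "AE t in lebesgue. t \<in> {x..y} \<longrightarrow> f t = 0"
proof -
  have UI: "{u1<..<u2} \<subseteq> I" "{x..y} \<subseteq> I" using U by auto
  obtain \<phi>1 \<psi>1 where e1: "ode \<mu> (\<lambda>_. 0) 1 0 \<phi>1 \<psi>1" by (rule ode_solution[OF L2_zero])
  obtain \<phi>2 \<psi>2 where e2: "ode \<mu> (\<lambda>_. 0) 0 1 \<phi>2 \<psi>2" by (rule ode_solution[OF L2_zero])
  note o1 = odeD[OF e1] and o2 = odeD[OF e2]
  let ?i = "indicat_real {x..y}"
  have cnjL2: "(\<lambda>t. ?i t *\<^sub>R cnj (\<phi> t)) \<in> L2 M" if \<phi>: "continuous_on UNIV \<phi>" "\<exists>B. \<forall>t. cmod (\<phi> t) \<le> B \<and> cmod (\<psi> t) \<le> B" for \<phi> \<psi>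
  proof -
    obtain B where "\<And>t. cmod (cnj (\<phi> t)) \<le> B" using \<phi>(2) by auto
    then have "(\<lambda>t. cnj (\<phi> t)) \<in> L2 M"
      by (intro L2_bounded[of _ B] continuous_imp_lebesgue_measurable continuous_intros \<phi>(1))
    then show ?thesis by (rule L2_indicator) simp
  qed
  \<comment> \<open>Conjugation compensates for that in the first argument of
    \<open>L2_inner\<close>: orthogonality of \<open>k\<close> to \<open>E1\<close> and
    \<open>E2\<close> is the bilinear condition of \<open>compactly_supported_solution\<close>. The
    indicator confines \<open>k\<close> to \<open>[x, y]\<close>.\<close>
  define E1 E2 F where "E1 t = ?i t *\<^sub>R cnj (\<phi>1 t)" and "E2 t = ?i t *\<^sub>R cnj (\<phi>2 t)" and "F t = ?i t *\<^sub>R f t" for t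
  have L2: "E1 \<in> L2 M" "E2 \<in> L2 M" "F \<in> L2 M"
    unfolding E1_def E2_def F_def using cnjL2[OF o1(1,3)] cnjL2[OF o2(1,3)] L2_indicator[OF f, of "{x..y}"] by auto
  obtain c1 c2 where c: "L2_inner M E1 (\<lambda>t. F t - c1 * E1 t - c2 * E2 t) = 0" "L2_inner M E2 (\<lambda>t. F t - c1 * E1 t - c2 * E2 t) = 0"
    by (rule L2_projection2[OF L2]) (rule that)
  define k where "k t = F t - c1 * E1 t - c2 * E2 t" for t
  have kL2: "k \<in> L2 M" unfolding k_def using L2 by (intro L2_diff L2_mult)
  have kout: "k t = 0" if "t \<notin> {x..y}" for t using that by (simp add: k_def F_def E1_def E2_def)
  have ki: "?i t *\<^sub>R k t = k t" for t using kout[of t] by (cases "t \<in> {x..y}") auto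
  have cnjE: "cnj (E1 t) * k t = k t * \<phi>1 t" "cnj (E2 t) * k t = k t * \<phi>2 t" for t
    using kout[of t] by (cases "t \<in> {x..y}"; simp add: E1_def E2_def)+
  have o: "(LINT t|lebesgue. R t *\<^sub>R (k t * \<phi>1 t)) = 0" "(LINT t|lebesgue. R t *\<^sub>R (k t * \<phi>2 t)) = 0"
    using c unfolding k_def[symmetric] L2_inner_M(1)[OF L2(1) kL2] L2_inner_M(1)[OF L2(2) kL2] cnjE by auto
  obtain g :: "real \<Rightarrow> complex" where g: "(g, \<lambda>t. complex_of_real \<mu> * g t + k t) \<in> T0" "g \<in> L2 M"
    by (rule compactly_supported_solution[OF e1 e2 U(1) _ U(5) kL2 kout o]) (use U in auto)
  \<comment> \<open>For the pair just built the value is \<open>\<mu> * g + k\<close>, so the terms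
    with \<open>\<mu>\<close> cancel in the weak identity.\<close>
  have "L2_inner M k f + of_real \<mu> * L2_inner M g f = of_real \<mu> * L2_inner M g f"
    using orth[OF g(1)] L2_inner_add_mult_left[OF f kL2 g(2), of "of_real \<mu>"] by (simp add: add.commute)
  then have "L2_inner M k f = 0" by simp
  moreover have "L2_inner M k F = L2_inner M k f"
    unfolding L2_inner_M(1)[OF kL2 f] L2_inner_M(1)[OF kL2 L2(3)]
    by (intro Bochner_Integration.integral_cong refl) (use kout in \<open>auto simp: F_def indicator_def\<close>)
  ultimately have kF: "L2_inner M k F = 0" by simp
  have kE: "L2_inner M k E1 = 0" "L2_inner M k E2 = 0"
    using c unfolding k_def[symmetric] by (subst L2_inner_commute, simp)+
  have "L2_inner M k k = L2_inner M k F - c1 * L2_inner M k E1 - c2 * L2_inner M k E2"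
  proof -
    have "L2_inner M k k = L2_inner M k (\<lambda>t. F t - c1 * E1 t - c2 * E2 t)" unfolding k_def[abs_def, symmetric] ..
    also have "\<dots> = L2_inner M k F - c1 * L2_inner M k E1 - c2 * L2_inner M k E2"
      using L2 kL2 by (simp add: L2_inner_diff L2_diff L2_mult L2_inner_mult)
    finally show ?thesis .
  qed
  then have "L2_inner M k k = 0" using kF kE by simp
  then have "L2_norm M k = 0" by (simp add: L2_inner_self)
  then have k0: "AE t in lebesgue. t \<in> I \<longrightarrow> k t = 0" using L2_norm_eq_0_iff[OF kL2] unfolding AE_M by simp
  \<comment> \<open>After conjugating, \<open>f\<close> is expressed by \<open>\<phi>1\<close> and
    \<open>\<phi>2\<close> themselves, and the combination can be paired with the same combination
    of quasi-derivatives.\<close>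
  define d1 d2 where "d1 = cnj c1" and "d2 = cnj c2"
  have f_eq: "AE t in lebesgue. t \<in> {x..y} \<longrightarrow> cnj (f t) = d1 * \<phi>1 t + d2 * \<phi>2 t"
    using k0
  proof eventually_elim
    case (elim t)
    show ?case
    proof
      assume t: "t \<in> {x..y}"
      then have "F t = c1 * E1 t + c2 * E2 t" using elim UI by (auto simp: k_def algebra_simps)
      then have "f t = c1 * cnj (\<phi>1 t) + c2 * cnj (\<phi>2 t)" using t by (simp add: F_def E1_def E2_def)
      then show "cnj (f t) = d1 * \<phi>1 t + d2 * \<phi>2 t" by (simp add: d1_def d2_def)
    qed
  qed
  define \<Gamma> \<Omega> where "\<Gamma> t = d1 * \<phi>1 t + d2 * \<phi>2 t" and "\<Omega> t = d1 * \<psi>1 t + d2 * \<psi>2 t" for t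
  have cont: "continuous_on UNIV \<Gamma>" "continuous_on UNIV \<Omega>" unfolding \<Gamma>_def \<Omega>_def by (intro continuous_intros o1 o2)+
  have \<Gamma>0: "\<Gamma> t = 0" if t: "t \<in> {u1<..<u2}" for t
  proof (rule continuous_AE_eq[OF _ _ _ _ t])
    show "continuous_on {u1<..<u2} \<Gamma>" using cont(1) by (rule continuous_on_subset) simp
    show "AE t in lebesgue. t \<in> {u1<..<u2} \<longrightarrow> \<Gamma> t = 0"
      using f_eq fU by eventually_elim (use U in \<open>auto simp: \<Gamma>_def\<close>)
  qed auto
  have i1: "integrable lebesgue (\<lambda>u. P u *\<^sub>R \<psi>1 u - S u *\<^sub>R \<phi>1 u)" and i2: "integrable lebesgue (\<lambda>u. P u *\<^sub>R \<psi>2 u - S u *\<^sub>R \<phi>2 u)"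
    using ode_integrable(1)[OF e1 L2_zero] ode_integrable(1)[OF e2 L2_zero] .
  have eq: "(\<lambda>u. P u *\<^sub>R \<Omega> u - S u *\<^sub>R \<Gamma> u) = (\<lambda>u. d1 * (P u *\<^sub>R \<psi>1 u - S u *\<^sub>R \<phi>1 u) + d2 * (P u *\<^sub>R \<psi>2 u - S u *\<^sub>R \<phi>2 u))"
    by (simp add: \<Gamma>_def \<Omega>_def fun_eq_iff scaleR_conv_of_real algebra_simps)
  have int: "integrable lebesgue (\<lambda>u. P u *\<^sub>R \<Omega> u - S u *\<^sub>R \<Gamma> u)"
    unfolding eq by (intro Bochner_Integration.integrable_add integrable_mult_right i1 i2)
  have \<Gamma>: "\<Gamma> t = d1 + prim (\<lambda>u. P u *\<^sub>R \<Omega> u - S u *\<^sub>R \<Gamma> u) t" for t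
  proof -
    have "prim (\<lambda>u. P u *\<^sub>R \<Omega> u - S u *\<^sub>R \<Gamma> u) t = d1 * prim (\<lambda>u. P u *\<^sub>R \<psi>1 u - S u *\<^sub>R \<phi>1 u) t + d2 * prim (\<lambda>u. P u *\<^sub>R \<psi>2 u - S u *\<^sub>R \<phi>2 u) t"
      unfolding eq by (simp only: prim_add_mult[OF integrable_mult_right[OF i1] i2] prim_mult_left)
    moreover have "\<Gamma> t = d1 * \<phi>1 t + d2 * \<phi>2 t" by (simp add: \<Gamma>_def)
    ultimately show ?thesis using o1(4)[of t] o2(4)[of t] by (simp add: algebra_simps)
  qed
  define t0 where "t0 = (u1 + u2) / 2"
  have t0: "t0 \<in> {u1<..<u2}" using U by (simp add: t0_def)
  have \<Omega>0: "\<Omega> t0 = 0" by (rule quasi_deriv_eq_0[OF cont(2) int \<Gamma> _ UI(1) \<Gamma>0 t0]) auto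
  have W: "\<phi>1 t0 * \<psi>2 t0 - \<psi>1 t0 * \<phi>2 t0 = 1" using wronskian[OF e1 e2, of t0] by simp
  \<comment> \<open>Cramer's rule: at \<open>t0\<close> both the combination and its
    quasi-derivative vanish, and the determinant is the Wronskian.\<close>
  have "d1 = d1 * (\<phi>1 t0 * \<psi>2 t0 - \<psi>1 t0 * \<phi>2 t0)" by (simp add: W)
  also have "\<dots> = \<Gamma> t0 * \<psi>2 t0 - \<Omega> t0 * \<phi>2 t0" by (simp add: \<Gamma>_def \<Omega>_def algebra_simps)
  finally have d1: "d1 = 0" using \<Gamma>0[OF t0] \<Omega>0 by simp
  have "d2 = d2 * (\<phi>1 t0 * \<psi>2 t0 - \<psi>1 t0 * \<phi>2 t0)" by (simp add: W)
  also have "\<dots> = \<Omega> t0 * \<phi>1 t0 - \<Gamma> t0 * \<psi>1 t0" by (simp add: \<Gamma>_def \<Omega>_def algebra_simps)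
  finally have d2: "d2 = 0" using \<Gamma>0[OF t0] \<Omega>0 by simp
  show ?thesis using f_eq by eventually_elim (simp add: d1 d2)
qed

text \<open>Exhausts \<open>(a, b)\<close> by countably many compact intervals, each covered by
  \<open>unique_continuation_interval\<close>.\<close>

lemma unique_continuation:
  assumes f: "f \<in> L2 M" and U: "a \<le> u1" "u1 < u2" "u2 \<le> b"
    and fU: "AE t in lebesgue. t \<in> {u1<..<u2} \<longrightarrow> f t = 0"
    and orth: "\<And>g h. (g, h) \<in> T0 \<Longrightarrow> L2_inner M h f = of_real \<mu> * L2_inner M g f"
  shows "AE t in M. f t = 0"
proof -
  \<comment> \<open>The zero interval may touch an endpoint of \<open>(a, b)\<close>, whereas the
    local statement needs it strictly inside \<open>[x, y]\<close>; its middle third is.\<close>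
  define v1 v2 where "v1 = u1 + (u2 - u1) / 3" and "v2 = u2 - (u2 - u1) / 3"
  have v: "u1 < v1" "v1 < v2" "v2 < u2" using U by (auto simp: v1_def v2_def field_simps)
  \<comment> \<open>The denominator is at least 2, so already \<open>x 0\<close> lies strictly left
    of \<open>v1\<close> and \<open>y 0\<close> strictly right of \<open>v2\<close>.\<close>
  define x y where "x n = a + (v1 - a) / real (n + 2)" and "y n = b - (b - v2) / real (n + 2)" for n :: nat
  have xy: "a < x n" "x n < v1" "v2 < y n" "y n < b" for n
  proof -
    have z: "0 < z / real (n + 2)" "z / real (n + 2) < z" if "0 < z" for z
    proof -
      have "z / real (n + 2) \<le> z / 2" using that by (intro divide_left_mono) auto
      then show "z / real (n + 2) < z" using that by linarith
      show "0 < z / real (n + 2)" using that by simp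
    qed
    show "a < x n" "x n < v1" "v2 < y n" "y n < b"
      using z[of "v1 - a"] z[of "b - v2"] U v by (simp_all add: x_def y_def)
  qed
  have fv: "AE t in lebesgue. t \<in> {v1<..<v2} \<longrightarrow> f t = 0"
    using fU by eventually_elim (use v in auto)
  have "AE t in lebesgue. t \<in> {x n..y n} \<longrightarrow> f t = 0" for n
    by (rule unique_continuation_interval[OF f xy(1,2) v(2) xy(3,4) fv orth])
  then have "AE t in lebesgue. \<forall>n. t \<in> {x n..y n} \<longrightarrow> f t = 0"
    by (subst AE_all_countable) blast
  then show ?thesis
    unfolding AE_M
  proof eventually_elim
    case (elim t)
    show ?case
    proof
      assume t: "t \<in> I"
      have "x \<longlonglongrightarrow> a + 0" "y \<longlonglongrightarrow> b - 0"
        unfolding x_def y_def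
        by (intro tendsto_intros real_tendsto_divide_at_top[OF tendsto_const] filterlim_compose[OF filterlim_real_sequentially] filterlim_add_const_nat_at_top)+
      then have "eventually (\<lambda>n. x n < t) sequentially" "eventually (\<lambda>n. t < y n) sequentially"
        using t by (auto intro: order_tendstoD)
      then have "eventually (\<lambda>n. t \<in> {x n..y n}) sequentially" by eventually_elim auto
      then obtain n where "t \<in> {x n..y n}" using eventually_happens trivial_limit_sequentially by blast
      then show "f t = 0" using elim by blast
    qed
  qed
qed

text \<open>If all elements of \<open>T0\<close> were null, the weak identity would hold vacuously
  for every \<open>f\<close>, with \<open>\<mu> = 0\<close>. Unique continuation would then
  annihilate a function that is 0 on one half of the interval and 1 on the other.\<close>

lemma T0_nontrivial: "\<exists>f h. (f, h) \<in> T0 \<and> L2_norm M f \<noteq> 0"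
proof (rule ccontr)
  assume "\<not> ?thesis"
  then have triv: "\<And>f h. (f, h) \<in> T0 \<Longrightarrow> L2_norm M f = 0" by blast
  define m where "m = (a + b) / 2"
  have m: "a < m" "m < b" using ab by (auto simp: m_def)
  define f where "f t = indicat_real {m..} t *\<^sub>R (1::complex)" for t
  have f: "f \<in> L2 M" unfolding f_def by (rule L2_indicator[OF L2_const]) simp
  have "AE t in M. f t = 0"
  proof (rule unique_continuation[OF f order_refl m(1) less_imp_le[OF m(2)]])
    show "AE t in lebesgue. t \<in> {a<..<m} \<longrightarrow> f t = 0" by (auto simp: f_def)
    fix g h assume gh: "(g, h) \<in> T0"
    obtain g' w x y where core: "core g h g' w x y" by (rule T0_imp_core[OF gh])
    have L2: "g \<in> L2 M" "h \<in> L2 M" using T0_L2[OF gh] by auto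
    have "AE t in lebesgue. t \<in> I \<longrightarrow> g t = 0" using triv[OF gh] L2_norm_eq_0_iff[OF L2(1)] unfolding AE_M by simp
    then have "AE t in M. h t = 0" using core_single_valued[OF core] unfolding AE_M by simp
    then have "L2_norm M h = 0" using L2_norm_eq_0_iff[OF L2(2)] by simp
    then show "L2_inner M h f = of_real 0 * L2_inner M g f"
      using L2_Cauchy_Schwarz[OF L2(2) f] by simp
  qed
  then have "AE t in lebesgue. t \<notin> {m<..<b}"
    unfolding AE_M by eventually_elim (use m in \<open>auto simp: f_def\<close>)
  then have "{m<..<b} \<in> null_sets lebesgue"
    using AE_iff_null_sets[of "{m<..<b}" lebesgue] by simp
  then show False using m by (simp add: null_sets_def)
qed

lemma T0_compact_op: "\<exists>m. compact_op M T0 m"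
proof -
  obtain m where m: "\<And>f h. (f, h) \<in> T0 \<Longrightarrow> m * (L2_norm M f)\<^sup>2 \<le> Re (L2_inner M f h)"
    using T0_bounded_below by blast
  have "compact_op M T0 m"
    by (intro compact_op.intro semibounded_op.intro compact_op_axioms.intro)
      (fact T0_L2 T0_add_mult T0_symmetric m T0_nontrivial T0_compact)+
  then show ?thesis ..
qed

lemma lowest_eigenvalue_T_F: "lowest_eigenvalue M (T_F p q r s a b) = rayleigh_inf M T0"
proof -
  obtain m where "compact_op M T0 m" using T0_compact_op by blast
  then interpret compact_op M T0 m .
  show ?thesis unfolding T_F_def T_min_eq by (rule lowest_eigenvalue_friedrichs)
qed

end

section \<open>Monotonicity in the interval\<close>

lemma SL_regular_subinterval:
  assumes "SL_regular p q r s a b" "a \<le> c" "c < d" "d \<le> b"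
  shows "SL_regular p q r s c d"
proof -
  interpret SL_regular p q r s a b by (rule assms(1))
  have sub: "{c<..<d} \<subseteq> {a<..<b}" using assms by auto
  have ae: "AE x in lebesgue_on {c<..<d}. X x" if "AE x in lebesgue_on {a<..<b}. X x" for X
    using that sub by (auto simp: AE_restrict_space_iff elim!: eventually_mono)
  have int: "integrable (lebesgue_on {c<..<d}) f" if "integrable (lebesgue_on {a<..<b}) f" for f :: "real \<Rightarrow> real"
  proof -
    have "set_integrable lebesgue {a<..<b} f"
      using that by (simp add: set_integrable_def integrable_restrict_space)
    then have "set_integrable lebesgue {c<..<d} f"
      by (rule set_integrable_subset) (use sub in auto)
    then show ?thesis by (simp add: set_integrable_def integrable_restrict_space)
  qed
  show ?thesis
    using assms(3) measurable_restrict_mono[OF p_meas sub] measurable_restrict_mono[OF r_meas sub]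
      ae[OF p_pos] ae[OF r_pos] int[OF p_int] int[OF q_int] int[OF r_int] int[OF s_int]
    by (rule SL_regular.intro)
qed

locale SL_subinterval = A: SL_regular p q r s a b + B: SL_regular p q r s c d
  for p q r s :: "real \<Rightarrow> real" and a b c d :: real +
  assumes ac: "a \<le> c" and db: "d \<le> b"
begin

definition ext :: "(real \<Rightarrow> complex) \<Rightarrow> real \<Rightarrow> complex" where
  "ext f t = indicat_real {c<..<d} t *\<^sub>R f t"

lemma coefficients_inside:
  assumes "t \<in> {c<..<d}"
  shows "A.P t = B.P t" "A.Q t = B.Q t" "A.R t = B.R t" "A.S t = B.S t"
proof -
  have "t \<in> {a<..<b}" using assms ac db by auto
  then show "A.P t = B.P t" "A.Q t = B.Q t" "A.R t = B.R t" "A.S t = B.S t"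
    using assms by (simp_all add: A.P_def A.Q_def A.R_def A.S_def B.P_def B.Q_def B.R_def B.S_def)
qed

lemma R_ext: "A.R t *\<^sub>R ext h t = B.R t *\<^sub>R h t"
  using coefficients_inside[of t] B.PQRS_outside(3)[of t] by (cases "t \<in> {c<..<d}") (auto simp: ext_def)

lemma ext_L2:
  assumes "f \<in> L2 B.M"
  shows "ext f \<in> L2 A.M"
proof -
  have "(\<lambda>t. indicat_real {c<..<d} t *\<^sub>R f t) \<in> borel_measurable lebesgue"
    using L2_measurable[OF assms] unfolding B.measurable_M_iff .
  then have m: "ext f \<in> borel_measurable A.M"
    unfolding ext_def[abs_def] by (rule A.lebesgue_imp_M)
  then have mA: "(\<lambda>t. (cmod (ext f t))\<^sup>2) \<in> borel_measurable A.M" by simp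
  have mB: "(\<lambda>t. (cmod (f t))\<^sup>2) \<in> borel_measurable B.M" using L2_measurable[OF assms] by simp
  have "(\<lambda>t. A.R t *\<^sub>R (cmod (ext f t))\<^sup>2) = (\<lambda>t. B.R t *\<^sub>R (cmod (f t))\<^sup>2)"
  proof
    fix t
    show "A.R t *\<^sub>R (cmod (ext f t))\<^sup>2 = B.R t *\<^sub>R (cmod (f t))\<^sup>2"
      using coefficients_inside[of t] B.PQRS_outside(3)[of t] by (cases "t \<in> {c<..<d}") (auto simp: ext_def)
  qed
  then have "integrable A.M (\<lambda>t. (cmod (ext f t))\<^sup>2)"
    using L2_integrable[OF assms] unfolding A.integrable_M_iff[OF mA] B.integrable_M_iff[OF mB] by simp
  then show ?thesis using m by (simp add: L2_def)
qed

lemma ext_inner: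
  assumes "f \<in> L2 B.M" "g \<in> L2 B.M"
  shows "L2_inner A.M (ext f) (ext g) = L2_inner B.M f g"
proof -
  have "(\<lambda>t. A.R t *\<^sub>R (cnj (ext f t) * ext g t)) = (\<lambda>t. B.R t *\<^sub>R (cnj (f t) * g t))"
  proof
    fix t
    show "A.R t *\<^sub>R (cnj (ext f t) * ext g t) = B.R t *\<^sub>R (cnj (f t) * g t)"
      using coefficients_inside[of t] B.PQRS_outside(3)[of t] by (cases "t \<in> {c<..<d}") (auto simp: ext_def)
  qed
  then show ?thesis
    unfolding A.L2_inner_M(1)[OF ext_L2[OF assms(1)] ext_L2[OF assms(2)]] B.L2_inner_M(1)[OF assms] by simp
qed

lemma ext_norm:
  assumes "f \<in> L2 B.M"
  shows "L2_norm A.M (ext f) = L2_norm B.M f"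
proof -
  have "(L2_norm A.M (ext f))\<^sup>2 = (L2_norm B.M f)\<^sup>2"
    using ext_inner[OF assms assms] unfolding L2_inner_self by (simp only: of_real_eq_iff)
  then show ?thesis by (simp add: L2_norm_nonneg power2_eq_iff_nonneg)
qed

lemma ext_tendsto:
  assumes "L2_tendsto B.M F f" "\<And>n. F n \<in> L2 B.M" "f \<in> L2 B.M"
  shows "L2_tendsto A.M (\<lambda>n. ext (F n)) (ext f)"
proof -
  have "(\<lambda>t. ext (F n) t - ext f t) = ext (\<lambda>t. F n t - f t)" for n
    by (simp add: ext_def fun_eq_iff scaleR_diff_right)
  then show ?thesis
    using assms(1) ext_norm[OF L2_diff[OF assms(2,3)]] by (simp add: L2_tendsto_def)
qed

text \<open>The representatives \<open>g\<close> and \<open>w\<close> already live on the whole line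
  and vanish off \<open>[x, y]\<close>, which lies inside \<open>(c, d)\<close>; there both sets of
  coefficients agree, so the integral equations carry over unchanged.\<close>

lemma ext_core:
  assumes "B.core f h g w x y"
  shows "A.core (ext f) (ext h) g w x y"
proof -
  note c = B.coreD[OF assms]
  have sub: "{x..y} \<subseteq> {c<..<d}" using c(1-3) by auto
  have gw: "g t = 0" "w t = 0" if "t \<notin> {c<..<d}" for t using c(9,10)[of t] sub that by blast+
  have eq1: "(\<lambda>u. A.P u *\<^sub>R w u - A.S u *\<^sub>R g u) = (\<lambda>u. B.P u *\<^sub>R w u - B.S u *\<^sub>R g u)"
  proof
    show "A.P u *\<^sub>R w u - A.S u *\<^sub>R g u = B.P u *\<^sub>R w u - B.S u *\<^sub>R g u" for u
      using coefficients_inside[of u] gw[of u] by (cases "u \<in> {c<..<d}") simp_all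
  qed
  have eq2: "(\<lambda>u. A.S u *\<^sub>R w u + A.Q u *\<^sub>R g u - A.R u *\<^sub>R ext h u) = (\<lambda>u. B.S u *\<^sub>R w u + B.Q u *\<^sub>R g u - B.R u *\<^sub>R h u)"
  proof
    show "A.S u *\<^sub>R w u + A.Q u *\<^sub>R g u - A.R u *\<^sub>R ext h u = B.S u *\<^sub>R w u + B.Q u *\<^sub>R g u - B.R u *\<^sub>R h u" for u
      unfolding R_ext using coefficients_inside[of u] gw[of u] by (cases "u \<in> {c<..<d}") simp_all
  qed
  show ?thesis
    unfolding A.core_def
  proof (intro conjI allI impI)
    show "AE t in lebesgue. t \<in> {a<..<b} \<longrightarrow> ext f t = g t"
      using c(6)
    proof eventually_elim
      case (elim t)
      then show ?case using gw[of t] by (cases "t \<in> {c<..<d}") (simp_all add: ext_def)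
    qed
    show "g t = prim (\<lambda>u. A.P u *\<^sub>R w u - A.S u *\<^sub>R g u) t" for t unfolding eq1 by (rule c(11))
    show "w t = prim (\<lambda>u. A.S u *\<^sub>R w u + A.Q u *\<^sub>R g u - A.R u *\<^sub>R ext h u) t" for t unfolding eq2 by (rule c(12))
  qed (use c(1-3) ac db c(7-10) ext_L2[OF c(4)] ext_L2[OF c(5)] in auto)
qed

lemma ext_T0:
  assumes "(f, h) \<in> B.T0"
  shows "(ext f, ext h) \<in> A.T0"
proof -
  obtain g w x y where core: "B.core f h g w x y" by (rule B.T0_imp_core[OF assms])
  show ?thesis by (rule A.core_imp_T0[OF ext_core[OF core]])
qed

text \<open>Under equality the extended minimizing sequence of \<open>(c, d)\<close> is minimizing
  for \<open>(a, b)\<close> as well. Its limit is then an eigenfunction of the larger problem, with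
  no need to compare the two form domains.\<close>

lemma rayleigh_inf_strict_mono:
  assumes strict: "a < c \<or> d < b"
  shows "rayleigh_inf A.M A.T0 < rayleigh_inf B.M B.T0"
proof -
  obtain mA mB where "compact_op A.M A.T0 mA" "compact_op B.M B.T0 mB"
    using A.T0_compact_op B.T0_compact_op by blast
  then interpret CA: compact_op A.M A.T0 mA + CB: compact_op B.M B.T0 mB by auto
  obtain F H f where F: "\<And>n. (F n, H n) \<in> B.T0" "\<And>n. L2_norm B.M (F n) = 1"
    "(\<lambda>n. Re (L2_inner B.M (F n) (H n))) \<longlonglongrightarrow> rayleigh_inf B.M B.T0" "f \<in> L2 B.M" "L2_tendsto B.M F f"
    by (rule CB.ground_state) (rule that)
  have L2: "F n \<in> L2 B.M" "H n \<in> L2 B.M" for n using CB.L2[OF F(1)] by auto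
  have E: "(ext (F n), ext (H n)) \<in> A.T0" "L2_norm A.M (ext (F n)) = 1"
    "L2_inner A.M (ext (F n)) (ext (H n)) = L2_inner B.M (F n) (H n)" for n
    using ext_T0[OF F(1)] ext_norm[OF L2(1)] F(2) ext_inner[OF L2] by auto
  have lim: "(\<lambda>n. Re (L2_inner A.M (ext (F n)) (ext (H n)))) \<longlonglongrightarrow> rayleigh_inf B.M B.T0"
    unfolding E(3) by (rule F(3))
  have le: "rayleigh_inf A.M A.T0 \<le> rayleigh_inf B.M B.T0"
    by (rule LIMSEQ_le_const[OF lim]) (use CA.rayleigh_inf_le[OF E(1,2)] in blast)
  have "rayleigh_inf A.M A.T0 \<noteq> rayleigh_inf B.M B.T0"
  proof
    assume eq: "rayleigh_inf A.M A.T0 = rayleigh_inf B.M B.T0"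
    let ?f = "ext f"
    have f: "?f \<in> L2 A.M" by (rule ext_L2[OF F(4)])
    note min = CA.friedrichs_minimizing_sequence[OF E(1,2) lim[folded eq] f ext_tendsto[OF F(5) L2(1) F(4)]]
    have orth: "L2_inner A.M k ?f = of_real (rayleigh_inf A.M A.T0) * L2_inner A.M g ?f" if "(g, k) \<in> A.T0" for g k
      using CA.friedrichs_closure_inner[OF min(1) that] by (simp add: L2_inner_mult)
    \<comment> \<open>The gap left by \<open>(c, d)\<close>, either \<open>(a, c)\<close> or
      \<open>(d, b)\<close>: strict containment enters here.\<close>
    obtain u1 u2 where u: "a \<le> u1" "u1 < u2" "u2 \<le> b" "{u1<..<u2} \<inter> {c<..<d} = {}"
    proof (cases "a < c")
      case True
      then show thesis using B.ab db by (intro that[of a c]) auto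
    next
      case False
      then have "d < b" using strict by simp
      then show thesis using B.ab ac by (intro that[of d b]) auto
    qed
    have "AE t in A.M. ?f t = 0"
    proof (rule A.unique_continuation[OF f u(1-3) _ orth])
      show "AE t in lebesgue. t \<in> {u1<..<u2} \<longrightarrow> ?f t = 0"
      proof (rule AE_I2, rule impI)
        fix t assume "t \<in> {u1<..<u2}"
        then have "t \<notin> {c<..<d}" using u(4) by blast
        then show "?f t = 0" by (simp add: ext_def)
      qed
    qed
    then show False using min(2) L2_norm_eq_0_iff[OF f] by simp
  qed
  then show ?thesis using le by simp
qed

end

theorem theorem1p1:
  fixes a b c d :: real
    and p q r s :: "real \<Rightarrow> real"
  assumes "a < b"
    and "p \<in> borel_measurable (lebesgue_on {a<..<b})"
    and "q \<in> borel_measurable (lebesgue_on {a<..<b})"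
    and "r \<in> borel_measurable (lebesgue_on {a<..<b})"
    and "s \<in> borel_measurable (lebesgue_on {a<..<b})"
    and "AE x in lebesgue_on {a<..<b}. p x > 0"
    and "AE x in lebesgue_on {a<..<b}. r x > 0"
    and "integrable (lebesgue_on {a<..<b}) (\<lambda>x. 1 / p x)"
    and "integrable (lebesgue_on {a<..<b}) q"
    and "integrable (lebesgue_on {a<..<b}) r"
    and "integrable (lebesgue_on {a<..<b}) s"
    and "c < d"
    and "(a \<le> c \<and> d < b) \<or> (a < c \<and> d \<le> b)"
  shows "lowest_eigenvalue (weighted r a b) (T_F p q r s a b)
       < lowest_eigenvalue (weighted r c d) (T_F p q r s c d)"
proof -
  have ab: "SL_regular p q r s a b"
    by (rule SL_regular.intro) fact+
  have cd: "SL_regular p q r s c d"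
    by (rule SL_regular_subinterval[OF ab]) (use assms(12,13) in auto)
  interpret SL_subinterval p q r s a b c d
    by (intro SL_subinterval.intro ab cd SL_subinterval_axioms.intro) (use assms(13) in auto)
  show ?thesis
    unfolding A.lowest_eigenvalue_T_F B.lowest_eigenvalue_T_F
    using rayleigh_inf_strict_mono assms(13) by auto
qed

end
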